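(* Let $q:\mathbb{R}^2\to\mathbb{R}$ be a regular kernel, let $f=q\star W$ be the associated Gaussian field and $\rho=\mathcal{F}[q]$ (see context). Suppose that for some $\beta>1$ there is $c>0$ such that $|\partial^\alpha q(x)|<c|x|^{-\beta}$ for every $|x|>1$ and every multi-index $\alpha$ with $|\alpha|\le1$, and suppose that there exists a neighbourhood $V$ of $0$ such that $\inf_V|\rho|>0$. Then there exist $c_1,c_2>0$ and $R_0>0$ such that, for every $R_1,R_2\ge R_0$, $r\ge1$, $t_1\ge\log R_1$ and $t_2\ge\log R_2$, every pair of Borel sets $D_1,D_2\subset\mathbb{R}^2$ of diameter at most $R_1$ and $R_2$ respectively and such that $r=\mathrm{dist}(D_1,D_2)$, and every pair of monotonic events $A\in\mathcal{F}_{D_1}$ and $B\in\mathcal{F}_{D_2}$, $$\left|\mathbb{P}[f\in A\cap B]-\mathbb{P}[f\in A]\,\mathbb{P}[f\in B]\right|\le c_1R_1t_1r^{1-\beta}+c_1e^{-c_2t_1^2}+c_1R_2t_2r^{1-\beta}+c_1e^{-c_2t_2^2}.$$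
   Context: $W$ is planar white noise: a centred Gaussian process indexed by $L^2(\mathbb{R}^2)$ with $\mathbb{E}[\int q_1\,dW\int q_2\,dW]=\int q_1(y)q_2(y)\,dy$. For $q\in L^2(\mathbb{R}^2)$, $(q\star W)(x)=\int q(x-u)\,dW(u)$. $\mathcal{F}[\cdot]$ denotes the Fourier transform, $\mathcal{F}[g](s)=\int e^{2\pi i\langle x,s\rangle}g(x)\,dx$, extended to $L^2$. Regular kernel: $q:\mathbb{R}^2\to\mathbb{R}$ is called a regular kernel if $q\in L^2(\mathbb{R}^2)$, $q(-x)=q(x)$ for all $x$, $q$ is $C^3$, there exist $\varepsilon,c>0$ such that $|\partial^\alpha q(x)|\le c|x|^{-(1+\varepsilon)}$ for every multi-index $\alpha$ with $|\alpha|\le 3$, and the support of $\rho=\mathcal{F}[q]$ contains a non-empty open set. For a regular kernel $q$, $f$ denotes a continuous (in fact a.s. $C^2$) modification of $q\star W$, a stationary centred Gaussian field. For a Borel set $D\subseteq\mathbb{R}^2$, $\mathcal{F}_D$ is the $\sigma$-algebra on $C(\mathbb{R}^2)$ (continuous functions $\mathbb{R}^2\to\mathbb{R}$) generated by the evaluations $u\mapsto u(x)$, $x\in D$. An event $A\subseteq C(\mathbb{R}^2)$ is increasing if $u\in A$, $v\in C(\mathbb{R}^2)$ and $v\ge u$ imply $v\in A$; decreasing if its complement is increasing; monotonic if it is increasing or decreasing. $\mathrm{dist}$ is Euclidean distance. *)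

theory Defs
  imports "HOL-Probability.Probability"
begin

text \<open>The space \<open>L\<^sup>2\<close> with respect to Lebesgue measure, represented by genuine Borel functions
  rather than by classes modulo null sets.\<close>

definition square_integrable :: "(real^2 \<Rightarrow> 'b::euclidean_space) \<Rightarrow> bool" where
  "square_integrable g \<longleftrightarrow>
     g \<in> borel_measurable lborel \<and> integrable lborel (\<lambda>x. (norm (g x))\<^sup>2)"


subsection \<open>Fourier transform on \<open>L\<^sup>2\<close>\<close>

definition fourier_L1 :: "(real^2 \<Rightarrow> complex) \<Rightarrow> real^2 \<Rightarrow> complex" where
  "fourier_L1 g s = (LINT x|lborel. cis (2 * pi * (x \<bullet> s)) * g x)"

text \<open>\<open>\<rho>\<close> is (a representative of) the Fourier transform of \<open>g \<in> L\<^sup>2\<close>: the \<open>L\<^sup>2\<close>-limit of the Fourier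
  integrals of functions in \<open>L\<^sup>1 \<inter> L\<^sup>2\<close> that converge to \<open>g\<close> in \<open>L\<^sup>2\<close>. It is determined
  up to null sets, hence a relation and not a function.\<close>

definition is_fourier_transform :: "(real^2 \<Rightarrow> complex) \<Rightarrow> (real^2 \<Rightarrow> complex) \<Rightarrow> bool" where
  "is_fourier_transform g \<rho> \<longleftrightarrow>
     square_integrable g \<and> square_integrable \<rho> \<and>
     (\<exists>h :: nat \<Rightarrow> real^2 \<Rightarrow> complex.
        (\<forall>n. integrable lborel (h n) \<and> square_integrable (h n)) \<and>
        (\<lambda>n. \<integral>\<^sup>+x. ennreal ((norm (h n x - g x))\<^sup>2) \<partial>lborel) \<longlonglongrightarrow> 0 \<and>
        (\<lambda>n. \<integral>\<^sup>+s. ennreal ((norm (fourier_L1 (h n) s - \<rho> s))\<^sup>2) \<partial>lborel) \<longlonglongrightarrow> 0)"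

text \<open>Support of a function defined up to null sets: the complement of the largest open set on
  which it vanishes almost everywhere.\<close>

definition ess_support :: "(real^2 \<Rightarrow> complex) \<Rightarrow> (real^2) set" where
  "ess_support \<rho> = - \<Union>{U. open U \<and> (AE s in lborel. s \<in> U \<longrightarrow> \<rho> s = 0)}"


subsection \<open>Regular kernels\<close>

definition partial_deriv :: "2 \<Rightarrow> (real^2 \<Rightarrow> real) \<Rightarrow> real^2 \<Rightarrow> real" where
  "partial_deriv i g x = deriv (\<lambda>t. g (x + t *\<^sub>R axis i 1)) 0"

text \<open>\<open>multi_deriv (a, b)\<close> is the derivative for the multi-index \<open>(a, b)\<close>, of order \<open>a + b\<close>; in the index
  type \<open>2\<close> the two coordinates are \<open>1\<close> and \<open>2\<close> (the latter equal to \<open>0\<close>).\<close>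

fun multi_deriv :: "nat \<times> nat \<Rightarrow> (real^2 \<Rightarrow> real) \<Rightarrow> real^2 \<Rightarrow> real" where
  "multi_deriv (a, b) g = (partial_deriv 1 ^^ a) ((partial_deriv 2 ^^ b) g)"

fun Ck :: "nat \<Rightarrow> (real^2 \<Rightarrow> real) \<Rightarrow> bool" where
  "Ck 0 g \<longleftrightarrow> continuous_on UNIV g"
| "Ck (Suc k) g \<longleftrightarrow> (\<forall>x. g differentiable (at x)) \<and> (\<forall>i. Ck k (partial_deriv i g))"

text \<open>The decay bound is imposed for \<open>x \<noteq> 0\<close> only: at \<open>0\<close> its right-hand side is infinite on paper, but
  \<open>0 powr a = 0\<close>.\<close>

definition regular_kernel :: "(real^2 \<Rightarrow> real) \<Rightarrow> bool" where
  "regular_kernel q \<longleftrightarrow>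
     square_integrable q \<and>
     (\<forall>x. q (- x) = q x) \<and>
     Ck 3 q \<and>
     (\<exists>\<epsilon>>0. \<exists>c>0. \<forall>a b. a + b \<le> 3 \<longrightarrow>
        (\<forall>x. x \<noteq> 0 \<longrightarrow> \<bar>multi_deriv (a, b) q x\<bar> \<le> c * norm x powr (- (1 + \<epsilon>)))) \<and>
     (\<exists>\<rho>. is_fourier_transform (\<lambda>x. complex_of_real (q x)) \<rho> \<and>
        (\<exists>U. open U \<and> U \<noteq> {} \<and> U \<subseteq> ess_support \<rho>))"


subsection \<open>White noise and the Gaussian field\<close>

text \<open>Normal law, the degenerate case of variance \<open>0\<close> included.\<close>

definition gaussian_rv :: "'w measure \<Rightarrow> ('w \<Rightarrow> real) \<Rightarrow> bool" where
  "gaussian_rv M X \<longleftrightarrow>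
     X \<in> borel_measurable M \<and>
     (\<exists>\<mu> \<sigma>. (\<sigma> = 0 \<and> (AE \<omega> in M. X \<omega> = \<mu>)) \<or>
            (\<sigma> > 0 \<and> distributed M lborel X (\<lambda>x. ennreal (normal_density \<mu> \<sigma> x))))"

definition gaussian_process :: "'w measure \<Rightarrow> 'i set \<Rightarrow> ('i \<Rightarrow> 'w \<Rightarrow> real) \<Rightarrow> bool" where
  "gaussian_process M T X \<longleftrightarrow>
     (\<forall>S a. finite S \<and> S \<subseteq> T \<longrightarrow> gaussian_rv M (\<lambda>\<omega>. \<Sum>t\<in>S. a t * X t \<omega>))"

text \<open>\<open>W g\<close> stands for the stochastic integral of \<open>g\<close> against the noise.\<close>

definition white_noise :: "'w measure \<Rightarrow> ((real^2 \<Rightarrow> real) \<Rightarrow> 'w \<Rightarrow> real) \<Rightarrow> bool" where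
  "white_noise M W \<longleftrightarrow>
     prob_space M \<and>
     gaussian_process M {g. square_integrable g} W \<and>
     (\<forall>g. square_integrable g \<longrightarrow> (LINT \<omega>|M. W g \<omega>) = 0) \<and>
     (\<forall>g h. square_integrable g \<longrightarrow> square_integrable h \<longrightarrow>
        (LINT \<omega>|M. W g \<omega> * W h \<omega>) = (LINT y|lborel. g y * h y))"

definition noise_conv ::
  "(real^2 \<Rightarrow> real) \<Rightarrow> ((real^2 \<Rightarrow> real) \<Rightarrow> 'w \<Rightarrow> real) \<Rightarrow> real^2 \<Rightarrow> 'w \<Rightarrow> real" where
  "noise_conv q W x = W (\<lambda>u. q (x - u))"

definition continuous_modification ::
  "'w measure \<Rightarrow> (real^2 \<Rightarrow> 'w \<Rightarrow> real) \<Rightarrow> (real^2 \<Rightarrow> 'w \<Rightarrow> real) \<Rightarrow> bool" where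
  "continuous_modification M g f \<longleftrightarrow>
     (\<forall>x. f x \<in> borel_measurable M) \<and>
     (\<forall>x. AE \<omega> in M. f x \<omega> = g x \<omega>) \<and>
     (\<forall>\<omega>\<in>space M. continuous_on UNIV (\<lambda>x. f x \<omega>))"


subsection \<open>Events\<close>

definition C_plane :: "(real^2 \<Rightarrow> real) set" where
  "C_plane = {u. continuous_on UNIV u}"

definition eval_events :: "(real^2) set \<Rightarrow> (real^2 \<Rightarrow> real) set set" where
  "eval_events D =
     sigma_sets C_plane {{u \<in> C_plane. u x \<in> S} | x S. x \<in> D \<and> S \<in> sets borel}"

definition increasing_event :: "(real^2 \<Rightarrow> real) set \<Rightarrow> bool" where
  "increasing_event A \<longleftrightarrow>
     A \<subseteq> C_plane \<and> (\<forall>u v. u \<in> A \<longrightarrow> v \<in> C_plane \<longrightarrow> (\<forall>x. u x \<le> v x) \<longrightarrow> v \<in> A)"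

definition decreasing_event :: "(real^2 \<Rightarrow> real) set \<Rightarrow> bool" where
  "decreasing_event A \<longleftrightarrow> A \<subseteq> C_plane \<and> increasing_event (C_plane - A)"

definition monotonic_event :: "(real^2 \<Rightarrow> real) set \<Rightarrow> bool" where
  "monotonic_event A \<longleftrightarrow> increasing_event A \<or> decreasing_event A"

end

theory Submission
  imports Defs "HOL-Real_Asymp.Real_Asymp"
begin

text \<open>
  Let \<open>q\<^sub>r\<close> be \<open>q\<close> cut off at distance \<open>r / 2\<close>. The field \<open>g = q\<^sub>r \<star> W\<close> has no correlation at
  distance \<open>r\<close>, so its restrictions to \<open>D\<^sub>1\<close> and \<open>D\<^sub>2\<close> are independent, and it suffices to replace \<open>f\<close> by
  \<open>g\<close> on each of the two sets. The difference \<open>f - g\<close> has standard deviation and \<open>L\<^sup>2\<close> Lipschitz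
  constant of order \<open>r\<close> to the power \<open>1 - \<beta>\<close>, and by chaining its supremum over \<open>D\<close> is below a
  multiple \<open>\<epsilon>\<close> of \<open>t\<close> times that power, except with probability of order \<open>exp (- t\<^sup>2)\<close>. Off that event, an
  increasing event distinguishes \<open>f\<close> from \<open>g\<close> only if it contains \<open>f + \<epsilon>\<close> and not \<open>f - \<epsilon>\<close>. By
  Cameron--Martin this has probability at most a multiple of \<open>\<epsilon>\<close> times the norm, in the
  reproducing kernel space of \<open>f\<close>, of a function that is at least \<open>1\<close> on \<open>D\<close>. As \<open>\<rho>\<close> is bounded below near \<open>0\<close>,
  a function with Fourier transform concentrated at scale \<open>1 / R\<close> shows that this norm is of
  order \<open>R\<close>.

  A continuous version of \<open>g\<close> is never constructed: \<open>g\<close> is only used on finite nets of \<open>D\<close>, through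
  a positive interpolation operator.
\<close>

section \<open>Gaussian spaces and independence\<close>

text \<open>The term R t r^(1 - \<beta>) is a product of two scales: \<open>f - g\<close> is of size
  t r^(1 - \<beta>) on D, and shifting the field by a constant on D costs a Cameron-Martin norm of
  order R. The assumption t >= log R serves the chaining: a set of diameter R has grids of
  cardinality polynomial in R, that is at most exp (const t), and Gaussian tails at level t absorb
  this. The radius threshold is at least e, so that t >= 1 and lower powers of t are absorbed by
  t^2. The obstacle is that the noise is a mere family of random variables, so no path property of
  \<open>g\<close> is available. Every estimate on \<open>g\<close> is therefore proved on finite
  sets of points, with constants independent of their number; the fineness of the net is dictated by
  the modulus of continuity of \<open>f\<close> alone and costs an arbitrarily small probability,
  removed at the very end. For finite vectors, independence is derived from the one-dimensional
  uniqueness theorem for characteristic functions by inserting nonnegative trigonometric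
  weights.\<close>

lemma borel_measurable_cis[measurable]: "cis \<in> borel_measurable borel"
  by (intro borel_measurable_continuous_onI) (auto intro!: continuous_intros)

section \<open>Uniqueness of finite-dimensional laws under nonnegative weights\<close>

context prob_space
begin

text \<open>Frequency 0 shows that the two weights have the same mass m. If m > 0, dividing by m
  turns both into probability densities under which \<open>X\<close> has the same characteristic
  function, and Levy's uniqueness theorem applies. Weights are carried along because the induction
  on the number of coordinates stores in them the coordinates already treated.\<close>

lemma weighted_law_unique:
  fixes V V' X :: "'a \<Rightarrow> real"
  assumes X[measurable]: "X \<in> borel_measurable M"
    and V: "integrable M V" "\<And>\<omega>. 0 \<le> V \<omega>" and V': "integrable M V'" "\<And>\<omega>. 0 \<le> V' \<omega>"
    and cos_eq: "\<And>u. expectation (\<lambda>\<omega>. V \<omega> * cos (u * X \<omega>)) = expectation (\<lambda>\<omega>. V' \<omega> * cos (u * X \<omega>))"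
    and sin_eq: "\<And>u. expectation (\<lambda>\<omega>. V \<omega> * sin (u * X \<omega>)) = expectation (\<lambda>\<omega>. V' \<omega> * sin (u * X \<omega>))"
    and B[measurable]: "B \<in> sets borel"
  shows "expectation (\<lambda>\<omega>. V \<omega> * indicat_real B (X \<omega>)) = expectation (\<lambda>\<omega>. V' \<omega> * indicat_real B (X \<omega>))"
proof -
  note [measurable] = borel_measurable_integrable[OF V(1)] borel_measurable_integrable[OF V'(1)]
  define m where "m = expectation V"
  have m': "m = expectation V'" using cos_eq[of 0] by (simp add: m_def)
  show ?thesis
  proof (cases "m = 0")
    case True
    have "AE \<omega> in M. V \<omega> = 0"
      using integral_nonneg_eq_0_iff_AE[OF V(1)] V(2) True m_def by auto
    moreover have "AE \<omega> in M. V' \<omega> = 0"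
      using integral_nonneg_eq_0_iff_AE[OF V'(1)] V'(2) True m' by auto
    ultimately show ?thesis by (intro integral_cong_AE) auto
  next
    case False
    have "m \<ge> 0" using V(2) by (simp add: m_def)
    with False have m: "m > 0" by simp
    define law where "law U = distr (density M (\<lambda>\<omega>. ennreal (U \<omega> / m))) borel X" for U :: "'a \<Rightarrow> real"
    have law: "real_distribution (law U)"
      "char (law U) t = Complex (expectation (\<lambda>\<omega>. U \<omega> * cos (t * X \<omega>)) / m) (expectation (\<lambda>\<omega>. U \<omega> * sin (t * X \<omega>)) / m)"
      "measure (law U) B = expectation (\<lambda>\<omega>. U \<omega> * indicat_real B (X \<omega>)) / m"
      if U: "integrable M U" "\<And>\<omega>. 0 \<le> U \<omega>" "expectation U = m" for U t
    proof -
      note [measurable] = borel_measurable_integrable[OF U(1)]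
      have "emeasure (density M (\<lambda>\<omega>. ennreal (U \<omega> / m))) (space M) = (\<integral>\<^sup>+\<omega>. ennreal (U \<omega> / m) \<partial>M)"
        by (subst emeasure_density) (auto intro!: nn_integral_cong)
      also have "\<dots> = ennreal (expectation (\<lambda>\<omega>. U \<omega> / m))"
        using U m by (intro nn_integral_eq_integral) auto
      also have "\<dots> = 1" using U(3) m by simp
      finally have ps: "prob_space (density M (\<lambda>\<omega>. ennreal (U \<omega> / m)))"
        by (intro prob_spaceI) simp
      then interpret L: prob_space "density M (\<lambda>\<omega>. ennreal (U \<omega> / m))" .
      show "real_distribution (law U)"
        unfolding law_def by (intro L.real_distribution_distr) simp
      have int: "integrable M (\<lambda>\<omega>. U \<omega> * cos (t * X \<omega>))" "integrable M (\<lambda>\<omega>. U \<omega> * sin (t * X \<omega>))"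
        by (rule Bochner_Integration.integrable_bound[OF U(1)]; auto simp: abs_mult intro!: mult_left_le)+
      have "char (law U) t = (CLINT \<omega>|M. (U \<omega> / m) *\<^sub>R iexp (t * X \<omega>))"
        unfolding law_def char_def using U(2) m
        by (simp add: integral_distr integral_density)
      also have "\<dots> = (CLINT \<omega>|M. complex_of_real (U \<omega> * cos (t * X \<omega>) / m) + \<i> * complex_of_real (U \<omega> * sin (t * X \<omega>) / m))"
        by (intro Bochner_Integration.integral_cong refl)
           (simp del: of_real_mult add: cis_conv_exp[symmetric] complex_eq_iff)
      also have "\<dots> = complex_of_real (expectation (\<lambda>\<omega>. U \<omega> * cos (t * X \<omega>) / m)) + \<i> * complex_of_real (expectation (\<lambda>\<omega>. U \<omega> * sin (t * X \<omega>) / m))"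
        using int by (subst Bochner_Integration.integral_add) (auto simp del: of_real_mult of_real_divide)
      finally show "char (law U) t = Complex (expectation (\<lambda>\<omega>. U \<omega> * cos (t * X \<omega>)) / m) (expectation (\<lambda>\<omega>. U \<omega> * sin (t * X \<omega>)) / m)"
        by (simp add: complex_eq_iff)
      have "measure (law U) B = (LINT \<omega>|law U. indicat_real B \<omega>)"
        by (simp add: law_def)
      also have "\<dots> = expectation (\<lambda>\<omega>. (U \<omega> / m) *\<^sub>R indicat_real B (X \<omega>))"
        unfolding law_def using U(2) m
        by (subst integral_distr) (auto simp: integral_density)
      finally show "measure (law U) B = expectation (\<lambda>\<omega>. U \<omega> * indicat_real B (X \<omega>)) / m"
        by simp
    qed
    have "law V = law V'"
      using law(1,2)[of V] law(1,2)[of V'] V V' m' cos_eq sin_eq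
      by (intro Levy_uniqueness) (auto simp: m_def)
    then show ?thesis using law(3)[of V] law(3)[of V'] V V' m' m by (simp add: m_def)
  qed
qed

lemma integrable_weight_bounded:
  fixes V g :: "'a \<Rightarrow> real"
  assumes V: "integrable M V" and g: "g \<in> borel_measurable M" "\<And>\<omega>. \<bar>g \<omega>\<bar> \<le> K"
  shows "integrable M (\<lambda>\<omega>. V \<omega> * g \<omega>)"
proof (rule Bochner_Integration.integrable_bound[where f = "\<lambda>\<omega>. K * V \<omega>"])
  have "0 \<le> K" using g(2)[of undefined] by linarith
  then show "AE \<omega> in M. norm (V \<omega> * g \<omega>) \<le> norm (K * V \<omega>)"
    using g(2) by (auto simp: abs_mult mult.commute[of "\<bar>V _\<bar>"] intro!: mult_right_mono)
qed (use V g(1) in \<open>auto intro!: borel_measurable_times\<close>)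

text \<open>Cramer-Wold, one coordinate at a time: multiplying the weight by \<open>1 + cos Y\<close> or \<open>1 + sin Y\<close>,
  where \<open>Y\<close> is a combination of the remaining coordinates, keeps it nonnegative and turns the
  one-dimensional uniqueness theorem into the statement for one coordinate less.\<close>

lemma weighted_joint_law_unique_box:
  fixes V V' :: "'a \<Rightarrow> real" and X :: "'i \<Rightarrow> 'a \<Rightarrow> real"
  assumes "finite I" and X: "\<And>i. i \<in> I \<Longrightarrow> X i \<in> borel_measurable M"
    and V: "integrable M V" "\<And>\<omega>. 0 \<le> V \<omega>" and V': "integrable M V'" "\<And>\<omega>. 0 \<le> V' \<omega>"
    and cos_eq: "\<And>a. expectation (\<lambda>\<omega>. V \<omega> * cos (\<Sum>i\<in>I. a i * X i \<omega>)) = expectation (\<lambda>\<omega>. V' \<omega> * cos (\<Sum>i\<in>I. a i * X i \<omega>))"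
    and sin_eq: "\<And>a. expectation (\<lambda>\<omega>. V \<omega> * sin (\<Sum>i\<in>I. a i * X i \<omega>)) = expectation (\<lambda>\<omega>. V' \<omega> * sin (\<Sum>i\<in>I. a i * X i \<omega>))"
    and B: "\<And>i. i \<in> I \<Longrightarrow> B i \<in> sets borel"
  shows "expectation (\<lambda>\<omega>. V \<omega> * (\<Prod>i\<in>I. indicat_real (B i) (X i \<omega>))) = expectation (\<lambda>\<omega>. V' \<omega> * (\<Prod>i\<in>I. indicat_real (B i) (X i \<omega>)))"
  using assms
proof (induction I arbitrary: V V')
  case empty
  \<comment> \<open>The empty sum has cosine 1, so the hypothesis reduces to equality of the masses,
    whatever the coefficients.\<close>
  show ?case using empty.prems(6)[of undefined] by simp
next
  case (insert k I V V')
  have [measurable]: "X k \<in> borel_measurable M" and [measurable]: "B k \<in> sets borel"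
    using insert.prems by auto
  have Y[measurable]: "(\<lambda>\<omega>. \<Sum>i\<in>I. a i * X i \<omega>) \<in> borel_measurable M" for a
    using insert.prems by auto
  let ?Y = "\<lambda>a \<omega>. \<Sum>i\<in>I. a i * X i \<omega>"
  let ?b = "\<lambda>\<omega>. indicat_real (B k) (X k \<omega>)"
  have int: "integrable M (\<lambda>\<omega>. U \<omega> * g \<omega>)"
    if "U = V \<or> U = V'" "g \<in> borel_measurable M" "\<And>\<omega>. \<bar>g \<omega>\<bar> \<le> K" for U g K
    using that insert.prems by (auto intro!: integrable_weight_bounded[where K = K])
  have comb: "expectation (\<lambda>\<omega>. V \<omega> * cos (u * X k \<omega> + ?Y a \<omega>)) = expectation (\<lambda>\<omega>. V' \<omega> * cos (u * X k \<omega> + ?Y a \<omega>))"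
      "expectation (\<lambda>\<omega>. V \<omega> * sin (u * X k \<omega> + ?Y a \<omega>)) = expectation (\<lambda>\<omega>. V' \<omega> * sin (u * X k \<omega> + ?Y a \<omega>))" for u a
  proof -
    have "(\<Sum>i\<in>insert k I. (a(k := u)) i * X i \<omega>) = u * X k \<omega> + ?Y a \<omega>" for \<omega>
      using insert.hyps by (simp, intro sum.cong) auto
    then show "expectation (\<lambda>\<omega>. V \<omega> * cos (u * X k \<omega> + ?Y a \<omega>)) = expectation (\<lambda>\<omega>. V' \<omega> * cos (u * X k \<omega> + ?Y a \<omega>))"
      "expectation (\<lambda>\<omega>. V \<omega> * sin (u * X k \<omega> + ?Y a \<omega>)) = expectation (\<lambda>\<omega>. V' \<omega> * sin (u * X k \<omega> + ?Y a \<omega>))"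
      using insert.prems(6,7)[of "a(k := u)"] by (simp_all del: sum.insert)
  qed
  have comb0: "expectation (\<lambda>\<omega>. V \<omega> * cos (u * X k \<omega>)) = expectation (\<lambda>\<omega>. V' \<omega> * cos (u * X k \<omega>))"
      "expectation (\<lambda>\<omega>. V \<omega> * sin (u * X k \<omega>)) = expectation (\<lambda>\<omega>. V' \<omega> * sin (u * X k \<omega>))" for u
    using comb[of u "\<lambda>_. 0"] by simp_all
  have neg: "?Y (\<lambda>i. - a i) \<omega> = - ?Y a \<omega>" for a \<omega> by (simp add: sum_negf)
  have i: "integrable M (\<lambda>\<omega>. U \<omega> * cos (u * X k \<omega> + ?Y a \<omega>))" "integrable M (\<lambda>\<omega>. U \<omega> * sin (u * X k \<omega> + ?Y a \<omega>))"
    if U: "U = V \<or> U = V'" for U u a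
    by (rule int[OF U, of _ 1]; simp)+
  have avg: "expectation f = (expectation g + expectation h) / 2"
    if "integrable M g" "integrable M h" "\<And>\<omega>. f \<omega> = (g \<omega> + h \<omega>) / 2" for f g h :: "'a \<Rightarrow> real"
    unfolding that(3) using that(1,2) by simp
  have dif: "expectation f = (expectation g - expectation h) / 2"
    if "integrable M g" "integrable M h" "\<And>\<omega>. f \<omega> = (g \<omega> - h \<omega>) / 2" for f g h :: "'a \<Rightarrow> real"
    unfolding that(3) using that(1,2) by simp
  \<comment> \<open>Product-to-sum formulas: u X k + Y and u X k - Y are both linear combinations of
    the coordinates, so the hypotheses reach all four products.\<close>
  have half: "expectation (\<lambda>\<omega>. U \<omega> * (cos (u * X k \<omega>) * cos (?Y a \<omega>))) = (expectation (\<lambda>\<omega>. U \<omega> * cos (u * X k \<omega> + ?Y a \<omega>)) + expectation (\<lambda>\<omega>. U \<omega> * cos (u * X k \<omega> + ?Y (\<lambda>i. - a i) \<omega>))) / 2"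
      "expectation (\<lambda>\<omega>. U \<omega> * (sin (u * X k \<omega>) * cos (?Y a \<omega>))) = (expectation (\<lambda>\<omega>. U \<omega> * sin (u * X k \<omega> + ?Y a \<omega>)) + expectation (\<lambda>\<omega>. U \<omega> * sin (u * X k \<omega> + ?Y (\<lambda>i. - a i) \<omega>))) / 2"
      "expectation (\<lambda>\<omega>. U \<omega> * (cos (u * X k \<omega>) * sin (?Y a \<omega>))) = (expectation (\<lambda>\<omega>. U \<omega> * sin (u * X k \<omega> + ?Y a \<omega>)) - expectation (\<lambda>\<omega>. U \<omega> * sin (u * X k \<omega> + ?Y (\<lambda>i. - a i) \<omega>))) / 2"
      "expectation (\<lambda>\<omega>. U \<omega> * (sin (u * X k \<omega>) * sin (?Y a \<omega>))) = (expectation (\<lambda>\<omega>. U \<omega> * cos (u * X k \<omega> + ?Y (\<lambda>i. - a i) \<omega>)) - expectation (\<lambda>\<omega>. U \<omega> * cos (u * X k \<omega> + ?Y a \<omega>))) / 2"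
    if U: "U = V \<or> U = V'" for U u a
    by (rule avg[OF i(1)[OF U] i(1)[OF U]] avg[OF i(2)[OF U] i(2)[OF U]] dif[OF i(1)[OF U] i(1)[OF U]] dif[OF i(2)[OF U] i(2)[OF U]],
        simp only: neg, simp add: cos_add sin_add cos_diff sin_diff field_simps)+
  have prods: "expectation (\<lambda>\<omega>. V \<omega> * (cos (u * X k \<omega>) * cos (?Y a \<omega>))) = expectation (\<lambda>\<omega>. V' \<omega> * (cos (u * X k \<omega>) * cos (?Y a \<omega>)))"
     "expectation (\<lambda>\<omega>. V \<omega> * (sin (u * X k \<omega>) * cos (?Y a \<omega>))) = expectation (\<lambda>\<omega>. V' \<omega> * (sin (u * X k \<omega>) * cos (?Y a \<omega>)))"
     "expectation (\<lambda>\<omega>. V \<omega> * (cos (u * X k \<omega>) * sin (?Y a \<omega>))) = expectation (\<lambda>\<omega>. V' \<omega> * (cos (u * X k \<omega>) * sin (?Y a \<omega>)))"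
     "expectation (\<lambda>\<omega>. V \<omega> * (sin (u * X k \<omega>) * sin (?Y a \<omega>))) = expectation (\<lambda>\<omega>. V' \<omega> * (sin (u * X k \<omega>) * sin (?Y a \<omega>)))" for u a
    by (simp_all only: half[OF disjI1[OF refl]] half[OF disjI2[OF refl]] comb)
  have one_plus: "expectation (\<lambda>\<omega>. V \<omega> * (1 + g \<omega>) * ?b \<omega>) = expectation (\<lambda>\<omega>. V' \<omega> * (1 + g \<omega>) * ?b \<omega>)"
    if g[measurable]: "g \<in> borel_measurable M" and g1: "\<And>\<omega>. \<bar>g \<omega>\<bar> \<le> 1"
      and c: "\<And>u. expectation (\<lambda>\<omega>. V \<omega> * (cos (u * X k \<omega>) * g \<omega>)) = expectation (\<lambda>\<omega>. V' \<omega> * (cos (u * X k \<omega>) * g \<omega>))"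
      and s: "\<And>u. expectation (\<lambda>\<omega>. V \<omega> * (sin (u * X k \<omega>) * g \<omega>)) = expectation (\<lambda>\<omega>. V' \<omega> * (sin (u * X k \<omega>) * g \<omega>))" for g
  proof (rule weighted_law_unique)
    have bd: "\<bar>1 + g \<omega>\<bar> \<le> 2" "0 \<le> 1 + g \<omega>" for \<omega> using g1[of \<omega>] by linarith+
    show "integrable M (\<lambda>\<omega>. V \<omega> * (1 + g \<omega>))" "integrable M (\<lambda>\<omega>. V' \<omega> * (1 + g \<omega>))"
      by (rule int[of _ _ 2]; use bd in simp)+
    show "0 \<le> V \<omega> * (1 + g \<omega>)" "0 \<le> V' \<omega> * (1 + g \<omega>)" for \<omega>
      using bd insert.prems by simp_all
    have ci: "\<bar>cos x * g \<omega>\<bar> \<le> 1" "\<bar>sin x * g \<omega>\<bar> \<le> 1" for x \<omega>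
      using g1[of \<omega>] by (auto simp: abs_mult intro!: mult_le_one)
    have i: "integrable M (\<lambda>\<omega>. U \<omega> * cos (u * X k \<omega>))" "integrable M (\<lambda>\<omega>. U \<omega> * sin (u * X k \<omega>))"
      "integrable M (\<lambda>\<omega>. U \<omega> * (cos (u * X k \<omega>) * g \<omega>))" "integrable M (\<lambda>\<omega>. U \<omega> * (sin (u * X k \<omega>) * g \<omega>))"
      if "U = V \<or> U = V'" for U u
      by (rule int[OF that, of _ 1]; use ci in simp)+
    have e: "U \<omega> * (1 + g \<omega>) * cos (u * X k \<omega>) = U \<omega> * cos (u * X k \<omega>) + U \<omega> * (cos (u * X k \<omega>) * g \<omega>)"
      "U \<omega> * (1 + g \<omega>) * sin (u * X k \<omega>) = U \<omega> * sin (u * X k \<omega>) + U \<omega> * (sin (u * X k \<omega>) * g \<omega>)" for U :: "'a \<Rightarrow> real" and u \<omega>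
      by (simp_all add: algebra_simps)
    show "expectation (\<lambda>\<omega>. V \<omega> * (1 + g \<omega>) * cos (u * X k \<omega>)) = expectation (\<lambda>\<omega>. V' \<omega> * (1 + g \<omega>) * cos (u * X k \<omega>))"
      "expectation (\<lambda>\<omega>. V \<omega> * (1 + g \<omega>) * sin (u * X k \<omega>)) = expectation (\<lambda>\<omega>. V' \<omega> * (1 + g \<omega>) * sin (u * X k \<omega>))" for u
      unfolding e using i[of V] i[of V'] comb0 c s by simp_all
  qed simp_all
  have zero: "expectation (\<lambda>\<omega>. V \<omega> * ?b \<omega>) = expectation (\<lambda>\<omega>. V' \<omega> * ?b \<omega>)"
    using one_plus[of "\<lambda>_. 0"] by simp
  \<comment> \<open>Subtracting the case g = 0 removes the summand 1 that kept the weight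
    nonnegative. What remains are the trigonometric hypotheses for \<open>V\<close> times the
    indicator of the new coordinate, as the induction hypothesis demands.\<close>
  have drop1: "expectation (\<lambda>\<omega>. V \<omega> * ?b \<omega> * g \<omega>) = expectation (\<lambda>\<omega>. V' \<omega> * ?b \<omega> * g \<omega>)"
    if g[measurable]: "g \<in> borel_measurable M" and g1: "\<And>\<omega>. \<bar>g \<omega>\<bar> \<le> 1"
      and op: "expectation (\<lambda>\<omega>. V \<omega> * (1 + g \<omega>) * ?b \<omega>) = expectation (\<lambda>\<omega>. V' \<omega> * (1 + g \<omega>) * ?b \<omega>)" for g
  proof -
    have i: "integrable M (\<lambda>\<omega>. U \<omega> * ?b \<omega>)" "integrable M (\<lambda>\<omega>. U \<omega> * (?b \<omega> * g \<omega>))" if "U = V \<or> U = V'" for U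
      by (rule int[OF that, of _ 1]; use g1 in \<open>auto simp: indicator_def\<close>)+
    have "expectation (\<lambda>\<omega>. U \<omega> * (1 + g \<omega>) * ?b \<omega>) = expectation (\<lambda>\<omega>. U \<omega> * ?b \<omega>) + expectation (\<lambda>\<omega>. U \<omega> * ?b \<omega> * g \<omega>)"
      if "U = V \<or> U = V'" for U
      using i[OF that] by (subst Bochner_Integration.integral_add[symmetric]) (auto simp: algebra_simps)
    then show ?thesis using op zero by simp
  qed
  have "expectation (\<lambda>\<omega>. (V \<omega> * ?b \<omega>) * (\<Prod>i\<in>I. indicat_real (B i) (X i \<omega>))) = expectation (\<lambda>\<omega>. (V' \<omega> * ?b \<omega>) * (\<Prod>i\<in>I. indicat_real (B i) (X i \<omega>)))"
  proof (rule insert.IH)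
    show "integrable M (\<lambda>\<omega>. V \<omega> * ?b \<omega>)" "integrable M (\<lambda>\<omega>. V' \<omega> * ?b \<omega>)"
      by (rule int[of _ _ 1]; auto simp: indicator_def)+
    show "0 \<le> V \<omega> * ?b \<omega>" "0 \<le> V' \<omega> * ?b \<omega>" for \<omega> using insert.prems by simp_all
    show "expectation (\<lambda>\<omega>. V \<omega> * ?b \<omega> * cos (?Y a \<omega>)) = expectation (\<lambda>\<omega>. V' \<omega> * ?b \<omega> * cos (?Y a \<omega>))"
      "expectation (\<lambda>\<omega>. V \<omega> * ?b \<omega> * sin (?Y a \<omega>)) = expectation (\<lambda>\<omega>. V' \<omega> * ?b \<omega> * sin (?Y a \<omega>))" for a
      by (intro drop1 one_plus prods; simp)+
  qed (use insert.prems in auto)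
  then show ?case using insert.hyps by (simp add: mult.assoc)
qed

end

text \<open>Boxes are stable under intersection and generate the finite product sigma-algebra, so
  the two finite measures with densities \<open>V\<close> and \<open>V'\<close>, pushed forward by
  the vector, agree once they agree on boxes.\<close>

lemma (in prob_space) weighted_joint_law_unique:
  fixes V V' :: "'a \<Rightarrow> real" and X :: "'i \<Rightarrow> 'a \<Rightarrow> real"
  assumes fin: "finite I" and X: "\<And>i. i \<in> I \<Longrightarrow> X i \<in> borel_measurable M"
    and V: "integrable M V" "\<And>\<omega>. 0 \<le> V \<omega>" and V': "integrable M V'" "\<And>\<omega>. 0 \<le> V' \<omega>"
    and cos_eq: "\<And>a. expectation (\<lambda>\<omega>. V \<omega> * cos (\<Sum>i\<in>I. a i * X i \<omega>)) = expectation (\<lambda>\<omega>. V' \<omega> * cos (\<Sum>i\<in>I. a i * X i \<omega>))"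
    and sin_eq: "\<And>a. expectation (\<lambda>\<omega>. V \<omega> * sin (\<Sum>i\<in>I. a i * X i \<omega>)) = expectation (\<lambda>\<omega>. V' \<omega> * sin (\<Sum>i\<in>I. a i * X i \<omega>))"
    and A: "A \<in> sets (PiM I (\<lambda>_. borel))"
  shows "expectation (\<lambda>\<omega>. V \<omega> * indicat_real A (\<lambda>i\<in>I. X i \<omega>)) = expectation (\<lambda>\<omega>. V' \<omega> * indicat_real A (\<lambda>i\<in>I. X i \<omega>))"
proof -
  define law where "law U = distr (density M (\<lambda>\<omega>. ennreal (U \<omega>))) (PiM I (\<lambda>_. borel)) (\<lambda>\<omega>. \<lambda>i\<in>I. X i \<omega>)" for U :: "'a \<Rightarrow> real"
  have Xm[measurable]: "(\<lambda>\<omega>. \<lambda>i\<in>I. X i \<omega>) \<in> measurable M (PiM I (\<lambda>_. borel))"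
    using X by (intro measurable_restrict) auto
  have law: "emeasure (law U) S = ennreal (expectation (\<lambda>\<omega>. U \<omega> * indicat_real S (\<lambda>i\<in>I. X i \<omega>)))"
    "integrable M (\<lambda>\<omega>. U \<omega> * indicat_real S (\<lambda>i\<in>I. X i \<omega>))"
    if U: "integrable M U" "\<And>\<omega>. 0 \<le> U \<omega>" and S[measurable]: "S \<in> sets (PiM I (\<lambda>_. borel))" for U S
  proof -
    note [measurable] = borel_measurable_integrable[OF U(1)]
    show i: "integrable M (\<lambda>\<omega>. U \<omega> * indicat_real S (\<lambda>i\<in>I. X i \<omega>))"
      by (rule integrable_weight_bounded[OF U(1), where K = 1]) (auto simp: indicator_def)
    have "emeasure (law U) S = (\<integral>\<^sup>+\<omega>. ennreal (U \<omega>) * indicator ((\<lambda>\<omega>. \<lambda>i\<in>I. X i \<omega>) -` S \<inter> space M) \<omega> \<partial>M)"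
      unfolding law_def by (simp add: emeasure_distr emeasure_density)
    also have "\<dots> = (\<integral>\<^sup>+\<omega>. ennreal (U \<omega> * indicat_real S (\<lambda>i\<in>I. X i \<omega>)) \<partial>M)"
      by (intro nn_integral_cong) (auto simp: indicator_def)
    also have "\<dots> = ennreal (expectation (\<lambda>\<omega>. U \<omega> * indicat_real S (\<lambda>i\<in>I. X i \<omega>)))"
      using U(2) i by (intro nn_integral_eq_integral) auto
    finally show "emeasure (law U) S = ennreal (expectation (\<lambda>\<omega>. U \<omega> * indicat_real S (\<lambda>i\<in>I. X i \<omega>)))" .
  qed
  have "law V = law V'"
  proof (rule measure_eqI_PiM_finite[OF fin, where A = "\<lambda>_. Pi\<^sub>E I (\<lambda>_. UNIV)"])
    show "sets (law V) = PiM I (\<lambda>_. borel)" "sets (law V') = PiM I (\<lambda>_. borel)"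
      by (simp_all add: law_def)
    fix B :: "'i \<Rightarrow> real set" assume B: "\<And>i. i \<in> I \<Longrightarrow> B i \<in> sets borel"
    have PiB: "Pi\<^sub>E I B \<in> sets (PiM I (\<lambda>_. borel))"
      using B fin by (intro sets_PiM_I_finite) auto
    have "indicat_real (Pi\<^sub>E I B) (\<lambda>i\<in>I. X i \<omega>) = (\<Prod>i\<in>I. indicat_real (B i) (X i \<omega>))" for \<omega>
      using fin by (auto simp: indicator_def PiE_iff)
    then show "emeasure (law V) (Pi\<^sub>E I B) = emeasure (law V') (Pi\<^sub>E I B)"
      using law(1)[OF V PiB] law(1)[OF V' PiB]
        weighted_joint_law_unique_box[OF fin X V V' cos_eq sin_eq B] by simp
  next
    show "range (\<lambda>_. Pi\<^sub>E I (\<lambda>_. UNIV)) \<subseteq> prod_algebra I (\<lambda>_. borel :: real measure)"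
      using prod_algebraI_finite[OF fin, of "\<lambda>_. UNIV" "\<lambda>_. borel :: real measure"] by auto
    show "(\<Union>i::nat. Pi\<^sub>E I (\<lambda>_. UNIV)) = space (PiM I (\<lambda>_. borel :: real measure))"
      by (simp add: space_PiM)
    show "emeasure (law V) (Pi\<^sub>E I (\<lambda>_. UNIV)) \<noteq> \<infinity>"
      using fin by (subst law(1)[OF V]) auto
  qed
  then show ?thesis
    using law(1)[OF V A] law(1)[OF V' A] V(2) V'(2) by (simp add: integral_nonneg_AE)
qed

text \<open>Closure under linear combinations encodes joint Gaussianity: every finite family in
  \<open>H\<close> is a centred Gaussian vector. Members are functions rather than classes modulo
  null sets, and no completeness is assumed, since only finite families are ever used.\<close>

locale gaussian_space = prob_space M for M :: "'w measure" +
  fixes H :: "('w \<Rightarrow> real) set"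
  assumes gaussian: "X \<in> H \<Longrightarrow> gaussian_rv M X"
    and centred: "X \<in> H \<Longrightarrow> expectation X = 0"
    and zero_mem: "(\<lambda>_. 0) \<in> H"
    and add_mem: "X \<in> H \<Longrightarrow> Y \<in> H \<Longrightarrow> (\<lambda>\<omega>. X \<omega> + Y \<omega>) \<in> H"
    and scale_mem: "X \<in> H \<Longrightarrow> (\<lambda>\<omega>. c * X \<omega>) \<in> H"
begin

section \<open>Covariance calculus in a Gaussian space\<close>

lemma diff_mem: "X \<in> H \<Longrightarrow> Y \<in> H \<Longrightarrow> (\<lambda>\<omega>. X \<omega> - Y \<omega>) \<in> H"
  using add_mem[of X "\<lambda>\<omega>. (-1) * Y \<omega>"] scale_mem[of Y "-1"] by simp

lemma sum_mem: "(\<And>i. i \<in> I \<Longrightarrow> X i \<in> H) \<Longrightarrow> (\<lambda>\<omega>. \<Sum>i\<in>I. a i * X i \<omega>) \<in> H"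
proof (induction I rule: infinite_finite_induct)
  case (insert k I)
  then show ?case using add_mem[OF scale_mem[of "X k" "a k"], of "\<lambda>\<omega>. \<Sum>i\<in>I. a i * X i \<omega>"] by simp
qed (simp_all add: zero_mem)

lemma measurable_mem: "X \<in> H \<Longrightarrow> X \<in> borel_measurable M"
  using gaussian by (auto simp: gaussian_rv_def)

text \<open>Centring forces the mean to be 0 in both alternatives of \<open>gaussian_rv\<close>, so
  the second moment is the variance parameter.\<close>

lemma mem_cases:
  assumes "X \<in> H"
  obtains (null) "AE \<omega> in M. X \<omega> = 0" "expectation (\<lambda>\<omega>. (X \<omega>)\<^sup>2) = 0" "integrable M (\<lambda>\<omega>. (X \<omega>)\<^sup>2)"
  | (normal) \<sigma> where "\<sigma> > 0" "distributed M lborel X (normal_density 0 \<sigma>)"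
      "expectation (\<lambda>\<omega>. (X \<omega>)\<^sup>2) = \<sigma>\<^sup>2" "integrable M (\<lambda>\<omega>. (X \<omega>)\<^sup>2)"
proof -
  have [measurable]: "X \<in> borel_measurable M" using assms by (rule measurable_mem)
  obtain \<mu> \<sigma> where ms: "(\<sigma> = 0 \<and> (AE \<omega> in M. X \<omega> = \<mu>)) \<or>
      (\<sigma> > 0 \<and> distributed M lborel X (\<lambda>x. ennreal (normal_density \<mu> \<sigma> x)))"
    using gaussian[OF assms] by (auto simp: gaussian_rv_def)
  then show thesis
  proof
    assume *: "\<sigma> = 0 \<and> (AE \<omega> in M. X \<omega> = \<mu>)"
    then have "expectation X = expectation (\<lambda>_. \<mu>)" by (intro integral_cong_AE) auto
    then have "\<mu> = 0" using centred[OF assms] by (simp add: prob_space)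
    with * have ae: "AE \<omega> in M. X \<omega> = 0" by auto
    have "AE \<omega> in M. (X \<omega>)\<^sup>2 = 0" using ae by auto
    then have "expectation (\<lambda>\<omega>. (X \<omega>)\<^sup>2) = expectation (\<lambda>_. 0)" "integrable M (\<lambda>\<omega>. (X \<omega>)\<^sup>2) = integrable M (\<lambda>_. 0::real)"
      by (intro integral_cong_AE integrable_cong_AE; simp)+
    then show thesis using ae null by simp
  next
    assume *: "\<sigma> > 0 \<and> distributed M lborel X (\<lambda>x. ennreal (normal_density \<mu> \<sigma> x))"
    then have d: "distributed M lborel X (normal_density \<mu> \<sigma>)" and s: "\<sigma> > 0" by auto
    have "\<mu> = 0" using normal_distributed_expectation[OF s d] centred[OF assms] by simp
    with d have d0: "distributed M lborel X (normal_density 0 \<sigma>)" by simp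
    have "variance X = \<sigma>\<^sup>2" using normal_distributed_variance[OF s d0] .
    then have v: "expectation (\<lambda>\<omega>. (X \<omega>)\<^sup>2) = \<sigma>\<^sup>2" using centred[OF assms] by simp
    \<comment> \<open>A non-integrable function has integral 0 by convention, so a positive second
      moment already proves integrability.\<close>
    then have "integrable M (\<lambda>\<omega>. (X \<omega>)\<^sup>2)"
      using s not_integrable_integral_eq by fastforce
    then show thesis using normal[OF s d0 v] by simp
  qed
qed

lemma integrable_square: "X \<in> H \<Longrightarrow> integrable M (\<lambda>\<omega>. (X \<omega>)\<^sup>2)"
  by (elim mem_cases) auto

text \<open>Polarisation: \<open>X + Y\<close> lies again in \<open>H\<close> and is therefore
  square integrable.\<close>

lemma integrable_product: "X \<in> H \<Longrightarrow> Y \<in> H \<Longrightarrow> integrable M (\<lambda>\<omega>. X \<omega> * Y \<omega>)"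
proof -
  assume XY: "X \<in> H" "Y \<in> H"
  have "X \<omega> * Y \<omega> = ((X \<omega> + Y \<omega>)\<^sup>2 - (X \<omega>)\<^sup>2 - (Y \<omega>)\<^sup>2) / 2" for \<omega>
    by (simp add: power2_eq_square algebra_simps)
  then have "(\<lambda>\<omega>. X \<omega> * Y \<omega>) = (\<lambda>\<omega>. ((X \<omega> + Y \<omega>)\<^sup>2 - (X \<omega>)\<^sup>2 - (Y \<omega>)\<^sup>2) / 2)" by (rule ext)
  then show ?thesis
    using integrable_square[OF add_mem[OF XY]] integrable_square[OF XY(1)] integrable_square[OF XY(2)] by simp
qed

definition cov :: "('w \<Rightarrow> real) \<Rightarrow> ('w \<Rightarrow> real) \<Rightarrow> real" where
  "cov X Y = expectation (\<lambda>\<omega>. X \<omega> * Y \<omega>)"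

lemma cov_sym: "cov X Y = cov Y X"
  by (simp add: cov_def mult.commute)

lemma cov_self: "cov X X = expectation (\<lambda>\<omega>. (X \<omega>)\<^sup>2)"
  by (simp add: cov_def power2_eq_square)

lemma cov_self_nonneg: "0 \<le> cov X X"
  by (simp add: cov_self)

lemma cov_add: "X \<in> H \<Longrightarrow> Y \<in> H \<Longrightarrow> Z \<in> H \<Longrightarrow> cov (\<lambda>\<omega>. X \<omega> + Y \<omega>) Z = cov X Z + cov Y Z"
  by (simp add: cov_def distrib_right integrable_product)

lemma cov_scale: "cov (\<lambda>\<omega>. c * X \<omega>) Z = c * cov X Z"
  by (simp add: cov_def mult.assoc)

lemma cov_diff: "X \<in> H \<Longrightarrow> Y \<in> H \<Longrightarrow> Z \<in> H \<Longrightarrow> cov (\<lambda>\<omega>. X \<omega> - Y \<omega>) Z = cov X Z - cov Y Z"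
  by (simp add: cov_def left_diff_distrib integrable_product)

lemma cov_sum: "(\<And>i. i \<in> I \<Longrightarrow> X i \<in> H) \<Longrightarrow> Z \<in> H \<Longrightarrow> cov (\<lambda>\<omega>. \<Sum>i\<in>I. a i * X i \<omega>) Z = (\<Sum>i\<in>I. a i * cov (X i) Z)"
proof (induction I rule: infinite_finite_induct)
  case (insert k I)
  then show ?case
    by (simp add: cov_add[where X = "\<lambda>\<omega>. a k * X k \<omega>"] scale_mem sum_mem cov_scale)
qed (simp_all add: cov_def)

text \<open>Real and imaginary part of the characteristic function of a centred normal law at
  frequency 1. Other frequencies are covered because \<open>H\<close> is closed under
  scaling.\<close>

lemma expectation_cos_sin:
  assumes "X \<in> H"
  shows "expectation (\<lambda>\<omega>. cos (X \<omega>)) = exp (- cov X X / 2)" "expectation (\<lambda>\<omega>. sin (X \<omega>)) = 0"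
proof -
  have [measurable]: "X \<in> borel_measurable M" using assms by (rule measurable_mem)
  have "expectation (\<lambda>\<omega>. cos (X \<omega>)) = exp (- cov X X / 2) \<and> expectation (\<lambda>\<omega>. sin (X \<omega>)) = 0"
    using assms
  proof (cases rule: mem_cases)
    case null
    then have "expectation (\<lambda>\<omega>. cos (X \<omega>)) = expectation (\<lambda>_. 1)" "expectation (\<lambda>\<omega>. sin (X \<omega>)) = expectation (\<lambda>_. 0)"
      by (intro integral_cong_AE; simp; fail | intro integral_cong_AE; auto)+
    then show ?thesis using null by (simp add: prob_space cov_self)
  next
    case (normal \<sigma>)
    have "distributed M lborel (\<lambda>x. (X x - 0) / \<sigma>) std_normal_density"
      using normal(1,2) normal_standard_normal_convert by blast
    then have sd: "distributed M lborel (\<lambda>x. X x / \<sigma>) std_normal_density" by simp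
    have "char std_normal_distribution \<sigma> = (CLINT x|distr M lborel (\<lambda>x. X x / \<sigma>). iexp (\<sigma> * x))"
      unfolding char_def using distributed_distr_eq_density[OF sd] by simp
    also have "\<dots> = (CLINT \<omega>|M. iexp (\<sigma> * (X \<omega> / \<sigma>)))"
      by (rule integral_distr) auto
    also have "\<dots> = (CLINT \<omega>|M. cis (X \<omega>))"
      using normal(1) by (intro Bochner_Integration.integral_cong) (auto simp: cis_conv_exp)
    finally have eq: "(CLINT \<omega>|M. cis (X \<omega>)) = complex_of_real (exp (- \<sigma>\<^sup>2 / 2))"
      by (simp add: char_std_normal_distribution)
    have i: "integrable M (\<lambda>\<omega>. cis (X \<omega>))"
      by (rule integrable_const_bound[where B = 1]) auto
    have "expectation (\<lambda>\<omega>. cos (X \<omega>)) = Re (CLINT \<omega>|M. cis (X \<omega>))" "expectation (\<lambda>\<omega>. sin (X \<omega>)) = Im (CLINT \<omega>|M. cis (X \<omega>))"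
      using i by (simp_all flip: integral_Re integral_Im)
    then show ?thesis using eq normal(3) by (simp add: cov_self)
  qed
  then show "expectation (\<lambda>\<omega>. cos (X \<omega>)) = exp (- cov X X / 2)" "expectation (\<lambda>\<omega>. sin (X \<omega>)) = 0"
    by auto
qed

text \<open>Here vanishing covariance becomes a factorisation. \<open>X + Y\<close> and
  \<open>X - Y\<close> lie in \<open>H\<close> and have the same variance, the sum of the two
  variances, so the product-to-sum formulas give the product of the two Gaussian exponentials for
  the cosines and 0 for the rest.\<close>

lemma expectation_cos_sin_uncorrelated:
  assumes X: "X \<in> H" and Y: "Y \<in> H" and "cov X Y = 0"
  shows "expectation (\<lambda>\<omega>. cos (Y \<omega>) * cos (X \<omega>)) = expectation (\<lambda>\<omega>. cos (Y \<omega>)) * expectation (\<lambda>\<omega>. cos (X \<omega>))"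
    "expectation (\<lambda>\<omega>. cos (Y \<omega>) * sin (X \<omega>)) = 0"
    "expectation (\<lambda>\<omega>. sin (Y \<omega>) * cos (X \<omega>)) = 0"
    "expectation (\<lambda>\<omega>. sin (Y \<omega>) * sin (X \<omega>)) = 0"
proof -
  let ?P = "\<lambda>\<omega>. X \<omega> + Y \<omega>" and ?D = "\<lambda>\<omega>. X \<omega> - Y \<omega>"
  have P: "?P \<in> H" and D: "?D \<in> H" using X Y add_mem diff_mem by auto
  have c: "cov Y X = 0" using assms(3) cov_sym by metis
  have vP: "cov ?P ?P = cov X X + cov Y Y"
    using cov_add[OF X Y P] cov_add[OF X Y X] cov_add[OF X Y Y] assms(3) c by (simp add: cov_sym[of X ?P] cov_sym[of Y ?P])
  have vD: "cov ?D ?D = cov X X + cov Y Y"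
    using cov_diff[OF X Y D] cov_diff[OF X Y X] cov_diff[OF X Y Y] assms(3) c by (simp add: cov_sym[of X ?D] cov_sym[of Y ?D])
  have [measurable]: "X \<in> borel_measurable M" "Y \<in> borel_measurable M" using X Y by (auto intro: measurable_mem)
  have i: "integrable M (\<lambda>\<omega>. cos (?P \<omega>))" "integrable M (\<lambda>\<omega>. cos (?D \<omega>))" "integrable M (\<lambda>\<omega>. sin (?P \<omega>))" "integrable M (\<lambda>\<omega>. sin (?D \<omega>))"
    by (rule integrable_const_bound[where B = 1]; simp)+
  have "(\<lambda>\<omega>. cos (Y \<omega>) * cos (X \<omega>)) = (\<lambda>\<omega>. (cos (?P \<omega>) + cos (?D \<omega>)) / 2)"
       "(\<lambda>\<omega>. cos (Y \<omega>) * sin (X \<omega>)) = (\<lambda>\<omega>. (sin (?P \<omega>) + sin (?D \<omega>)) / 2)"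
       "(\<lambda>\<omega>. sin (Y \<omega>) * cos (X \<omega>)) = (\<lambda>\<omega>. (sin (?P \<omega>) - sin (?D \<omega>)) / 2)"
       "(\<lambda>\<omega>. sin (Y \<omega>) * sin (X \<omega>)) = (\<lambda>\<omega>. (cos (?D \<omega>) - cos (?P \<omega>)) / 2)"
    by (auto simp: cos_add sin_add cos_diff sin_diff)
  note e = this
  show "expectation (\<lambda>\<omega>. cos (Y \<omega>) * cos (X \<omega>)) = expectation (\<lambda>\<omega>. cos (Y \<omega>)) * expectation (\<lambda>\<omega>. cos (X \<omega>))"
    "expectation (\<lambda>\<omega>. cos (Y \<omega>) * sin (X \<omega>)) = 0"
    "expectation (\<lambda>\<omega>. sin (Y \<omega>) * cos (X \<omega>)) = 0"
    "expectation (\<lambda>\<omega>. sin (Y \<omega>) * sin (X \<omega>)) = 0"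
    unfolding e using i expectation_cos_sin[OF X] expectation_cos_sin[OF Y] expectation_cos_sin[OF P] expectation_cos_sin[OF D]
    by (simp_all add: vP vD exp_add[symmetric] field_simps)
qed

text \<open>Uniqueness of joint laws is used twice. Under the weight \<open>1 + cos Y\<close>, with
  Y a combination of the second family, the first vector has its original law up to the factor
  \<open>1 + E cos Y\<close>; the same holds for sin. This pulls the event for X out of all
  trigonometric expectations of Y. Then the indicator of that event, compared with the constant
  weight given by its probability, is itself used as a weight for the second vector.\<close>

lemma uncorrelated_indep:
  fixes X :: "'i \<Rightarrow> 'w \<Rightarrow> real" and Y :: "'j \<Rightarrow> 'w \<Rightarrow> real"
  assumes fin: "finite I" "finite J" and X: "\<And>i. i \<in> I \<Longrightarrow> X i \<in> H" and Y: "\<And>j. j \<in> J \<Longrightarrow> Y j \<in> H"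
    and unc: "\<And>i j. i \<in> I \<Longrightarrow> j \<in> J \<Longrightarrow> cov (X i) (Y j) = 0"
    and A: "A \<in> sets (PiM I (\<lambda>_. borel))" and B: "B \<in> sets (PiM J (\<lambda>_. borel))"
  shows "prob {\<omega> \<in> space M. (\<lambda>i\<in>I. X i \<omega>) \<in> A \<and> (\<lambda>j\<in>J. Y j \<omega>) \<in> B}
       = prob {\<omega> \<in> space M. (\<lambda>i\<in>I. X i \<omega>) \<in> A} * prob {\<omega> \<in> space M. (\<lambda>j\<in>J. Y j \<omega>) \<in> B}"
proof -
  let ?XI = "\<lambda>\<omega>. \<lambda>i\<in>I. X i \<omega>" and ?YJ = "\<lambda>\<omega>. \<lambda>j\<in>J. Y j \<omega>"
  let ?X = "\<lambda>a \<omega>. \<Sum>i\<in>I. a i * X i \<omega>" and ?Y = "\<lambda>b \<omega>. \<Sum>j\<in>J. b j * Y j \<omega>"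
  note [measurable] = A B
  have Xm: "\<And>i. i \<in> I \<Longrightarrow> X i \<in> borel_measurable M" and Ym: "\<And>j. j \<in> J \<Longrightarrow> Y j \<in> borel_measurable M"
    using X Y measurable_mem by auto
  have [measurable]: "?XI \<in> measurable M (PiM I (\<lambda>_. borel))" "?YJ \<in> measurable M (PiM J (\<lambda>_. borel))"
    using Xm Ym by (auto intro!: measurable_restrict)
  have XH: "?X a \<in> H" and YH: "?Y b \<in> H" for a b using X Y by (auto intro: sum_mem)
  have [measurable]: "?X a \<in> borel_measurable M" "?Y b \<in> borel_measurable M" for a b
    using XH YH measurable_mem by auto
  have unc': "cov (?X a) (?Y b) = 0" for a b
  proof -
    have "cov (X i) (?Y b) = 0" if i: "i \<in> I" for i
    proof -
      have "cov (?Y b) (X i) = (\<Sum>j\<in>J. b j * cov (Y j) (X i))" using Y X[OF i] by (rule cov_sum)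
      also have "\<dots> = 0" using unc[OF i] by (intro sum.neutral) (simp add: cov_sym[of "Y _"])
      finally show ?thesis by (simp add: cov_sym[of "X i"])
    qed
    moreover have "cov (?X a) (?Y b) = (\<Sum>i\<in>I. a i * cov (X i) (?Y b))" using X YH by (rule cov_sum)
    ultimately show ?thesis by simp
  qed
  note trig = expectation_cos_sin_uncorrelated[OF XH YH unc']
  have bnd: "integrable M g" if "g \<in> borel_measurable M" "\<And>\<omega>. \<bar>g \<omega>\<bar> \<le> 2" for g :: "'w \<Rightarrow> real"
    using that by (intro integrable_const_bound[where B = 2]) auto
  have b1: "\<bar>x * y\<bar> \<le> 2" if "\<bar>x\<bar> \<le> 1" "\<bar>y\<bar> \<le> 1" for x y :: real
  proof -
    have "\<bar>x\<bar> * \<bar>y\<bar> \<le> 1 * 1" using that by (intro mult_mono) auto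
    then show ?thesis by (simp add: abs_mult)
  qed
  let ?a = "\<lambda>\<omega>. indicat_real A (?XI \<omega>)"
  have meas: "expectation ?a = prob {\<omega> \<in> space M. ?XI \<omega> \<in> A}"
    by (subst Bochner_Integration.integral_cong[OF refl, where g = "indicator {\<omega> \<in> space M. ?XI \<omega> \<in> A}"])
       (auto simp: indicator_def)
  have cosA: "expectation (\<lambda>\<omega>. ?a \<omega> * cos (?Y b \<omega>)) = prob {\<omega> \<in> space M. ?XI \<omega> \<in> A} * expectation (\<lambda>\<omega>. cos (?Y b \<omega>))" for b
  proof -
    let ?e = "expectation (\<lambda>\<omega>. cos (?Y b \<omega>))"
    have "?e \<ge> -1" by (simp add: expectation_cos_sin(1)[OF YH] order_trans[OF _ exp_ge_zero])
    have i: "integrable M (\<lambda>\<omega>. cos (?Y b \<omega>))" "integrable M (\<lambda>\<omega>. cos (?X a \<omega>))" "integrable M (\<lambda>\<omega>. sin (?X a \<omega>))"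
      "integrable M (\<lambda>\<omega>. cos (?Y b \<omega>) * cos (?X a \<omega>))" "integrable M (\<lambda>\<omega>. cos (?Y b \<omega>) * sin (?X a \<omega>))"
      "integrable M (\<lambda>\<omega>. ?a \<omega> * cos (?Y b \<omega>))" "integrable M ?a" for a
      by (rule bnd; simp add: b1 order_trans[OF abs_cos_le_one] order_trans[OF abs_sin_le_one] indicator_def)+
    have "expectation (\<lambda>\<omega>. (1 + cos (?Y b \<omega>)) * ?a \<omega>) = expectation (\<lambda>\<omega>. (1 + ?e) * ?a \<omega>)"
    proof (rule weighted_joint_law_unique[OF fin(1) Xm])
      show "0 \<le> 1 + ?e" using \<open>?e \<ge> -1\<close> by simp
      show "0 \<le> 1 + cos (?Y b \<omega>)" for \<omega> using cos_ge_minus_one[of "?Y b \<omega>"] by linarith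
      show "expectation (\<lambda>\<omega>. (1 + cos (?Y b \<omega>)) * cos (?X a \<omega>)) = expectation (\<lambda>\<omega>. (1 + ?e) * cos (?X a \<omega>))"
        "expectation (\<lambda>\<omega>. (1 + cos (?Y b \<omega>)) * sin (?X a \<omega>)) = expectation (\<lambda>\<omega>. (1 + ?e) * sin (?X a \<omega>))" for a
        using trig(1,2)[of b a] expectation_cos_sin(2)[OF XH, of a] i
        by (simp_all add: distrib_right[of 1])
    qed (use i(1) A in auto)
    moreover have "expectation (\<lambda>\<omega>. (1 + cos (?Y b \<omega>)) * ?a \<omega>) = expectation ?a + expectation (\<lambda>\<omega>. ?a \<omega> * cos (?Y b \<omega>))"
      using i(6,7) by (simp add: mult.commute[of _ "?a _"] distrib_left)
    moreover have "expectation (\<lambda>\<omega>. (1 + ?e) * ?a \<omega>) = (1 + ?e) * prob {\<omega> \<in> space M. ?XI \<omega> \<in> A}"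
      by (simp add: meas)
    ultimately have "prob {\<omega> \<in> space M. ?XI \<omega> \<in> A} + expectation (\<lambda>\<omega>. ?a \<omega> * cos (?Y b \<omega>)) = (1 + ?e) * prob {\<omega> \<in> space M. ?XI \<omega> \<in> A}"
      by (simp only: meas)
    then show ?thesis by (simp only: distrib_right mult_1 mult.commute add_left_cancel)
  qed
  have sinA: "expectation (\<lambda>\<omega>. ?a \<omega> * sin (?Y b \<omega>)) = 0" for b
  proof -
    have i: "integrable M (\<lambda>\<omega>. sin (?Y b \<omega>))" "integrable M (\<lambda>\<omega>. cos (?X a \<omega>))" "integrable M (\<lambda>\<omega>. sin (?X a \<omega>))"
      "integrable M (\<lambda>\<omega>. sin (?Y b \<omega>) * cos (?X a \<omega>))" "integrable M (\<lambda>\<omega>. sin (?Y b \<omega>) * sin (?X a \<omega>))"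
      "integrable M (\<lambda>\<omega>. ?a \<omega> * sin (?Y b \<omega>))" "integrable M ?a" for a
      by (rule bnd; simp add: b1 order_trans[OF abs_cos_le_one] order_trans[OF abs_sin_le_one] indicator_def)+
    have "expectation (\<lambda>\<omega>. (1 + sin (?Y b \<omega>)) * ?a \<omega>) = expectation (\<lambda>\<omega>. 1 * ?a \<omega>)"
    proof (rule weighted_joint_law_unique[OF fin(1) Xm])
      show "0 \<le> 1 + sin (?Y b \<omega>)" for \<omega> using sin_ge_minus_one[of "?Y b \<omega>"] by linarith
      show "expectation (\<lambda>\<omega>. (1 + sin (?Y b \<omega>)) * cos (?X a \<omega>)) = expectation (\<lambda>\<omega>. 1 * cos (?X a \<omega>))"
        "expectation (\<lambda>\<omega>. (1 + sin (?Y b \<omega>)) * sin (?X a \<omega>)) = expectation (\<lambda>\<omega>. 1 * sin (?X a \<omega>))" for a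
        using trig(3,4)[of b a] expectation_cos_sin(2)[OF XH, of a] i
        by (simp_all add: distrib_right[of 1])
    qed (use i(1) A in auto)
    moreover have "expectation (\<lambda>\<omega>. (1 + sin (?Y b \<omega>)) * ?a \<omega>) = expectation ?a + expectation (\<lambda>\<omega>. ?a \<omega> * sin (?Y b \<omega>))"
      using i(6,7) by (simp add: mult.commute[of _ "?a _"] distrib_left)
    ultimately show ?thesis by simp
  qed
  have "expectation (\<lambda>\<omega>. ?a \<omega> * indicat_real B (?YJ \<omega>)) = expectation (\<lambda>\<omega>. prob {\<omega> \<in> space M. ?XI \<omega> \<in> A} * indicat_real B (?YJ \<omega>))"
    by (rule weighted_joint_law_unique[OF fin(2) Ym])
       (use cosA sinA expectation_cos_sin(2)[OF YH] B in \<open>auto intro!: bnd simp: indicator_def\<close>)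
  moreover have "expectation (\<lambda>\<omega>. ?a \<omega> * indicat_real B (?YJ \<omega>)) = prob {\<omega> \<in> space M. ?XI \<omega> \<in> A \<and> ?YJ \<omega> \<in> B}"
    by (subst Bochner_Integration.integral_cong[OF refl, where g = "indicator {\<omega> \<in> space M. ?XI \<omega> \<in> A \<and> ?YJ \<omega> \<in> B}"])
       (auto simp: indicator_def)
  moreover have "expectation (\<lambda>\<omega>. indicat_real B (?YJ \<omega>)) = prob {\<omega> \<in> space M. ?YJ \<omega> \<in> B}"
    by (subst Bochner_Integration.integral_cong[OF refl, where g = "indicator {\<omega> \<in> space M. ?YJ \<omega> \<in> B}"])
       (auto simp: indicator_def)
  ultimately show ?thesis by simp
qed

text \<open>The normal density is at most 1 / (sqrt (2 pi) sd), and sqrt (2 pi) >= 1.\<close>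

lemma interval_bound:
  assumes X: "X \<in> H" and v: "cov X X > 0" and ab: "a \<le> b"
  shows "prob {\<omega> \<in> space M. X \<omega> \<in> {a..b}} \<le> (b - a) / sqrt (cov X X)"
  using X
proof (cases rule: mem_cases)
  case null
  then show ?thesis using v by (simp add: cov_self)
next
  case (normal \<sigma>)
  have "emeasure M (X -` {a..b} \<inter> space M) = (\<integral>\<^sup>+x. ennreal (normal_density 0 \<sigma> x) * indicator {a..b} x \<partial>lborel)"
    using normal(2) by (rule distributed_emeasure) simp
  also have "\<dots> \<le> (\<integral>\<^sup>+x. ennreal (1 / \<sigma>) * indicator {a..b} x \<partial>lborel)"
  proof (intro nn_integral_mono mult_right_mono ennreal_leI)
    fix x :: real
    have "1 \<le> sqrt (2 * pi)" using pi_gt3 by simp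
    then have "1 \<le> sqrt (2 * pi * \<sigma>\<^sup>2) / \<sigma>"
      using normal(1) by (simp add: real_sqrt_mult)
    then have "1 / sqrt (2 * pi * \<sigma>\<^sup>2) \<le> 1 / \<sigma>" using normal(1) by (simp add: field_simps)
    moreover have "normal_density 0 \<sigma> x \<le> 1 / sqrt (2 * pi * \<sigma>\<^sup>2)"
      unfolding normal_density_def using normal(1) by (intro mult_left_le) auto
    ultimately show "normal_density 0 \<sigma> x \<le> 1 / \<sigma>" by linarith
  qed simp
  also have "\<dots> = ennreal ((b - a) / \<sigma>)"
    using ab normal(1) by (simp add: nn_integral_cmult ennreal_mult[symmetric])
  finally have "emeasure M {\<omega> \<in> space M. X \<omega> \<in> {a..b}} \<le> ennreal ((b - a) / \<sigma>)"
    by (simp add: vimage_def Int_def conj_commute)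
  moreover have "sqrt (cov X X) = \<sigma>" using normal(1,3) by (simp add: cov_self)
  ultimately show ?thesis using ab normal(1) by (simp add: emeasure_eq_measure)
qed

text \<open>Completing the square turns the tilted density into a normal density with mean
  \<open>l * \<sigma>\<^sup>2\<close>. Stated as a nonnegative integral, the identity contains the
  finiteness of the moment.\<close>

lemma exp_moment:
  assumes X: "X \<in> H"
  shows "(\<integral>\<^sup>+\<omega>. ennreal (exp (l * X \<omega>)) \<partial>M) = ennreal (exp (l\<^sup>2 * cov X X / 2))"
  using X
proof (cases rule: mem_cases)
  case null
  have "(\<integral>\<^sup>+\<omega>. ennreal (exp (l * X \<omega>)) \<partial>M) = (\<integral>\<^sup>+\<omega>. 1 \<partial>M)"
    using null by (intro nn_integral_cong_AE) auto
  then show ?thesis using null by (simp add: cov_self emeasure_space_1)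
next
  case (normal \<sigma>)
  have "(\<integral>\<^sup>+\<omega>. ennreal (exp (l * X \<omega>)) \<partial>M) = (\<integral>\<^sup>+x. ennreal (normal_density 0 \<sigma> x) * ennreal (exp (l * x)) \<partial>lborel)"
    by (rule distributed_nn_integral[OF normal(2), symmetric]) simp
  also have "\<dots> = (\<integral>\<^sup>+x. ennreal (exp (l\<^sup>2 * \<sigma>\<^sup>2 / 2)) * ennreal (normal_density (l * \<sigma>\<^sup>2) \<sigma> x) \<partial>lborel)"
  proof (intro nn_integral_cong)
    fix x :: real
    have "-(x - 0)\<^sup>2 / (2 * \<sigma>\<^sup>2) + l * x = l\<^sup>2 * \<sigma>\<^sup>2 / 2 + -(x - l * \<sigma>\<^sup>2)\<^sup>2 / (2 * \<sigma>\<^sup>2)"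
      using normal(1) by (simp add: field_simps power2_eq_square)
    then have "exp (-(x - 0)\<^sup>2 / (2 * \<sigma>\<^sup>2)) * exp (l * x) = exp (l\<^sup>2 * \<sigma>\<^sup>2 / 2) * exp (-(x - l * \<sigma>\<^sup>2)\<^sup>2 / (2 * \<sigma>\<^sup>2))"
      unfolding exp_add[symmetric] by simp
    then have "normal_density 0 \<sigma> x * exp (l * x) = exp (l\<^sup>2 * \<sigma>\<^sup>2 / 2) * normal_density (l * \<sigma>\<^sup>2) \<sigma> x"
      unfolding normal_density_def by (simp only: mult.assoc mult.left_commute[of "exp _" "1 / _"])
    then show "ennreal (normal_density 0 \<sigma> x) * ennreal (exp (l * x)) = ennreal (exp (l\<^sup>2 * \<sigma>\<^sup>2 / 2)) * ennreal (normal_density (l * \<sigma>\<^sup>2) \<sigma> x)"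
      by (simp add: ennreal_mult[symmetric])
  qed
  also have "\<dots> = ennreal (exp (l\<^sup>2 * \<sigma>\<^sup>2 / 2))"
    using normal(1) by (simp add: nn_integral_cmult nn_integral_eq_integral)
  finally show ?thesis using normal(3) by (simp add: cov_self)
qed

text \<open>Chernoff bound with parameter u / \<sigma>: the exponential moment contributes at most
  exp (u^2 / 2) against exp (- u^2). \<open>\<sigma>\<close> is only an upper bound for the standard
  deviation, so one scale serves a whole family, degenerate variables included.\<close>

lemma tail_bound:
  assumes X: "X \<in> H" and v: "cov X X \<le> \<sigma>\<^sup>2" and \<sigma>: "\<sigma> > 0" and u: "u \<ge> 0"
  shows "prob {\<omega> \<in> space M. \<bar>X \<omega>\<bar> > \<sigma> * u} \<le> 2 * exp (- u\<^sup>2 / 2)"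
proof -
  have one: "prob {\<omega> \<in> space M. Y \<omega> \<ge> \<sigma> * u} \<le> exp (- u\<^sup>2 / 2)" if Y: "Y \<in> H" "cov Y Y \<le> \<sigma>\<^sup>2" for Y
  proof -
    have [measurable]: "Y \<in> borel_measurable M" using Y(1) by (rule measurable_mem)
    let ?l = "u / \<sigma>"
    have "emeasure M {\<omega> \<in> space M. Y \<omega> \<ge> \<sigma> * u} \<le> (\<integral>\<^sup>+\<omega>. ennreal (exp (- u\<^sup>2)) * ennreal (exp (?l * Y \<omega>)) \<partial>M)"
    proof (subst nn_integral_indicator[symmetric], measurable, intro nn_integral_mono)
      fix \<omega>
      have "1 \<le> exp (- u\<^sup>2) * exp (?l * Y \<omega>)" if "Y \<omega> \<ge> \<sigma> * u"
      proof -
        have "u\<^sup>2 = ?l * (\<sigma> * u)" using \<sigma> by (simp add: power2_eq_square)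
        also have "\<dots> \<le> ?l * Y \<omega>" using that \<sigma> u by (intro mult_left_mono) auto
        finally show ?thesis by (simp add: exp_add[symmetric])
      qed
      then show "indicator {\<omega> \<in> space M. Y \<omega> \<ge> \<sigma> * u} \<omega> \<le> ennreal (exp (- u\<^sup>2)) * ennreal (exp (?l * Y \<omega>))"
        by (auto simp: indicator_def ennreal_mult[symmetric])
    qed
    also have "\<dots> = ennreal (exp (- u\<^sup>2)) * ennreal (exp (?l\<^sup>2 * cov Y Y / 2))"
      using exp_moment[OF Y(1), of ?l] by (simp add: nn_integral_cmult)
    also have "\<dots> \<le> ennreal (exp (- u\<^sup>2 / 2))"
    proof -
      have "?l\<^sup>2 * cov Y Y \<le> ?l\<^sup>2 * \<sigma>\<^sup>2" using Y(2) by (intro mult_left_mono) auto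
      also have "\<dots> = u\<^sup>2" using \<sigma> by (simp add: power_divide)
      finally show ?thesis by (simp add: ennreal_mult[symmetric] exp_add[symmetric])
    qed
    finally show ?thesis by (simp add: emeasure_eq_measure)
  qed
  have [measurable]: "X \<in> borel_measurable M" using X by (rule measurable_mem)
  have mX: "(\<lambda>\<omega>. - X \<omega>) \<in> H" using scale_mem[OF X, of "-1"] by simp
  have "prob {\<omega> \<in> space M. \<bar>X \<omega>\<bar> > \<sigma> * u} \<le> prob ({\<omega> \<in> space M. X \<omega> \<ge> \<sigma> * u} \<union> {\<omega> \<in> space M. - X \<omega> \<ge> \<sigma> * u})"
    by (intro finite_measure_mono) auto
  also have "\<dots> \<le> prob {\<omega> \<in> space M. X \<omega> \<ge> \<sigma> * u} + prob {\<omega> \<in> space M. - X \<omega> \<ge> \<sigma> * u}"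
    by (intro measure_Un_le) auto
  also have "\<dots> \<le> exp (- u\<^sup>2 / 2) + exp (- u\<^sup>2 / 2)"
    using one[OF X v] one[OF mX] v by (intro add_mono) (auto simp: cov_def)
  finally show ?thesis by simp
qed

end

section \<open>Chaining\<close>

text \<open>Rounding down, coordinate by coordinate, to the grid of mesh 2^-n through
  \<open>x0\<close>. Basing the grid at \<open>x0\<close> makes the number of grid points depend on
  the radius alone. Rounded points may leave the set they come from, which is harmless because the
  fields are controlled on the whole plane.\<close>

definition grid_round :: "real^2 \<Rightarrow> nat \<Rightarrow> real^2 \<Rightarrow> real^2" where
  "grid_round x0 n x = x0 + (\<chi> i. of_int \<lfloor>2 ^ n * (x $ i - x0 $ i)\<rfloor> / 2 ^ n)"

lemma dist_grid_round: "dist (grid_round x0 n x) x \<le> 2 / 2 ^ n"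
proof -
  let ?d = "grid_round x0 n x - x"
  have "\<bar>?d $ i\<bar> \<le> 1 / 2 ^ n" for i
  proof -
    let ?z = "2 ^ n * (x $ i - x0 $ i)"
    have "?d $ i = (of_int \<lfloor>?z\<rfloor> - ?z) / 2 ^ n"
      by (simp add: grid_round_def field_simps)
    moreover have "\<bar>of_int \<lfloor>?z\<rfloor> - ?z\<bar> \<le> 1" by linarith
    ultimately show ?thesis by (simp add: divide_right_mono)
  qed
  then have "(\<Sum>i\<in>UNIV. \<bar>?d $ i\<bar>) \<le> (\<Sum>i\<in>(UNIV::2 set). 1 / 2 ^ n)" by (intro sum_mono)
  also have "\<dots> = 2 / 2 ^ n" by (simp add: UNIV_2)
  finally show ?thesis using norm_le_l1_cart[of ?d] by (simp add: dist_norm)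
qed

text \<open>The integer coordinates of the rounded points lie in [-L, L] with L = 2^(n + 1) R, where
  the extra factor 2 leaves room for the rounding. There are at most 2 L + 1 <= 3 L such integers,
  and (3 L)^2 is the bound.\<close>

lemma card_grid_round:
  assumes "\<And>x. x \<in> G \<Longrightarrow> dist x0 x \<le> R" and R: "R \<ge> 1"
  shows "finite (grid_round x0 n ` G)" "real (card (grid_round x0 n ` G)) \<le> 36 * 4 ^ n * R\<^sup>2"
proof -
  define L where "L = 2 ^ (n + 1) * R"
  define K where "K = {- \<lfloor>L\<rfloor>..\<lfloor>L\<rfloor>}"
  define e where "e = (\<lambda>(a::int, b::int). x0 + (\<chi> i::2. (if i = 1 then of_int a else of_int b) / 2 ^ n))"
  have two: "1 \<le> (2::real) ^ n" by simp
  have L1: "1 \<le> L"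
  proof -
    have "(1::real) * 1 \<le> 2 ^ (n + 1) * R" using R by (intro mult_mono one_le_power) simp_all
    then show ?thesis by (simp only: L_def mult_1)
  qed
  have sub: "grid_round x0 n ` G \<subseteq> e ` (K \<times> K)"
  proof (rule image_subsetI)
    fix x assume x: "x \<in> G"
    have "\<lfloor>2 ^ n * (x $ i - x0 $ i)\<rfloor> \<in> K" for i
    proof -
      have "\<bar>x $ i - x0 $ i\<bar> \<le> R"
        using component_le_norm_cart[of "x - x0" i] assms(1)[OF x] by (simp add: dist_norm norm_minus_commute)
      then have "\<bar>2 ^ n * (x $ i - x0 $ i)\<bar> \<le> 2 ^ n * R" by (simp add: abs_mult)
      moreover have "2 ^ n * R + 1 \<le> L"
        unfolding L_def using mult_mono[OF two R] by (simp add: mult.commute)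
      ultimately have "\<bar>real_of_int \<lfloor>2 ^ n * (x $ i - x0 $ i)\<rfloor>\<bar> \<le> L" by linarith
      then have "\<lfloor>2 ^ n * (x $ i - x0 $ i)\<rfloor> \<le> \<lfloor>L\<rfloor>" "- \<lfloor>2 ^ n * (x $ i - x0 $ i)\<rfloor> \<le> \<lfloor>L\<rfloor>"
        unfolding le_floor_iff by linarith+
      then show ?thesis unfolding K_def by auto
    qed
    moreover have "grid_round x0 n x = e (\<lfloor>2 ^ n * (x $ 1 - x0 $ 1)\<rfloor>, \<lfloor>2 ^ n * (x $ 2 - x0 $ 2)\<rfloor>)"
      by (simp add: grid_round_def e_def vec_eq_iff forall_2)
    ultimately show "grid_round x0 n x \<in> e ` (K \<times> K)" by blast
  qed
  have "finite (e ` (K \<times> K))" by (simp add: K_def)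
  then show "finite (grid_round x0 n ` G)" using sub finite_subset by blast
  have "real (card K) \<le> 3 * L"
  proof -
    have "real (card K) = 2 * of_int \<lfloor>L\<rfloor> + 1" using L1 by (simp add: K_def)
    also have "\<dots> \<le> 2 * L + 1" by simp
    finally show ?thesis using L1 by linarith
  qed
  have "card (grid_round x0 n ` G) \<le> card (e ` (K \<times> K))"
    using sub by (intro card_mono) (auto simp: K_def)
  also have "\<dots> \<le> card (K \<times> K)" by (intro card_image_le) (simp add: K_def)
  finally have "real (card (grid_round x0 n ` G)) \<le> real (card (K \<times> K))" by simp
  also have "\<dots> = (real (card K))\<^sup>2" by (simp only: card_cartesian_product of_nat_mult power2_eq_square)
  also have "\<dots> \<le> (3 * L)\<^sup>2" using \<open>real (card K) \<le> 3 * L\<close> by (intro power_mono) auto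
  also have "\<dots> = 36 * 4 ^ n * R\<^sup>2"
    by (simp add: L_def power_mult_distrib power2_eq_square power_mult_distrib[symmetric])
  finally show "real (card (grid_round x0 n ` G)) \<le> 36 * 4 ^ n * R\<^sup>2" .
qed

lemma sum_arith_geometric_le: "(\<Sum>n<N. (real n + 1) / 2 ^ n) \<le> 4"
proof -
  have "(\<Sum>n<N. (real n + 1) / 2 ^ n) = 4 - 2 * (real N + 2) / 2 ^ N"
  proof (induction N)
    case (Suc N)
    have "4 - 2 * (real N + 2) / 2 ^ N + (real N + 1) / 2 ^ N = 4 - 2 * (real (Suc N) + 2) / 2 ^ Suc N"
      by (simp add: field_simps)
    then show ?case using Suc.IH by (simp only: sum.lessThan_Suc)
  qed simp
  then show ?thesis by simp
qed

lemma sum_exp_minus_le: "(\<Sum>n<N. exp (- real n)) \<le> 2"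
proof -
  have "exp (- real n) \<le> (1 / 2) ^ n" for n
  proof -
    have "2 \<le> exp (1::real)" using exp_ge_add_one_self[of 1] by simp
    then have "exp (-1 :: real) \<le> 1 / 2" by (simp add: exp_minus field_simps)
    then have "exp (-1 :: real) ^ n \<le> (1 / 2) ^ n" by (intro power_mono) auto
    then show ?thesis by (simp add: exp_of_nat_mult[symmetric])
  qed
  then have "(\<Sum>n<N. exp (- real n)) \<le> (\<Sum>n<N. (1 / 2) ^ n)" by (intro sum_mono)
  also have "\<dots> \<le> 2" by (simp add: sum_gp_strict)
  finally show ?thesis .
qed

context gaussian_space
begin

lemma max_tail_bound:
  assumes "finite Q" and "\<And>p. p \<in> Q \<Longrightarrow> Z p \<in> H" "\<And>p. p \<in> Q \<Longrightarrow> cov (Z p) (Z p) \<le> \<sigma>\<^sup>2" "\<sigma> > 0" "u \<ge> 0"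
  shows "{\<omega> \<in> space M. \<exists>p\<in>Q. \<bar>Z p \<omega>\<bar> > \<sigma> * u} \<in> events"
    and "prob {\<omega> \<in> space M. \<exists>p\<in>Q. \<bar>Z p \<omega>\<bar> > \<sigma> * u} \<le> real (card Q) * (2 * exp (- u\<^sup>2 / 2))"
proof -
  have [measurable]: "\<And>p. p \<in> Q \<Longrightarrow> Z p \<in> borel_measurable M" using assms measurable_mem by auto
  have m: "{\<omega> \<in> space M. \<bar>Z p \<omega>\<bar> > \<sigma> * u} \<in> events" if "p \<in> Q" for p
    using that by measurable
  have eq: "{\<omega> \<in> space M. \<exists>p\<in>Q. \<bar>Z p \<omega>\<bar> > \<sigma> * u} = (\<Union>p\<in>Q. {\<omega> \<in> space M. \<bar>Z p \<omega>\<bar> > \<sigma> * u})" by auto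
  show "{\<omega> \<in> space M. \<exists>p\<in>Q. \<bar>Z p \<omega>\<bar> > \<sigma> * u} \<in> events"
    unfolding eq using assms(1) m by auto
  have "prob (\<Union>p\<in>Q. {\<omega> \<in> space M. \<bar>Z p \<omega>\<bar> > \<sigma> * u}) \<le> (\<Sum>p\<in>Q. prob {\<omega> \<in> space M. \<bar>Z p \<omega>\<bar> > \<sigma> * u})"
    using assms(1) m by (intro finite_measure_subadditive_finite) auto
  also have "\<dots> \<le> (\<Sum>p\<in>Q. 2 * exp (- u\<^sup>2 / 2))"
    using assms by (intro sum_mono tail_bound) auto
  finally show "prob {\<omega> \<in> space M. \<exists>p\<in>Q. \<bar>Z p \<omega>\<bar> > \<sigma> * u} \<le> real (card Q) * (2 * exp (- u\<^sup>2 / 2))"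
    unfolding eq by simp
qed

text \<open>Chaining along dyadic roundings. The union bounds are crude (all pairs of grid points of two
  consecutive levels), since \<open>t \<ge> ln R\<close> lets the Gaussian tails absorb any power of \<open>R\<close>.\<close>

lemma sup_tail_bound:
  fixes g :: "real^2 \<Rightarrow> 'w \<Rightarrow> real"
  assumes g: "\<And>x. g x \<in> H" and var: "\<And>x. cov (g x) (g x) \<le> s\<^sup>2"
    and lip: "\<And>x y. cov (\<lambda>\<omega>. g x \<omega> - g y \<omega>) (\<lambda>\<omega>. g x \<omega> - g y \<omega>) \<le> (s * dist x y)\<^sup>2"
    and s: "s > 0" and G: "finite G" "\<And>x. x \<in> G \<Longrightarrow> dist x0 x \<le> R"
    and R: "R \<ge> 1" and t: "t \<ge> 1" "t \<ge> ln R"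
  shows "prob {\<omega> \<in> space M. \<exists>x\<in>G. \<bar>g x \<omega>\<bar> > 53 * s * t} \<le> 20809 * exp (- t\<^sup>2)"
proof -
  let ?P = "\<lambda>n. grid_round x0 n ` G"
  let ?D = "\<lambda>p \<omega>. g (fst p) \<omega> - g (snd p) \<omega>"
  note finP = card_grid_round(1)[OF G(2) R] and cardP = card_grid_round(2)[OF G(2) R]
  have t2: "t \<le> t\<^sup>2" "1 \<le> t\<^sup>2" using t(1) by (simp_all add: self_le_power one_le_power)
  have Rt: "R \<le> exp t" using t(2) R by (simp add: ln_ge_iff flip: ln_le_cancel_iff)
  have Rpow: "R ^ k \<le> exp (real k * t)" for k
    using power_mono[OF Rt, of k] R by (simp add: exp_of_nat_mult)
  have DH: "?D p \<in> H" for p using g by (intro diff_mem)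
  \<comment> \<open>All links between levels n + 1 and n that a point can produce: its two roundings
    are within 2 / 2^(n + 1) + 2 / 2^n = 3 / 2^n of each other.\<close>
  define Q where "Q n = {p \<in> ?P (Suc n) \<times> ?P n. dist (fst p) (snd p) \<le> 3 / 2 ^ n}" for n
  \<comment> \<open>The threshold grows linearly in the level. Its Gaussian tail exp (- 8 t^2 (n +
    1)^2) beats the number of links, of order 16^n R^4, while the sum of the thresholds times the
    mesh still converges.\<close>
  define E where "E n = {\<omega> \<in> space M. \<exists>p\<in>Q n. \<bar>?D p \<omega>\<bar> > (s * 3 / 2 ^ n) * (4 * t * (real n + 1))}" for n
  define E0 where "E0 = {\<omega> \<in> space M. \<exists>x\<in>?P 0. \<bar>g x \<omega>\<bar> > s * (4 * t)}"
  \<comment> \<open>The last link, from level N to the point itself, is allowed a deviation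
    \<open>s\<close>, which is 2^N / 2 times the bound on its standard deviation.\<close>
  define F where "F N = {\<omega> \<in> space M. \<exists>p\<in>(\<lambda>x. (x, grid_round x0 N x)) ` G. \<bar>?D p \<omega>\<bar> > (s * 2 / 2 ^ N) * (2 ^ N / 2)}" for N
  have finQ: "finite (Q n)" for n unfolding Q_def using finP by (intro finite_Collect_conjI) auto
  have E: "E n \<in> events" "prob (E n) \<le> 10368 * exp (- t\<^sup>2) * exp (- real n)" for n
  proof -
    have sd: "s * 3 / 2 ^ n > 0" "4 * t * (real n + 1) \<ge> 0" using s t by auto
    have v: "cov (?D p) (?D p) \<le> (s * 3 / 2 ^ n)\<^sup>2" if "p \<in> Q n" for p
    proof -
      have "s * dist (fst p) (snd p) \<le> s * 3 / 2 ^ n"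
        using that s mult_left_mono[of "dist (fst p) (snd p)" "3 / 2 ^ n" s] by (auto simp: Q_def)
      then have "(s * dist (fst p) (snd p))\<^sup>2 \<le> (s * 3 / 2 ^ n)\<^sup>2" using s by (intro power_mono) auto
      then show ?thesis using lip[of "fst p" "snd p"] by linarith
    qed
    show "E n \<in> events" unfolding E_def by (rule max_tail_bound(1)[OF finQ DH v sd])
    have "real (card (Q n)) \<le> real (card (?P (Suc n) \<times> ?P n))"
      unfolding Q_def of_nat_le_iff using finP by (intro card_mono) auto
    also have "\<dots> = real (card (?P (Suc n))) * real (card (?P n))" by (simp only: card_cartesian_product of_nat_mult)
    also have "\<dots> \<le> (36 * 4 ^ Suc n * R\<^sup>2) * (36 * 4 ^ n * R\<^sup>2)" by (intro mult_mono cardP) auto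
    also have "\<dots> = 5184 * 16 ^ n * R ^ 4"
      by (simp add: power2_eq_square power4_eq_xxxx power_mult_distrib[symmetric])
    also have "\<dots> \<le> 5184 * exp (4 * real n) * exp (4 * t)"
    proof (intro mult_mono)
      have "2 \<le> exp (1::real)" using exp_ge_add_one_self[of 1] by simp
      then have "2 ^ (4 * n) \<le> exp (1::real) ^ (4 * n)" by (intro power_mono) auto
      moreover have "(2::real) ^ (4 * n) = 16 ^ n" unfolding power_mult by simp
      moreover have "exp (1::real) ^ (4 * n) = exp (4 * real n)" by (simp add: exp_of_nat_mult[symmetric])
      ultimately show "(16::real) ^ n \<le> exp (4 * real n)" by simp
      show "R ^ 4 \<le> exp (4 * t)" using Rpow[of 4] by simp
    qed (use R in auto)
    finally have c: "real (card (Q n)) \<le> 5184 * exp (4 * real n) * exp (4 * t)" .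
    \<comment> \<open>As t >= 1, also t <= t^2 and n <= n t^2, so all that has to be absorbed is at
      most t^2 (5 n + 5), which is below 8 t^2 (n + 1)^2.\<close>
    have ex: "4 * real n + 4 * t + - (4 * t * (real n + 1))\<^sup>2 / 2 \<le> - t\<^sup>2 + - real n"
    proof -
      have "real n \<le> real n * t\<^sup>2" using t2(2) by (simp add: mult_le_cancel_left1)
      moreover have "t\<^sup>2 * (5 * real n + 5) \<le> t\<^sup>2 * (8 * (real n + 1)\<^sup>2)"
        by (intro mult_left_mono) (auto simp: power2_eq_square algebra_simps)
      moreover have "(4 * t * (real n + 1))\<^sup>2 / 2 = t\<^sup>2 * (8 * (real n + 1)\<^sup>2)"
        by (simp add: power_mult_distrib)
      ultimately show ?thesis using t2(1) by (simp add: algebra_simps)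
    qed
    have "prob (E n) \<le> real (card (Q n)) * (2 * exp (- (4 * t * (real n + 1))\<^sup>2 / 2))"
      unfolding E_def by (rule max_tail_bound(2)[OF finQ DH v sd])
    also have "\<dots> \<le> (5184 * exp (4 * real n) * exp (4 * t)) * (2 * exp (- (4 * t * (real n + 1))\<^sup>2 / 2))"
      using c by (intro mult_right_mono) auto
    also have "\<dots> = 10368 * exp (4 * real n + 4 * t + - (4 * t * (real n + 1))\<^sup>2 / 2)"
      by (simp only: exp_add, simp?)
    also have "\<dots> \<le> 10368 * exp (- t\<^sup>2 + - real n)" using ex by simp
    finally show "prob (E n) \<le> 10368 * exp (- t\<^sup>2) * exp (- real n)" by (simp only: exp_add mult.assoc)
  qed
  have E0: "E0 \<in> events" "prob E0 \<le> 72 * exp (- t\<^sup>2)"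
  proof -
    have u: "4 * t \<ge> 0" using t by auto
    show "E0 \<in> events" unfolding E0_def by (rule max_tail_bound(1)[OF finP g var s u])
    have "prob E0 \<le> real (card (?P 0)) * (2 * exp (- (4 * t)\<^sup>2 / 2))"
      unfolding E0_def by (rule max_tail_bound(2)[OF finP g var s u])
    also have "\<dots> \<le> (36 * exp (2 * t)) * (2 * exp (- (4 * t)\<^sup>2 / 2))"
      proof (intro mult_right_mono)
      have "real (card (?P 0)) \<le> 36 * 4 ^ 0 * R\<^sup>2" by (rule cardP)
      then show "real (card (?P 0)) \<le> 36 * exp (2 * t)" using Rpow[of 2] by simp
    qed simp
    also have "\<dots> = 72 * exp (2 * t + - (4 * t)\<^sup>2 / 2)" by (simp only: exp_add, simp?)
    also have "\<dots> \<le> 72 * exp (- t\<^sup>2)" using t2 by (simp add: power_mult_distrib)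
    finally show "prob E0 \<le> 72 * exp (- t\<^sup>2)" .
  qed
  have F: "F N \<in> events" "prob (F N) \<le> real (card G) * (2 * exp (- (2 ^ N / 2)\<^sup>2 / 2))" for N
  proof -
    let ?Q = "(\<lambda>x. (x, grid_round x0 N x)) ` G"
    have sd: "s * 2 / 2 ^ N > 0" "(2::real) ^ N / 2 \<ge> 0" using s by auto
    have v: "cov (?D p) (?D p) \<le> (s * 2 / 2 ^ N)\<^sup>2" if p: "p \<in> ?Q" for p
    proof -
      obtain x where x: "p = (x, grid_round x0 N x)" using p by auto
      have "s * dist (fst p) (snd p) \<le> s * 2 / 2 ^ N"
        using x s mult_left_mono[OF dist_grid_round[of x0 N x], of s] by (auto simp: dist_commute)
      then have "(s * dist (fst p) (snd p))\<^sup>2 \<le> (s * 2 / 2 ^ N)\<^sup>2" using s by (intro power_mono) auto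
      then show ?thesis using lip[of "fst p" "snd p"] by linarith
    qed
    have fQ: "finite ?Q" using G by auto
    show "F N \<in> events" unfolding F_def by (rule max_tail_bound(1)[OF fQ DH v sd])
    have "card ?Q = card G" by (intro card_image) (auto simp: inj_on_def)
    then show "prob (F N) \<le> real (card G) * (2 * exp (- (2 ^ N / 2)\<^sup>2 / 2))"
      unfolding F_def using max_tail_bound(2)[where Z = ?D, OF fQ DH v sd] by (simp only:)
  qed
  \<comment> \<open>The size of \<open>G\<close> enters only through the last link. As N is chosen
    after \<open>G\<close>, it disappears from the final bound.\<close>
  have "(\<lambda>N. real (card G) * (2 * exp (- (2 ^ N / 2)\<^sup>2 / 2))) \<longlonglongrightarrow> real (card G) * (2 * 0)"
    by (intro tendsto_intros) real_asymp
  then have "eventually (\<lambda>N. real (card G) * (2 * exp (- (2 ^ N / 2)\<^sup>2 / 2)) < exp (- t\<^sup>2)) sequentially"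
    by (rule order_tendstoD) simp
  then obtain N where N: "real (card G) * (2 * exp (- (2 ^ N / 2)\<^sup>2 / 2)) < exp (- t\<^sup>2)"
    using eventually_happens by force
  let ?U = "E0 \<union> (\<Union>n<N. E n) \<union> F N"
  have "{\<omega> \<in> space M. \<exists>x\<in>G. \<bar>g x \<omega>\<bar> > 53 * s * t} \<subseteq> ?U"
  proof (rule subsetI, rule ccontr)
    fix \<omega> assume w: "\<omega> \<in> {\<omega> \<in> space M. \<exists>x\<in>G. \<bar>g x \<omega>\<bar> > 53 * s * t}" and nU: "\<omega> \<notin> ?U"
    then obtain x where x: "x \<in> G" "\<bar>g x \<omega>\<bar> > 53 * s * t" and sp: "\<omega> \<in> space M" by auto
    let ?r = "\<lambda>n. grid_round x0 n x"
    have a: "\<bar>g (?r 0) \<omega>\<bar> \<le> s * (4 * t)"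
      using nU sp x(1) by (auto simp: E0_def not_less)
    have b: "\<bar>g (?r (Suc n)) \<omega> - g (?r n) \<omega>\<bar> \<le> 12 * s * t * ((real n + 1) / 2 ^ n)" if "n < N" for n
    proof -
      have "dist (?r (Suc n)) (?r n) \<le> dist (?r (Suc n)) x + dist (?r n) x" by (rule dist_triangle2)
      also have "\<dots> \<le> 2 / 2 ^ Suc n + 2 / 2 ^ n" by (intro add_mono dist_grid_round)
      finally have "(?r (Suc n), ?r n) \<in> Q n" using x(1) by (auto simp: Q_def field_simps)
      moreover have "\<omega> \<notin> E n" using nU that by auto
      ultimately have "\<bar>g (?r (Suc n)) \<omega> - g (?r n) \<omega>\<bar> \<le> (s * 3 / 2 ^ n) * (4 * t * (real n + 1))"
        using sp by (force simp: E_def not_less)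
      then show ?thesis by (simp add: field_simps)
    qed
    have c: "\<bar>g x \<omega> - g (?r N) \<omega>\<bar> \<le> s"
      using nU sp x(1) by (auto simp: F_def not_less)
    have "\<bar>g (?r N) \<omega> - g (?r 0) \<omega>\<bar> = \<bar>\<Sum>n<N. g (?r (Suc n)) \<omega> - g (?r n) \<omega>\<bar>"
      by (subst sum_lessThan_telescope[where f = "\<lambda>n. g (?r n) \<omega>"]) simp
    also have "\<dots> \<le> (\<Sum>n<N. 12 * s * t * ((real n + 1) / 2 ^ n))"
      using b by (intro order_trans[OF sum_abs] sum_mono) auto
    also have "\<dots> = 12 * s * t * (\<Sum>n<N. (real n + 1) / 2 ^ n)" by (simp add: sum_distrib_left)
    also have "\<dots> \<le> 12 * s * t * 4" using s t by (intro mult_left_mono sum_arith_geometric_le) auto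
    \<comment> \<open>The coarsest level gives 4 s t, the links 12 * 4 = 48 times s t, the last link
      s <= s t: in all 53 s t.\<close>
    finally have "\<bar>g x \<omega>\<bar> \<le> s * (4 * t) + 12 * s * t * 4 + s" using a c by linarith
    moreover have "s \<le> s * t" using s t by simp
    ultimately show False using x(2) by simp
  qed
  then have "prob {\<omega> \<in> space M. \<exists>x\<in>G. \<bar>g x \<omega>\<bar> > 53 * s * t} \<le> prob ?U"
    using E(1) E0(1) F(1) by (intro finite_measure_mono) auto
  also have "\<dots> \<le> prob E0 + prob (\<Union>n<N. E n) + prob (F N)"
    using E(1) E0(1) F(1) by (intro order_trans[OF measure_Un_le] add_mono) auto
  also have "prob (\<Union>n<N. E n) \<le> (\<Sum>n<N. prob (E n))"
    using E(1) by (intro finite_measure_subadditive_finite) auto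
  also have "\<dots> \<le> (\<Sum>n<N. 10368 * exp (- t\<^sup>2) * exp (- real n))" by (intro sum_mono E)
  also have "\<dots> = 10368 * exp (- t\<^sup>2) * (\<Sum>n<N. exp (- real n))" by (simp add: sum_distrib_left)
  also have "\<dots> \<le> 10368 * exp (- t\<^sup>2) * 2" by (intro mult_left_mono sum_exp_minus_le) auto
  also have "prob E0 \<le> 72 * exp (- t\<^sup>2)" by (rule E0)
  also have "prob (F N) \<le> exp (- t\<^sup>2)" using F(2)[of N] N by linarith
  \<comment> \<open>72 + 2 * 10368 + 1 = 20809.\<close>
  finally show ?thesis by simp
qed

end

section \<open>Sensitivity of increasing events to shifts\<close>

context gaussian_space
begin

lemma cov_Cauchy_Schwarz:
  assumes X: "X \<in> H" and Y: "Y \<in> H"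
  shows "(cov X Y)\<^sup>2 \<le> cov X X * cov Y Y"
proof -
  have poly: "0 \<le> cov X X - 2 * l * cov X Y + l\<^sup>2 * cov Y Y" for l
  proof -
    have lY: "(\<lambda>\<omega>. l * Y \<omega>) \<in> H" and D: "(\<lambda>\<omega>. X \<omega> - l * Y \<omega>) \<in> H"
      using X Y by (auto intro: scale_mem diff_mem)
    have "cov (\<lambda>\<omega>. X \<omega> - l * Y \<omega>) (\<lambda>\<omega>. X \<omega> - l * Y \<omega>) = cov X X - 2 * l * cov X Y + l\<^sup>2 * cov Y Y"
      using cov_diff[OF X lY D] cov_diff[OF X lY X] cov_diff[OF X lY lY]
      by (simp add: cov_scale cov_sym[of X "\<lambda>\<omega>. X \<omega> - l * Y \<omega>"] cov_sym[of Y "\<lambda>\<omega>. X \<omega> - l * Y \<omega>"]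
          cov_sym[of X "\<lambda>\<omega>. l * Y \<omega>"] cov_sym[of Y "\<lambda>\<omega>. l * Y \<omega>"] cov_diff[OF X lY Y] cov_sym[of Y X]
          power2_eq_square algebra_simps)
    then show ?thesis using cov_self_nonneg[of "\<lambda>\<omega>. X \<omega> - l * Y \<omega>"] by simp
  qed
  show ?thesis
  proof (cases "cov Y Y = 0")
    case True
    have "cov X Y = 0"
    proof (rule ccontr)
      assume n: "cov X Y \<noteq> 0"
      \<comment> \<open>If \<open>Y\<close> has variance 0 the polynomial is affine in l, and this l
        gives it the value -1.\<close>
      show False using poly[of "(cov X X + 1) / (2 * cov X Y)"] True n by (simp add: field_simps)
    qed
    then show ?thesis using True by simp
  next
    case False
    then have "cov Y Y > 0" using cov_self_nonneg[of Y] by simp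
    then show ?thesis using poly[of "cov X Y / cov Y Y"] by (simp add: field_simps power2_eq_square)
  qed
qed

text \<open>The bound says that sending the combination of the \<open>f x\<close> to the same
  combination of the \<open>h x\<close> is a well-defined bounded functional, so it is represented
  by an element of the span. The covariance matrix may be singular; the induction is therefore a
  Gram-Schmidt step rather than a matrix inversion.\<close>

lemma finite_Riesz:
  fixes f :: "'i \<Rightarrow> 'w \<Rightarrow> real"
  assumes "finite G" and "\<And>x. x \<in> G \<Longrightarrow> f x \<in> H"
    and "\<And>c. (\<Sum>x\<in>G. c x * h x)\<^sup>2 \<le> K * cov (\<lambda>\<omega>. \<Sum>x\<in>G. c x * f x \<omega>) (\<lambda>\<omega>. \<Sum>x\<in>G. c x * f x \<omega>)"
  shows "\<exists>c. \<forall>x\<in>G. cov (f x) (\<lambda>\<omega>. \<Sum>y\<in>G. c y * f y \<omega>) = h x"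
  using assms
proof (induction G arbitrary: h K)
  case empty
  then show ?case by simp
next
  case (insert k G)
  let ?S = "\<lambda>c \<omega>. \<Sum>y\<in>G. c y * f y \<omega>"
  have fH: "\<And>x. x \<in> G \<Longrightarrow> f x \<in> H" and fk: "f k \<in> H" using insert.prems by auto
  have SH: "?S c \<in> H" for c using fH by (rule sum_mem)
  have Scov: "cov (?S a) Z = (\<Sum>y\<in>G. a y * cov (f y) Z)" if "Z \<in> H" for a Z
    using fH that by (rule cov_sum)
  have upd: "(\<Sum>y\<in>insert k G. (c(k := r)) y * g y) = r * g k + (\<Sum>y\<in>G. c y * g y)" for c r and g :: "'i \<Rightarrow> real"
    using insert.hyps by (simp, intro sum.cong) auto
  have bG: "(\<Sum>x\<in>G. c x * h x)\<^sup>2 \<le> K * cov (?S c) (?S c)" for c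
    using insert.prems(2)[of "c(k := 0)"] unfolding upd by simp
  obtain c where c: "\<And>x. x \<in> G \<Longrightarrow> cov (f x) (?S c) = h x"
    using insert.IH[OF fH bG] by auto
  \<comment> \<open>The induction hypothesis for the functional with values
    \<open>cov (f x) (f k)\<close> yields the projection \<open>?S d\<close> of \<open>f k\<close>
    onto the span of the others; this is why \<open>h\<close> and \<open>K\<close> are arbitrary in
    the induction. \<open>w\<close> below is the orthogonal remainder.\<close>
  have "(\<Sum>x\<in>G. a x * cov (f x) (f k))\<^sup>2 \<le> cov (f k) (f k) * cov (?S a) (?S a)" for a
    using cov_Cauchy_Schwarz[OF SH fk, of a] Scov[OF fk, of a] by (simp add: mult.commute)
  then obtain d where d: "\<And>x. x \<in> G \<Longrightarrow> cov (f x) (?S d) = cov (f x) (f k)"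
    using insert.IH[OF fH, of "\<lambda>x. cov (f x) (f k)" "cov (f k) (f k)"] by auto
  define w where "w = (\<lambda>\<omega>. f k \<omega> - ?S d \<omega>)"
  have wH: "w \<in> H" unfolding w_def using fk SH by (rule diff_mem)
  have fw: "cov (f x) w = 0" if "x \<in> G" for x
    using d[OF that] cov_diff[OF fk SH fH[OF that], of d] unfolding w_def[symmetric]
    by (simp add: cov_sym[of "f x"])
  have Sw: "cov (?S a) w = 0" for a
    using Scov[OF wH, of a] fw by simp
  have ww: "cov w w = cov (f k) w"
    using cov_diff[OF fk SH wH, of d] Sw[of d] unfolding w_def[symmetric] by simp
  have wsum: "w = (\<lambda>\<omega>. \<Sum>y\<in>insert k G. ((\<lambda>y. - d y)(k := 1)) y * f y \<omega>)"
    unfolding upd w_def by (simp add: sum_negf)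
  show ?case
  proof (cases "cov w w = 0")
    case True
    \<comment> \<open>If the remainder has variance 0, the bound applied to its coefficients forces
      \<open>h k\<close> to be the same combination of the other values as in the projection, and
      the representer found for \<open>G\<close> serves \<open>k\<close> as well.\<close>
    have "(\<Sum>y\<in>insert k G. ((\<lambda>y. - d y)(k := 1)) y * h y)\<^sup>2 \<le> 0"
      using insert.prems(2)[of "(\<lambda>y. - d y)(k := 1)"] True unfolding wsum[symmetric] by simp
    then have hk: "h k = (\<Sum>y\<in>G. d y * h y)" unfolding upd by (simp add: sum_negf)
    have "cov (?S c) w = 0" by (rule Sw)
    then have "cov (f k) (?S c) = cov (?S d) (?S c)"
      using cov_diff[OF fk SH SH, of d c] unfolding w_def[symmetric] by (simp add: cov_sym[of w])
    also have "\<dots> = (\<Sum>y\<in>G. d y * h y)"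
      using Scov[OF SH, of d c] c by simp
    finally have "cov (f k) (?S c) = h k" using hk by simp
    then have "\<forall>x\<in>insert k G. cov (f x) (\<lambda>\<omega>. \<Sum>y\<in>insert k G. (c(k := 0)) y * f y \<omega>) = h x"
      unfolding upd using c by simp
    then show ?thesis by blast
  next
    case False
    \<comment> \<open>Adding \<open>l * w\<close> corrects the value at \<open>k\<close> and leaves
      the others unchanged, since \<open>w\<close> is orthogonal to them.\<close>
    define l where "l = (h k - cov (f k) (?S c)) / cov w w"
    have "(\<lambda>\<omega>. \<Sum>y\<in>insert k G. ((\<lambda>y. c y - l * d y)(k := l)) y * f y \<omega>) = (\<lambda>\<omega>. ?S c \<omega> + l * w \<omega>)"
      unfolding upd w_def by (simp add: sum_subtractf sum_distrib_left algebra_simps)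
    moreover have "cov (f x) (\<lambda>\<omega>. ?S c \<omega> + l * w \<omega>) = cov (f x) (?S c) + l * cov (f x) w" if "x \<in> insert k G" for x
    proof -
      have "f x \<in> H" using that fH fk by auto
      then show ?thesis
        using cov_add[OF SH[of c] scale_mem[OF wH, of l], of "f x"]
        by (simp add: cov_scale cov_sym[of "f x"])
    qed
    moreover have "l * cov w w = h k - cov (f k) (?S c)" using False by (simp add: l_def)
    ultimately have "\<forall>x\<in>insert k G. cov (f x) (\<lambda>\<omega>. \<Sum>y\<in>insert k G. ((\<lambda>y. c y - l * d y)(k := l)) y * f y \<omega>) = h x"
      using c fw ww by auto
    then show ?thesis by blast
  qed
qed

text \<open>Finite-dimensional Cameron--Martin: with \<open>Z\<close> representing \<open>h\<close>, the vector splits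
  as \<open>\<xi> + a N\<close> with \<open>a = h / sd Z\<close> and \<open>N\<close> standard normal and independent of \<open>\<xi>\<close>. Given \<open>\<xi>\<close>, monotonicity
  confines \<open>N\<close> to a set of diameter at most \<open>2 s sd Z\<close>, and \<open>sd Z \<le> sqrt K\<close>.\<close>

lemma increasing_shift_bound:
  fixes f :: "'i \<Rightarrow> 'w \<Rightarrow> real" and h :: "'i \<Rightarrow> real"
  assumes G: "finite G" "G \<noteq> {}" and fH: "\<And>x. x \<in> G \<Longrightarrow> f x \<in> H"
    and bound: "\<And>c. (\<Sum>x\<in>G. c x * h x)\<^sup>2 \<le> K * cov (\<lambda>\<omega>. \<Sum>x\<in>G. c x * f x \<omega>) (\<lambda>\<omega>. \<Sum>x\<in>G. c x * f x \<omega>)"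
    and h: "\<And>x. x \<in> G \<Longrightarrow> h x \<ge> 1"
    and E: "E \<in> sets (PiM G (\<lambda>_. borel))"
    and incr: "\<And>u v. u \<in> E \<Longrightarrow> v \<in> space (PiM G (\<lambda>_. borel)) \<Longrightarrow> (\<And>x. x \<in> G \<Longrightarrow> u x \<le> v x) \<Longrightarrow> v \<in> E"
    and s: "s \<ge> 0"
  shows "prob {\<omega> \<in> space M. (\<lambda>x\<in>G. f x \<omega> + s) \<in> E \<and> (\<lambda>x\<in>G. f x \<omega> - s) \<notin> E} \<le> 4 * s * sqrt K"
proof -
  note [measurable] = E
  have fm[measurable]: "\<And>x. x \<in> G \<Longrightarrow> f x \<in> borel_measurable M" using fH measurable_mem by auto
  obtain c where c: "\<And>x. x \<in> G \<Longrightarrow> cov (f x) (\<lambda>\<omega>. \<Sum>y\<in>G. c y * f y \<omega>) = h x"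
    using finite_Riesz[OF G(1) fH bound] by auto
  define Z where "Z = (\<lambda>\<omega>. \<Sum>y\<in>G. c y * f y \<omega>)"
  have ZH: "Z \<in> H" unfolding Z_def using fH by (rule sum_mem)
  have fZ: "cov (f x) Z = h x" if "x \<in> G" for x using c[OF that] by (simp add: Z_def)
  define \<tau> where "\<tau> = sqrt (cov Z Z)"
  have "cov Z Z \<noteq> 0"
  proof
    assume z: "cov Z Z = 0"
    obtain x where x: "x \<in> G" using G by auto
    have "(h x)\<^sup>2 \<le> 0" using cov_Cauchy_Schwarz[OF fH[OF x] ZH] z by (simp add: fZ[OF x])
    then show False using h[OF x] by auto
  qed
  then have Zpos: "cov Z Z > 0" using cov_self_nonneg[of Z] by simp
  then have \<tau>: "\<tau> > 0" "\<tau>\<^sup>2 = cov Z Z" by (simp_all add: \<tau>_def)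
  have "cov Z Z = (\<Sum>y\<in>G. c y * h y)"
  proof -
    have "cov (\<lambda>\<omega>. \<Sum>y\<in>G. c y * f y \<omega>) Z = (\<Sum>y\<in>G. c y * cov (f y) Z)" using fH ZH by (rule cov_sum)
    then show ?thesis using fZ by (simp add: Z_def[symmetric])
  qed
  \<comment> \<open>The bound is applied to the coefficients of the representer itself: the norm of
    the functional is the standard deviation of \<open>Z\<close>.\<close>
  then have "(cov Z Z)\<^sup>2 \<le> K * cov Z Z" using bound[of c] by (simp add: Z_def[symmetric])
  then have "cov Z Z \<le> K" using Zpos by (simp add: power2_eq_square)
  then have \<tau>K: "\<tau> \<le> sqrt K" by (simp add: \<tau>_def)
  define N where "N = (\<lambda>\<omega>. (1 / \<tau>) * Z \<omega>)"
  have NH: "N \<in> H" unfolding N_def using ZH by (rule scale_mem)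
  have covN: "cov N Y = cov Z Y / \<tau>" for Y
    unfolding N_def by (simp only: cov_scale) simp
  have NN: "cov N N = 1"
  proof -
    have "cov N N = cov Z Z / \<tau> / \<tau>" using covN[of N] covN[of Z] cov_sym[of Z N] by simp
    then show ?thesis using \<tau>(1) unfolding \<tau>(2)[symmetric] by (simp add: power2_eq_square)
  qed
  define a where "a x = h x / \<tau>" for x
  define \<xi> where "\<xi> x = (\<lambda>\<omega>. f x \<omega> - a x * N \<omega>)" for x
  have \<xi>H: "\<xi> x \<in> H" if "x \<in> G" for x
    unfolding \<xi>_def using fH[OF that] NH by (intro diff_mem scale_mem)
  have fN: "cov (f x) N = a x" if "x \<in> G" for x
    using fZ[OF that] covN[of "f x"] cov_sym[of Z "f x"] cov_sym[of N "f x"] by (simp add: a_def)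
  have \<xi>N: "cov (\<xi> x) N = 0" if "x \<in> G" for x
    unfolding \<xi>_def using cov_diff[OF fH[OF that] scale_mem[OF NH] NH] fN[OF that] NN
    by (simp add: cov_scale)
  have [measurable]: "N \<in> borel_measurable M" using NH by (rule measurable_mem)
  have [measurable]: "\<And>x. x \<in> G \<Longrightarrow> \<xi> x \<in> borel_measurable M" using \<xi>H measurable_mem by auto
  let ?S = "PiM G (\<lambda>_. borel :: real measure)"
  let ?\<xi> = "\<lambda>\<omega>. \<lambda>x\<in>G. \<xi> x \<omega>"
  have \<xi>m[measurable]: "?\<xi> \<in> measurable M ?S" by (intro measurable_restrict) auto
  interpret D1: prob_space "distr M ?S ?\<xi>" by (rule prob_space_distr) simp
  interpret D2: prob_space "distr M borel N" by (rule prob_space_distr) simp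
  have sets_prod: "sets (distr M ?S ?\<xi> \<Otimes>\<^sub>M distr M borel N) = sets (?S \<Otimes>\<^sub>M borel)"
    by (intro sets_pair_measure_cong) auto
  have prod: "distr M ?S ?\<xi> \<Otimes>\<^sub>M distr M borel N = distr M (?S \<Otimes>\<^sub>M borel) (\<lambda>\<omega>. (?\<xi> \<omega>, N \<omega>))"
  proof (rule pair_measure_eqI)
    fix A B assume "A \<in> sets (distr M ?S ?\<xi>)" "B \<in> sets (distr M borel N)"
    then have [measurable]: "A \<in> sets ?S" "B \<in> sets borel" by auto
    \<comment> \<open>The independence statement concerns families, so the single variable
      \<open>N\<close> is viewed as a family indexed by the unit type.\<close>
    let ?B = "(\<lambda>v. v ()) -` B \<inter> space (PiM {()} (\<lambda>_. borel :: real measure))"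
    have B': "?B \<in> sets (PiM {()} (\<lambda>_. borel))" by measurable
    have "prob {\<omega> \<in> space M. ?\<xi> \<omega> \<in> A \<and> (\<lambda>j\<in>{()}. N \<omega>) \<in> ?B} = prob {\<omega> \<in> space M. ?\<xi> \<omega> \<in> A} * prob {\<omega> \<in> space M. (\<lambda>j\<in>{()}. N \<omega>) \<in> ?B}"
      by (rule uncorrelated_indep[OF G(1) _ \<xi>H _ _ _ B']) (auto simp: NH \<xi>N)
    then have "prob {\<omega> \<in> space M. ?\<xi> \<omega> \<in> A \<and> N \<omega> \<in> B} = prob {\<omega> \<in> space M. ?\<xi> \<omega> \<in> A} * prob {\<omega> \<in> space M. N \<omega> \<in> B}"
      by (simp add: space_PiM)
    then show "emeasure (distr M ?S ?\<xi>) A * emeasure (distr M borel N) B = emeasure (distr M (?S \<Otimes>\<^sub>M borel) (\<lambda>\<omega>. (?\<xi> \<omega>, N \<omega>))) (A \<times> B)"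
      by (simp add: emeasure_distr emeasure_eq_measure ennreal_mult[symmetric] vimage_def Int_def conj_ac)
  qed (auto intro: D1.sigma_finite_measure_axioms D2.sigma_finite_measure_axioms simp: sets_prod)
  define U where "U r p = (\<lambda>x\<in>G. fst p x + a x * (snd p + r))" for r and p :: "('i \<Rightarrow> real) \<times> real"
  have [measurable]: "U r \<in> measurable (?S \<Otimes>\<^sub>M borel) ?S" for r
    unfolding U_def by (intro measurable_restrict) measurable
  define T where "T = {p \<in> space (?S \<Otimes>\<^sub>M borel). U (s * \<tau>) p \<in> E \<and> U (- (s * \<tau>)) p \<notin> E}"
  have Tm[measurable]: "T \<in> sets (?S \<Otimes>\<^sub>M borel)"
    unfolding T_def by measurable
  have sect: "emeasure (distr M borel N) (Pair v -` T) \<le> ennreal (4 * s * \<tau>)" if v: "v \<in> space ?S" for v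
  proof (cases "Pair v -` T = {}")
    case False
    then obtain z0 where z0: "(v, z0) \<in> T" by auto
    \<comment> \<open>Two points of the section differ by at most \<open>2 * s * \<tau>\<close>. An
      interval centred at one of them has twice that length, whence the factor 4.\<close>
    have "Pair v -` T \<subseteq> {z0 - 2 * s * \<tau>..z0 + 2 * s * \<tau>}"
    proof
      fix z assume "z \<in> Pair v -` T"
      then have z: "(v, z) \<in> T" by simp
      have no: "\<not> y + 2 * s * \<tau> < z" if y: "(v, y) \<in> T" and z: "(v, z) \<in> T" for y z
      proof
        assume lt: "y + 2 * s * \<tau> < z"
        have "(\<lambda>x\<in>G. v x + a x * (z - s * \<tau>)) \<in> E"
        proof (rule incr)
          show "(\<lambda>x\<in>G. v x + a x * (y + s * \<tau>)) \<in> E" using y by (simp add: T_def U_def)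
          fix x assume x: "x \<in> G"
          have "a x \<ge> 0" using h[OF x] \<tau> by (simp add: a_def)
          then have "a x * (y + s * \<tau>) \<le> a x * (z - s * \<tau>)" using lt by (intro mult_left_mono) (linarith, assumption)
          then show "(\<lambda>x\<in>G. v x + a x * (y + s * \<tau>)) x \<le> (\<lambda>x\<in>G. v x + a x * (z - s * \<tau>)) x" using x by simp
        qed (simp add: space_PiM)
        then show False using z by (simp add: T_def U_def)
      qed
      show "z \<in> {z0 - 2 * s * \<tau>..z0 + 2 * s * \<tau>}"
        using no[OF z0 z] no[OF z z0] by auto
    qed
    then have "emeasure (distr M borel N) (Pair v -` T) \<le> emeasure (distr M borel N) {z0 - 2 * s * \<tau>..z0 + 2 * s * \<tau>}"
      by (intro emeasure_mono) auto
    also have "\<dots> = ennreal (prob {\<omega> \<in> space M. N \<omega> \<in> {z0 - 2 * s * \<tau>..z0 + 2 * s * \<tau>}})"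
      by (simp add: emeasure_distr emeasure_eq_measure vimage_def Int_def conj_ac)
    also have "\<dots> \<le> ennreal (4 * s * \<tau>)"
    proof (rule ennreal_leI)
      have "0 \<le> s * \<tau>" using s \<tau> by simp
      then show "prob {\<omega> \<in> space M. N \<omega> \<in> {z0 - 2 * s * \<tau>..z0 + 2 * s * \<tau>}} \<le> 4 * s * \<tau>"
        using interval_bound[OF NH, of "z0 - 2 * s * \<tau>" "z0 + 2 * s * \<tau>"] NN by (simp add: mult.commute mult.left_commute)
    qed
    finally show ?thesis .
  qed simp
  \<comment> \<open>Adding r h to the field is the same as adding r \<tau> to \<open>N\<close> while
    leaving \<open>\<xi>\<close> fixed.\<close>
  have split: "(\<lambda>x\<in>G. f x \<omega> + r * h x) = (\<lambda>x\<in>G. ?\<xi> \<omega> x + a x * (N \<omega> + r * \<tau>))" for r \<omega>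
    using \<tau> by (auto simp: \<xi>_def a_def field_simps)
  have "{\<omega> \<in> space M. (\<lambda>x\<in>G. f x \<omega> + s) \<in> E \<and> (\<lambda>x\<in>G. f x \<omega> - s) \<notin> E} \<subseteq> (\<lambda>\<omega>. (?\<xi> \<omega>, N \<omega>)) -` T \<inter> space M"
  proof (rule subsetI)
    fix \<omega> assume "\<omega> \<in> {\<omega> \<in> space M. (\<lambda>x\<in>G. f x \<omega> + s) \<in> E \<and> (\<lambda>x\<in>G. f x \<omega> - s) \<notin> E}"
    then have w: "\<omega> \<in> space M" and u: "(\<lambda>x\<in>G. f x \<omega> + s) \<in> E" and d: "(\<lambda>x\<in>G. f x \<omega> - s) \<notin> E" by auto
    \<comment> \<open>As \<open>h\<close> is at least 1 on \<open>G\<close>, the shift by s h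
      dominates the constant shift by s, upwards and downwards, and monotonicity of \<open>E\<close>
      passes to the shifts along \<open>h\<close>.\<close>
    have sh: "s \<le> s * h x" if "x \<in> G" for x using s h[OF that] mult_left_mono[of 1 "h x" s] by simp
    have "(\<lambda>x\<in>G. f x \<omega> + s * h x) \<in> E"
      by (rule incr[OF u]) (use sh in \<open>auto simp: space_PiM\<close>)
    moreover have "(\<lambda>x\<in>G. f x \<omega> + (- s) * h x) \<notin> E"
    proof
      assume "(\<lambda>x\<in>G. f x \<omega> + (- s) * h x) \<in> E"
      then have "(\<lambda>x\<in>G. f x \<omega> - s) \<in> E"
        by (rule incr) (use sh in \<open>auto simp: space_PiM\<close>)
      with d show False by simp
    qed
    ultimately have "(?\<xi> \<omega>, N \<omega>) \<in> T"
      unfolding split by (simp add: T_def U_def space_PiM space_pair_measure)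
    with w show "\<omega> \<in> (\<lambda>\<omega>. (?\<xi> \<omega>, N \<omega>)) -` T \<inter> space M" by simp
  qed
  then have "emeasure M {\<omega> \<in> space M. (\<lambda>x\<in>G. f x \<omega> + s) \<in> E \<and> (\<lambda>x\<in>G. f x \<omega> - s) \<notin> E} \<le> emeasure M ((\<lambda>\<omega>. (?\<xi> \<omega>, N \<omega>)) -` T \<inter> space M)"
    by (intro emeasure_mono) auto
  also have "\<dots> = emeasure (distr M ?S ?\<xi> \<Otimes>\<^sub>M distr M borel N) T"
    unfolding prod by (subst emeasure_distr) auto
  also have "\<dots> = (\<integral>\<^sup>+v. emeasure (distr M borel N) (Pair v -` T) \<partial>distr M ?S ?\<xi>)"
    by (rule D2.emeasure_pair_measure_alt) (simp only: sets_prod Tm)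
  also have "\<dots> \<le> (\<integral>\<^sup>+v. ennreal (4 * s * \<tau>) \<partial>distr M ?S ?\<xi>)"
    by (intro nn_integral_mono sect) simp
  also have "\<dots> = ennreal (4 * s * \<tau>)" using D1.emeasure_space_1 by simp
  also have "\<dots> \<le> ennreal (4 * s * sqrt K)"
    using s \<tau>K by (intro ennreal_leI mult_left_mono) auto
  finally have "ennreal (prob {\<omega> \<in> space M. (\<lambda>x\<in>G. f x \<omega> + s) \<in> E \<and> (\<lambda>x\<in>G. f x \<omega> - s) \<notin> E}) \<le> ennreal (4 * s * sqrt K)"
    by (simp add: emeasure_eq_measure)
  moreover have "0 < sqrt K" using \<tau>K \<tau>(1) by linarith
  then have "0 \<le> 4 * s * sqrt K" using s by simp
  ultimately show ?thesis by (simp only: ennreal_le_iff)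
qed

end

section \<open>A local Bessel inequality for the Fourier transform\<close>

lemma borel_measurable_cnj[measurable]: "cnj \<in> borel_measurable borel"
  by (intro borel_measurable_continuous_onI) (auto intro!: continuous_intros)

lemma nn_integral_lborel_reflect:
  fixes f :: "'a::euclidean_space \<Rightarrow> ennreal"
  assumes [measurable]: "f \<in> borel_measurable borel"
  shows "(\<integral>\<^sup>+y. f (x - y) \<partial>lborel) = (\<integral>\<^sup>+y. f y \<partial>lborel)"
proof -
  have "(\<integral>\<^sup>+y. f y \<partial>lborel) = (\<integral>\<^sup>+y. f y \<partial>density (distr lborel borel (\<lambda>y. x + (-1) *\<^sub>R y)) (\<lambda>_. 1))"
    by (subst lborel_affine[of "-1" x]) simp_all
  then show ?thesis by (simp add: density_1 nn_integral_distr)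
qed

lemma nn_integral_lborel_shift:
  fixes f :: "'a::euclidean_space \<Rightarrow> ennreal"
  assumes [measurable]: "f \<in> borel_measurable borel"
  shows "(\<integral>\<^sup>+y. f (y - x) \<partial>lborel) = (\<integral>\<^sup>+y. f y \<partial>lborel)"
proof -
  have "(\<integral>\<^sup>+y. f y \<partial>lborel) = (\<integral>\<^sup>+y. f y \<partial>density (distr lborel borel (\<lambda>y. - x + 1 *\<^sub>R y)) (\<lambda>_. 1))"
    by (subst lborel_affine[of "1" "- x"]) simp_all
  then show ?thesis by (simp add: density_1 nn_integral_distr)
qed

text \<open>The standard Gaussian density, a smooth substitute for the indicator of the unit ball:
  it is bounded below there, and its Fourier transform \<open>gauss_kernel\<close> is explicit,
  nonnegative and integrable.\<close>

definition gauss_weight :: "'a::euclidean_space \<Rightarrow> real" where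
  "gauss_weight s = (\<Prod>b\<in>Basis. std_normal_density (s \<bullet> b))"

definition gauss_kernel :: "'a::euclidean_space \<Rightarrow> real" where
  "gauss_kernel z = (\<Prod>b\<in>Basis. exp (- (2 * pi * (z \<bullet> b))\<^sup>2 / 2))"

lemma measurable_gauss[measurable]:
  "gauss_weight \<in> borel_measurable borel" "gauss_kernel \<in> borel_measurable borel"
  unfolding gauss_weight_def[abs_def] gauss_kernel_def[abs_def] by measurable

lemma gauss_nonneg: "0 \<le> gauss_weight s" "0 \<le> gauss_kernel s"
  by (auto simp: gauss_weight_def gauss_kernel_def intro!: prod_nonneg)

lemma nn_integral_gauss_weight: "(\<integral>\<^sup>+s. ennreal (gauss_weight (s::'a::euclidean_space)) \<partial>lborel) = 1"
proof -
  have "(\<integral>\<^sup>+s. ennreal (gauss_weight (s::'a)) \<partial>lborel) = (\<integral>\<^sup>+s. (\<Prod>b\<in>Basis. ennreal (std_normal_density ((s::'a) \<bullet> b))) \<partial>lborel)"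
    by (simp add: gauss_weight_def prod_ennreal)
  also have "\<dots> = (\<Prod>b\<in>(Basis::'a set). \<integral>\<^sup>+x. ennreal (std_normal_density x) \<partial>lborel)"
    by (rule nn_integral_lborel_prod) auto
  finally show ?thesis by (simp add: nn_integral_eq_integral)
qed

lemma nn_integral_gauss_kernel_finite: "(\<integral>\<^sup>+z. ennreal (gauss_kernel (z::'a::euclidean_space)) \<partial>lborel) < \<infinity>"
proof -
  have one: "(\<integral>\<^sup>+x. ennreal (exp (- (2 * pi * x)\<^sup>2 / 2)) \<partial>lborel) < \<infinity>"
  proof -
    have "integrable lborel (\<lambda>x. sqrt (2 * pi * (1 / (2 * pi))\<^sup>2) * normal_density 0 (1 / (2 * pi)) x)"
      by (intro integrable_mult_right integrable_normal_density) simp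
    moreover have "sqrt (2 * pi * (1 / (2 * pi))\<^sup>2) * normal_density 0 (1 / (2 * pi)) x = exp (- (2 * pi * x)\<^sup>2 / 2)" for x
      unfolding normal_density_def by (simp add: field_simps)
    ultimately have "integrable lborel (\<lambda>x. exp (- (2 * pi * x)\<^sup>2 / 2))" by simp
    then show ?thesis by (simp add: integrable_iff_bounded)
  qed
  have "(\<integral>\<^sup>+z. ennreal (gauss_kernel (z::'a)) \<partial>lborel) = (\<integral>\<^sup>+z. (\<Prod>b\<in>Basis. ennreal (exp (- (2 * pi * ((z::'a) \<bullet> b))\<^sup>2 / 2))) \<partial>lborel)"
    by (simp add: gauss_kernel_def prod_ennreal)
  also have "\<dots> = (\<Prod>b\<in>(Basis::'a set). \<integral>\<^sup>+x. ennreal (exp (- (2 * pi * x)\<^sup>2 / 2)) \<partial>lborel)"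
    by (rule nn_integral_lborel_prod) auto
  also have "\<dots> < \<infinity>" using one by (simp add: power_less_top_ennreal)
  finally show ?thesis .
qed

text \<open>The integral factorises over the coordinates into characteristic functions of the
  standard normal law at 2 pi times the coordinates of \<open>z\<close>.\<close>

lemma gauss_weight_transform:
  fixes z :: "'a::euclidean_space"
  shows "(LINT s|lborel. gauss_weight s *\<^sub>R cis (2 * pi * (z \<bullet> s))) = complex_of_real (gauss_kernel z)"
proof -
  interpret product_sigma_finite "\<lambda>_::'a. lborel :: real measure" ..
  let ?f = "\<lambda>b x. std_normal_density x *\<^sub>R cis (2 * pi * (z \<bullet> b) * x)"
  have int: "integrable lborel (?f b)" for b
    by (rule Bochner_Integration.integrable_bound[of lborel std_normal_density]) auto
  have split: "gauss_weight (\<Sum>b\<in>Basis. f b *\<^sub>R b) *\<^sub>R cis (2 * pi * (z \<bullet> (\<Sum>b\<in>Basis. f b *\<^sub>R b))) = (\<Prod>b\<in>Basis. ?f b (f b))" for f :: "'a \<Rightarrow> real"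
  proof -
    have "cis (2 * pi * (z \<bullet> (\<Sum>b\<in>Basis. f b *\<^sub>R b))) = (\<Prod>b\<in>Basis. cis (2 * pi * (z \<bullet> b) * f b))"
      by (simp add: cis_conv_exp inner_sum_right sum_distrib_left exp_sum[symmetric] mult_ac)
    moreover have "gauss_weight (\<Sum>b\<in>Basis. f b *\<^sub>R b) = (\<Prod>b\<in>Basis. std_normal_density (f b))"
      by (simp add: gauss_weight_def)
    ultimately show ?thesis by (simp add: scaleR_conv_of_real prod.distrib)
  qed
  have "(LINT s|lborel. gauss_weight s *\<^sub>R cis (2 * pi * (z \<bullet> s)))
      = (LINT f|(\<Pi>\<^sub>M b\<in>Basis. lborel). gauss_weight (\<Sum>b\<in>Basis. f b *\<^sub>R b) *\<^sub>R cis (2 * pi * (z \<bullet> (\<Sum>b\<in>Basis. f b *\<^sub>R (b::'a)))))"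
    by (subst lborel_eq, subst integral_distr) auto
  also have "\<dots> = (\<Prod>b\<in>Basis. LINT x|lborel. ?f b x)"
    unfolding split by (rule product_integral_prod) (auto intro: int)
  also have "\<dots> = (\<Prod>b\<in>Basis. complex_of_real (exp (- (2 * pi * (z \<bullet> b))\<^sup>2 / 2)))"
  proof (intro prod.cong refl)
    fix b
    have "char std_normal_distribution (2 * pi * (z \<bullet> b)) = (LINT x|lborel. ?f b x)"
      unfolding char_def by (subst integral_density) (auto simp: cis_conv_exp)
    then show "(LINT x|lborel. ?f b x) = complex_of_real (exp (- (2 * pi * (z \<bullet> b))\<^sup>2 / 2))"
      by (simp add: char_std_normal_distribution)
  qed
  finally show ?thesis by (simp add: gauss_kernel_def)
qed

text \<open>Writing the squared transform as a double integral and integrating over the frequency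
  first turns the left side into the quadratic form with kernel \<open>gauss_kernel (x - y)\<close>.
  By |a b| <= (a^2 + b^2) / 2 it is at most the integral of the kernel times the squared L2 norm.
  Integrability of \<open>u\<close> justifies Fubini, while the constant does not depend on
  \<open>u\<close>, so that the bound survives L2 limits.\<close>

lemma weighted_Bessel:
  fixes u :: "real^2 \<Rightarrow> complex"
  assumes u: "integrable lborel u"
  shows "(\<integral>\<^sup>+s. ennreal (gauss_weight s * (norm (fourier_L1 u s))\<^sup>2) \<partial>lborel)
     \<le> (\<integral>\<^sup>+z. ennreal (gauss_kernel (z::real^2)) \<partial>lborel) * (\<integral>\<^sup>+x. ennreal ((norm (u x))\<^sup>2) \<partial>lborel)"
proof -
  have [measurable]: "u \<in> borel_measurable borel" using borel_measurable_integrable[OF u] by simp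
  let ?L = "lborel :: (real^2) measure"
  let ?C = "\<integral>\<^sup>+z. ennreal (gauss_kernel (z::real^2)) \<partial>lborel"
  let ?u2 = "\<integral>\<^sup>+x. ennreal ((norm (u x))\<^sup>2) \<partial>lborel"
  define F where "F p s = gauss_weight s *\<^sub>R cis (2 * pi * ((fst p - snd p) \<bullet> s)) * (u (fst p) * cnj (u (snd p)))" for p :: "(real^2) \<times> (real^2)" and s :: "real^2"
  interpret LLL: pair_sigma_finite "?L \<Otimes>\<^sub>M ?L" ?L
    unfolding pair_sigma_finite_def by (simp add: lborel_prod sigma_finite_lborel)
  have Fm[measurable]: "case_prod F \<in> borel_measurable ((?L \<Otimes>\<^sub>M ?L) \<Otimes>\<^sub>M ?L)"
    unfolding F_def[abs_def] by measurable
  have nF: "norm (F p s) = gauss_weight s * (norm (u (fst p)) * norm (u (snd p)))" for p s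
    by (simp add: F_def norm_mult gauss_nonneg)
  have u_prod: "(\<integral>\<^sup>+x. \<integral>\<^sup>+y. ennreal (norm (u x)) * ennreal (norm (u y)) \<partial>?L \<partial>?L) < \<infinity>"
    using u by (simp add: nn_integral_cmult nn_integral_multc integrable_iff_bounded ennreal_mult_less_top)
  have Fint: "integrable ((?L \<Otimes>\<^sub>M ?L) \<Otimes>\<^sub>M ?L) (case_prod F)"
  proof (rule integrableI_bounded[OF Fm])
    have "(\<integral>\<^sup>+z. ennreal (norm (case_prod F z)) \<partial>((?L \<Otimes>\<^sub>M ?L) \<Otimes>\<^sub>M ?L))
       = (\<integral>\<^sup>+p. \<integral>\<^sup>+s. ennreal (norm (F p s)) \<partial>?L \<partial>(?L \<Otimes>\<^sub>M ?L))"
      by (subst lborel.nn_integral_fst[symmetric]) auto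
    also have "\<dots> = (\<integral>\<^sup>+p. ennreal (norm (u (fst p))) * ennreal (norm (u (snd p))) \<partial>(?L \<Otimes>\<^sub>M ?L))"
      unfolding nF by (simp add: ennreal_mult gauss_nonneg nn_integral_multc nn_integral_gauss_weight)
    also have "\<dots> = (\<integral>\<^sup>+x. \<integral>\<^sup>+y. ennreal (norm (u x)) * ennreal (norm (u y)) \<partial>?L \<partial>?L)"
      by (subst lborel.nn_integral_fst[symmetric]) auto
    also note u_prod
    finally show "(\<integral>\<^sup>+z. ennreal (norm (case_prod F z)) \<partial>((?L \<Otimes>\<^sub>M ?L) \<Otimes>\<^sub>M ?L)) < \<infinity>" .
  qed
  have inner_xy: "(LINT p|(?L \<Otimes>\<^sub>M ?L). F p s) = complex_of_real (gauss_weight s * (norm (fourier_L1 u s))\<^sup>2)" for s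
  proof -
    let ?v = "\<lambda>x. cis (2 * pi * (x \<bullet> s)) * u x"
    have vi: "integrable lborel ?v" by (rule Bochner_Integration.integrable_bound[OF u]) (auto simp: norm_mult)
    have Fs: "F p s = gauss_weight s *\<^sub>R (?v (fst p) * cnj (?v (snd p)))" for p
      by (simp add: F_def cis_cnj cis_mult[symmetric] inner_diff_left right_diff_distrib cis_divide[symmetric] divide_inverse)
    have "integrable (?L \<Otimes>\<^sub>M ?L) (\<lambda>p. ?v (fst p) * cnj (?v (snd p)))"
    proof (rule integrableI_bounded)
      have "(\<integral>\<^sup>+p. ennreal (norm (?v (fst p) * cnj (?v (snd p)))) \<partial>(?L \<Otimes>\<^sub>M ?L))
        = (\<integral>\<^sup>+x. \<integral>\<^sup>+y. ennreal (norm (u x)) * ennreal (norm (u y)) \<partial>?L \<partial>?L)"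
        by (subst lborel.nn_integral_fst[symmetric]) (auto simp: norm_mult ennreal_mult)
      also note u_prod
      finally show "(\<integral>\<^sup>+p. ennreal (norm (?v (fst p) * cnj (?v (snd p)))) \<partial>(?L \<Otimes>\<^sub>M ?L)) < \<infinity>" .
    qed measurable
    then have "(LINT p|(?L \<Otimes>\<^sub>M ?L). ?v (fst p) * cnj (?v (snd p))) = (LINT x|?L. LINT y|?L. ?v x * cnj (?v y))"
      by (subst lborel_pair.integral_fst'[symmetric]) auto
    also have "\<dots> = fourier_L1 u s * cnj (fourier_L1 u s)"
      unfolding fourier_L1_def
      by (simp only: integral_mult_right_zero integral_mult_left_zero Bochner_Integration.integral_cnj)
    also have "\<dots> = complex_of_real ((norm (fourier_L1 u s))\<^sup>2)" by (simp only: complex_norm_square)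
    finally show ?thesis
      unfolding Fs integral_scaleR_right by (simp only:) (simp add: scaleR_conv_of_real)
  qed
  have inner_s: "(LINT s|?L. F p s) = gauss_kernel (fst p - snd p) *\<^sub>R (u (fst p) * cnj (u (snd p)))" for p
    unfolding F_def integral_mult_left_zero gauss_weight_transform by (simp only: scaleR_conv_of_real)
  have "integrable ?L (\<lambda>s. LINT p|(?L \<Otimes>\<^sub>M ?L). F p s)"
    using LLL.integrable_snd[OF Fint] .
  then have "integrable ?L (\<lambda>s. complex_of_real (gauss_weight s * (norm (fourier_L1 u s))\<^sup>2))"
    unfolding inner_xy .
  then have i: "integrable ?L (\<lambda>s. gauss_weight s * (norm (fourier_L1 u s))\<^sup>2)"
    by (simp only: complex_of_real_integrable_eq)
  have "complex_of_real (LINT s|?L. gauss_weight s * (norm (fourier_L1 u s))\<^sup>2) = (LINT s|?L. LINT p|(?L \<Otimes>\<^sub>M ?L). F p s)"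
    unfolding inner_xy by (simp only: integral_complex_of_real)
  also have "\<dots> = (LINT p|(?L \<Otimes>\<^sub>M ?L). LINT s|?L. F p s)"
    using LLL.Fubini_integral[OF Fint] .
  also have "\<dots> = (LINT p|(?L \<Otimes>\<^sub>M ?L). gauss_kernel (fst p - snd p) *\<^sub>R (u (fst p) * cnj (u (snd p))))"
    unfolding inner_s ..
  finally have eq: "complex_of_real (LINT s|?L. gauss_weight s * (norm (fourier_L1 u s))\<^sup>2) = \<dots>" .
  have "(\<integral>\<^sup>+s. ennreal (gauss_weight s * (norm (fourier_L1 u s))\<^sup>2) \<partial>?L) = ennreal (LINT s|?L. gauss_weight s * (norm (fourier_L1 u s))\<^sup>2)"
    using i by (intro nn_integral_eq_integral) (auto simp: gauss_nonneg)
  also have "\<dots> = ennreal (norm (complex_of_real (LINT s|?L. gauss_weight s * (norm (fourier_L1 u s))\<^sup>2)))"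
    by (simp add: gauss_nonneg integral_nonneg_AE)
  also have "\<dots> \<le> (\<integral>\<^sup>+p. ennreal (norm (gauss_kernel (fst p - snd p) *\<^sub>R (u (fst p) * cnj (u (snd p))))) \<partial>(?L \<Otimes>\<^sub>M ?L))"
    unfolding eq by (rule integral_norm_bound_ennreal) (use LLL.integrable_fst[OF Fint] in \<open>simp add: inner_s\<close>)
  also have "\<dots> = (\<integral>\<^sup>+x. \<integral>\<^sup>+y. ennreal (gauss_kernel (x - y) * (norm (u x) * norm (u y))) \<partial>?L \<partial>?L)"
    by (subst lborel.nn_integral_fst[symmetric]) (auto simp: norm_mult gauss_nonneg)
  also have "\<dots> \<le> (\<integral>\<^sup>+x. \<integral>\<^sup>+y. ennreal (gauss_kernel (x - y)) * ennreal ((norm (u x))\<^sup>2 / 2) + ennreal (gauss_kernel (x - y)) * ennreal ((norm (u y))\<^sup>2 / 2) \<partial>?L \<partial>?L)"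
  proof (intro nn_integral_mono)
    fix x y :: "real^2"
    have "norm (u x) * norm (u y) \<le> (norm (u x))\<^sup>2 / 2 + (norm (u y))\<^sup>2 / 2"
      using sum_squares_bound[of "norm (u x)" "norm (u y)"] by (simp add: field_simps)
    then have "gauss_kernel (x - y) * (norm (u x) * norm (u y)) \<le> gauss_kernel (x - y) * ((norm (u x))\<^sup>2 / 2 + (norm (u y))\<^sup>2 / 2)"
      by (intro mult_left_mono gauss_nonneg)
    then show "ennreal (gauss_kernel (x - y) * (norm (u x) * norm (u y))) \<le> ennreal (gauss_kernel (x - y)) * ennreal ((norm (u x))\<^sup>2 / 2) + ennreal (gauss_kernel (x - y)) * ennreal ((norm (u y))\<^sup>2 / 2)"
      by (simp add: ennreal_mult[symmetric] ennreal_plus[symmetric] gauss_nonneg distrib_left del: ennreal_plus)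
  qed
  also have "\<dots> = (\<integral>\<^sup>+x. \<integral>\<^sup>+y. ennreal (gauss_kernel (x - y)) * ennreal ((norm (u x))\<^sup>2 / 2) \<partial>?L \<partial>?L) + (\<integral>\<^sup>+x. \<integral>\<^sup>+y. ennreal (gauss_kernel (x - y)) * ennreal ((norm (u y))\<^sup>2 / 2) \<partial>?L \<partial>?L)"
    by (simp add: nn_integral_add)
  also have "(\<integral>\<^sup>+x. \<integral>\<^sup>+y. ennreal (gauss_kernel (x - y)) * ennreal ((norm (u y))\<^sup>2 / 2) \<partial>?L \<partial>?L) = (\<integral>\<^sup>+y. \<integral>\<^sup>+x. ennreal (gauss_kernel (x - y)) * ennreal ((norm (u y))\<^sup>2 / 2) \<partial>?L \<partial>?L)"
    by (rule lborel_pair.Fubini'[symmetric]) measurable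
  also have "(\<integral>\<^sup>+x. \<integral>\<^sup>+y. ennreal (gauss_kernel (x - y)) * ennreal ((norm (u x))\<^sup>2 / 2) \<partial>?L \<partial>?L) = ?C * (\<integral>\<^sup>+x. ennreal ((norm (u x))\<^sup>2 / 2) \<partial>?L)"
    using nn_integral_lborel_reflect[of "\<lambda>z. ennreal (gauss_kernel (z::real^2))"] by (simp add: nn_integral_multc nn_integral_cmult)
  also have "(\<integral>\<^sup>+y. \<integral>\<^sup>+x. ennreal (gauss_kernel (x - y)) * ennreal ((norm (u y))\<^sup>2 / 2) \<partial>?L \<partial>?L) = ?C * (\<integral>\<^sup>+x. ennreal ((norm (u x))\<^sup>2 / 2) \<partial>?L)"
    using nn_integral_lborel_shift[of "\<lambda>z. ennreal (gauss_kernel (z::real^2))"] by (simp add: nn_integral_multc nn_integral_cmult)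
  also have "?C * (\<integral>\<^sup>+x. ennreal ((norm (u x))\<^sup>2 / 2) \<partial>?L) + ?C * (\<integral>\<^sup>+x. ennreal ((norm (u x))\<^sup>2 / 2) \<partial>?L) = ?C * (\<integral>\<^sup>+x. ennreal ((norm (u x))\<^sup>2 / 2) + ennreal ((norm (u x))\<^sup>2 / 2) \<partial>?L)"
    by (subst nn_integral_add) (simp_all add: distrib_left)
  also have "\<dots> = ?C * ?u2"
    by (simp add: ennreal_plus[symmetric] del: ennreal_plus)
  finally show ?thesis .
qed

lemma gauss_weight_ge:
  assumes "norm (s :: 'a::euclidean_space) \<le> 1"
  shows "(exp (- 1 / 2) / sqrt (2 * pi)) ^ DIM('a) \<le> gauss_weight s"
proof -
  have "(\<Prod>b\<in>(Basis::'a set). exp (- 1 / 2) / sqrt (2 * pi)) \<le> gauss_weight s"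
    unfolding gauss_weight_def
  proof (intro prod_mono conjI)
    fix b :: 'a assume "b \<in> Basis"
    then have "\<bar>s \<bullet> b\<bar> \<le> 1" using Basis_le_norm assms by (meson order_trans)
    then have "(s \<bullet> b)\<^sup>2 \<le> 1" by (simp add: abs_square_le_1)
    then show "exp (- 1 / 2) / sqrt (2 * pi) \<le> std_normal_density (s \<bullet> b)"
      by (simp add: std_normal_density_def divide_right_mono)
  qed simp
  then show ?thesis by simp
qed

text \<open>On the unit ball the Gaussian weight is at least \<open>w0\<close>; dividing the
  weighted inequality by \<open>w0\<close> localises it.\<close>

lemma local_Bessel:
  obtains C :: real where "C > 0"
    "\<And>u :: real^2 \<Rightarrow> complex. integrable lborel u \<Longrightarrow>
       (\<integral>\<^sup>+s. ennreal ((norm (fourier_L1 u s))\<^sup>2) * indicator (cball 0 1) s \<partial>lborel) \<le> ennreal C * (\<integral>\<^sup>+x. ennreal ((norm (u x))\<^sup>2) \<partial>lborel)"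
proof -
  define w0 where "w0 = (exp (- 1 / 2) / sqrt (2 * pi)) ^ DIM(real^2)"
  have w0: "w0 > 0" by (simp add: w0_def)
  define C0 where "C0 = enn2real (\<integral>\<^sup>+z. ennreal (gauss_kernel (z::real^2)) \<partial>lborel)"
  have C0: "ennreal C0 = (\<integral>\<^sup>+z. ennreal (gauss_kernel (z::real^2)) \<partial>lborel)" "C0 \<ge> 0"
    using nn_integral_gauss_kernel_finite[where 'a = "real^2"] by (simp_all add: C0_def)
  show thesis
  \<comment> \<open>\<open>C0\<close> is only known to be nonnegative; adding 1 makes the constant
    positive.\<close>
  proof (rule that[of "(C0 + 1) / w0"])
    show "0 < (C0 + 1) / w0" using w0 C0 by simp
    fix u :: "real^2 \<Rightarrow> complex" assume u: "integrable lborel u"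
    let ?u2 = "\<integral>\<^sup>+x. ennreal ((norm (u x))\<^sup>2) \<partial>lborel"
    have [measurable]: "u \<in> borel_measurable borel" using borel_measurable_integrable[OF u] by simp
    have [measurable]: "fourier_L1 u \<in> borel_measurable borel"
      unfolding fourier_L1_def[abs_def] by measurable
    have "(\<integral>\<^sup>+s. ennreal ((norm (fourier_L1 u s))\<^sup>2) * indicator (cball 0 1) s \<partial>lborel)
       \<le> (\<integral>\<^sup>+s. ennreal (1 / w0) * ennreal (gauss_weight s * (norm (fourier_L1 u s))\<^sup>2) \<partial>lborel)"
    proof (intro nn_integral_mono)
      fix s :: "real^2"
      have "(norm (fourier_L1 u s))\<^sup>2 \<le> 1 / w0 * (gauss_weight s * (norm (fourier_L1 u s))\<^sup>2)" if "norm s \<le> 1"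
      proof -
        have "1 \<le> gauss_weight s / w0" using gauss_weight_ge[OF that] w0 by (simp add: w0_def)
        then have "1 * (norm (fourier_L1 u s))\<^sup>2 \<le> gauss_weight s / w0 * (norm (fourier_L1 u s))\<^sup>2" by (intro mult_right_mono) auto
        then show ?thesis by simp
      qed
      then show "ennreal ((norm (fourier_L1 u s))\<^sup>2) * indicator (cball 0 1) s \<le> ennreal (1 / w0) * ennreal (gauss_weight s * (norm (fourier_L1 u s))\<^sup>2)"
        using w0 by (auto simp: indicator_def ennreal_mult[symmetric] gauss_nonneg simp del: ennreal_1)
    qed
    also have "\<dots> = ennreal (1 / w0) * (\<integral>\<^sup>+s. ennreal (gauss_weight s * (norm (fourier_L1 u s))\<^sup>2) \<partial>lborel)"
      by (rule nn_integral_cmult) measurable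
    also have "\<dots> \<le> ennreal (1 / w0) * (ennreal C0 * ?u2)"
      unfolding C0 by (intro mult_left_mono weighted_Bessel u) auto
    also have "\<dots> \<le> ennreal ((C0 + 1) / w0) * ?u2"
      unfolding mult.assoc[symmetric] using w0 C0(2)
      by (intro mult_right_mono) (auto simp: ennreal_mult[symmetric] divide_right_mono)
    finally show "(\<integral>\<^sup>+s. ennreal ((norm (fourier_L1 u s))\<^sup>2) * indicator (cball 0 1) s \<partial>lborel) \<le> ennreal ((C0 + 1) / w0) * ?u2" .
  qed
qed

section \<open>From integrable functions to the L2 Fourier transform of combinations of
  translates\<close>

lemma norm_add_power2_le:
  fixes a b :: "'a::real_normed_vector"
  shows "(norm (a + b))\<^sup>2 \<le> 2 * (norm a)\<^sup>2 + 2 * (norm b)\<^sup>2"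
proof -
  have "(norm (a + b))\<^sup>2 \<le> (norm a + norm b)\<^sup>2" by (intro power_mono norm_triangle_ineq) auto
  also have "\<dots> \<le> 2 * (norm a)\<^sup>2 + 2 * (norm b)\<^sup>2"
    using sum_squares_bound[of "norm a" "norm b"] by (simp add: power2_sum)
  finally show ?thesis .
qed

lemma norm_sum_scaleR_power2_le:
  fixes w :: "'i \<Rightarrow> 'a::real_normed_vector"
  shows "(norm (\<Sum>x\<in>G. c x *\<^sub>R w x))\<^sup>2 \<le> (\<Sum>x\<in>G. (c x)\<^sup>2) * (\<Sum>x\<in>G. (norm (w x))\<^sup>2)"
proof -
  have "norm (\<Sum>x\<in>G. c x *\<^sub>R w x) \<le> (\<Sum>x\<in>G. \<bar>c x\<bar> * norm (w x))"
    using norm_sum[of "\<lambda>x. c x *\<^sub>R w x" G] by simp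
  then have "(norm (\<Sum>x\<in>G. c x *\<^sub>R w x))\<^sup>2 \<le> (\<Sum>x\<in>G. \<bar>c x\<bar> * norm (w x))\<^sup>2"
    by (intro power_mono) auto
  also have "\<dots> \<le> (\<Sum>x\<in>G. \<bar>c x\<bar>\<^sup>2) * (\<Sum>x\<in>G. (norm (w x))\<^sup>2)"
    by (rule Cauchy_Schwarz_ineq_sum)
  finally show ?thesis by simp
qed

lemma integrable_lborel_shift:
  fixes h :: "'a::euclidean_space \<Rightarrow> 'b::{banach, second_countable_topology}"
  assumes "integrable lborel h"
  shows "integrable lborel (\<lambda>u. h (u - x))"
    and "(LINT u|lborel. h (u - x)) = (LINT u|lborel. h u)"
proof -
  have d: "distr lborel borel (\<lambda>u. u - x) = lborel"
  proof -
    have "(+) (- x) = (\<lambda>u. u - x)" by auto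
    then show ?thesis using lborel_distr_plus[of "- x"] by simp
  qed
  have m: "h \<in> borel_measurable borel" using borel_measurable_integrable[OF assms] by simp
  show "integrable lborel (\<lambda>u. h (u - x))"
    using integrable_distr[of "\<lambda>u. u - x" lborel borel h] assms d by simp
  show "(LINT u|lborel. h (u - x)) = (LINT u|lborel. h u)"
    using integral_distr[of "\<lambda>u. u - x" lborel borel h] m d by simp
qed

lemma fourier_L1_shift_sum:
  assumes h: "integrable lborel h"
  shows "fourier_L1 (\<lambda>u. \<Sum>x\<in>G. c x *\<^sub>R h (u - x)) s = (\<Sum>x\<in>G. c x *\<^sub>R cis (2 * pi * (x \<bullet> s))) * fourier_L1 h s"
proof -
  have hm: "h \<in> borel_measurable borel" using borel_measurable_integrable[OF h] by simp
  let ?v = "\<lambda>u. cis (2 * pi * (u \<bullet> s)) * h u"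
  have v: "integrable lborel ?v"
    by (rule Bochner_Integration.integrable_bound[OF h]) (use hm in \<open>auto simp: norm_mult\<close>)
  have eq: "cis (2 * pi * (u \<bullet> s)) * (\<Sum>x\<in>G. c x *\<^sub>R h (u - x)) = (\<Sum>x\<in>G. (c x *\<^sub>R cis (2 * pi * (x \<bullet> s))) * ?v (u - x))" for u
  proof -
    have "cis (2 * pi * (u \<bullet> s)) = cis (2 * pi * (x \<bullet> s)) * cis (2 * pi * ((u - x) \<bullet> s))" for x
      by (simp add: cis_mult inner_diff_left algebra_simps)
    then have "cis (2 * pi * (u \<bullet> s)) * (c x *\<^sub>R h (u - x)) = (c x *\<^sub>R cis (2 * pi * (x \<bullet> s))) * ?v (u - x)" for x
      by (simp add: scaleR_conv_of_real mult_ac)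
    then show ?thesis by (simp only: sum_distrib_left)
  qed
  have "fourier_L1 (\<lambda>u. \<Sum>x\<in>G. c x *\<^sub>R h (u - x)) s = (\<Sum>x\<in>G. LINT u|lborel. (c x *\<^sub>R cis (2 * pi * (x \<bullet> s))) * ?v (u - x))"
    unfolding fourier_L1_def eq
    by (rule Bochner_Integration.integral_sum) (intro integrable_mult_right integrable_lborel_shift(1)[OF v])
  also have "\<dots> = (\<Sum>x\<in>G. (c x *\<^sub>R cis (2 * pi * (x \<bullet> s))) * fourier_L1 h s)"
    unfolding integral_mult_right_zero integrable_lborel_shift(2)[OF v] fourier_L1_def ..
  finally show ?thesis by (simp only: sum_distrib_right)
qed

lemma borel_measurable_fourier_L1:
  assumes "h \<in> borel_measurable borel"
  shows "fourier_L1 h \<in> borel_measurable borel"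
proof -
  note [measurable] = assms
  show ?thesis unfolding fourier_L1_def[abs_def] by measurable
qed

text \<open>Only one inequality of Plancherel's theorem is needed, and only near the origin.\<close>

lemma transform_local_bound:
  obtains C :: real where "C > 0"
    "\<And>g \<rho> G c. is_fourier_transform g \<rho> \<Longrightarrow> finite G \<Longrightarrow>
       (\<integral>\<^sup>+s. ennreal ((norm ((\<Sum>x\<in>G. c x *\<^sub>R cis (2 * pi * (x \<bullet> s))) * \<rho> s))\<^sup>2) * indicator (cball 0 1) s \<partial>lborel)
       \<le> ennreal C * (\<integral>\<^sup>+u. ennreal ((norm (\<Sum>x\<in>G. c x *\<^sub>R g (u - x)))\<^sup>2) \<partial>lborel)"
proof -
  obtain C where C: "C > 0" and bessel: "\<And>u :: real^2 \<Rightarrow> complex. integrable lborel u \<Longrightarrow>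
       (\<integral>\<^sup>+s. ennreal ((norm (fourier_L1 u s))\<^sup>2) * indicator (cball 0 1) s \<partial>lborel) \<le> ennreal C * (\<integral>\<^sup>+x. ennreal ((norm (u x))\<^sup>2) \<partial>lborel)"
    using local_Bessel by blast
  show thesis
  \<comment> \<open>Two replacements are made, \<open>\<rho>\<close> by the transform of
    \<open>h n\<close> and then \<open>h n\<close> by \<open>g\<close>, and each costs a factor 2
    through \<open>norm_add_power2_le\<close>.\<close>
  proof (rule that[of "4 * C"])
    show "4 * C > 0" using C by simp
    fix g \<rho> :: "real^2 \<Rightarrow> complex" and G :: "(real^2) set" and c :: "real^2 \<Rightarrow> real"
    assume ft: "is_fourier_transform g \<rho>" and G: "finite G"
    let ?T = "\<lambda>s. \<Sum>x\<in>G. c x *\<^sub>R cis (2 * pi * (x \<bullet> s))"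
    let ?I = "indicator (cball 0 1) :: real^2 \<Rightarrow> ennreal"
    let ?k = "\<lambda>u. \<Sum>x\<in>G. c x *\<^sub>R g (u - x)"
    let ?lhs = "\<integral>\<^sup>+s. ennreal ((norm (?T s * \<rho> s))\<^sup>2) * ?I s \<partial>lborel"
    let ?rhs = "\<integral>\<^sup>+u. ennreal ((norm (?k u))\<^sup>2) \<partial>lborel"
    have [measurable]: "g \<in> borel_measurable borel" "\<rho> \<in> borel_measurable borel"
      using ft by (auto simp: is_fourier_transform_def square_integrable_def)
    obtain h where h: "\<And>n. integrable lborel (h n)"
      and e: "(\<lambda>n. \<integral>\<^sup>+x. ennreal ((norm (h n x - g x))\<^sup>2) \<partial>lborel) \<longlonglongrightarrow> 0"
      and e': "(\<lambda>n. \<integral>\<^sup>+s. ennreal ((norm (fourier_L1 (h n) s - \<rho> s))\<^sup>2) \<partial>lborel) \<longlonglongrightarrow> 0"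
      using ft unfolding is_fourier_transform_def by blast
    have hm[measurable]: "h n \<in> borel_measurable borel" for n using borel_measurable_integrable[OF h] by simp
    have [measurable]: "fourier_L1 (h n) \<in> borel_measurable borel" for n by (rule borel_measurable_fourier_L1) simp
    let ?e = "\<lambda>n. \<integral>\<^sup>+x. ennreal ((norm (h n x - g x))\<^sup>2) \<partial>lborel"
    let ?e' = "\<lambda>n. \<integral>\<^sup>+s. ennreal ((norm (fourier_L1 (h n) s - \<rho> s))\<^sup>2) \<partial>lborel"
    define S where "S = (\<Sum>x\<in>G. \<bar>c x\<bar>)"
    define Q where "Q = (\<Sum>x\<in>G. (c x)\<^sup>2)"
    have SQ: "S \<ge> 0" "Q \<ge> 0" by (auto simp: S_def Q_def sum_nonneg)
    \<comment> \<open>A trigonometric polynomial is bounded, so multiplying by it preserves the L2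
      convergence of the transforms.\<close>
    have TS: "norm (?T s) \<le> S" for s
      using norm_sum[of "\<lambda>x. c x *\<^sub>R cis (2 * pi * (x \<bullet> s))" G] by (simp add: S_def)
    let ?u = "\<lambda>n u. \<Sum>x\<in>G. c x *\<^sub>R h n (u - x)"
    have ui: "integrable lborel (?u n)" for n
      by (intro Bochner_Integration.integrable_sum integrable_scaleR_right integrable_lborel_shift(1) h)
    have step1: "?lhs \<le> 2 * (\<integral>\<^sup>+s. ennreal ((norm (fourier_L1 (?u n) s))\<^sup>2) * ?I s \<partial>lborel) + ennreal (2 * S\<^sup>2) * ?e' n" for n
    proof -
      have "?lhs \<le> (\<integral>\<^sup>+s. 2 * (ennreal ((norm (fourier_L1 (?u n) s))\<^sup>2) * ?I s) + ennreal (2 * S\<^sup>2) * ennreal ((norm (fourier_L1 (h n) s - \<rho> s))\<^sup>2) \<partial>lborel)"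
      proof (intro nn_integral_mono)
        fix s :: "real^2"
        have "(norm (?T s * \<rho> s))\<^sup>2 = (norm (?T s * fourier_L1 (h n) s + ?T s * (\<rho> s - fourier_L1 (h n) s)))\<^sup>2"
          by (simp add: algebra_simps)
        also have "\<dots> \<le> 2 * (norm (?T s * fourier_L1 (h n) s))\<^sup>2 + 2 * (norm (?T s * (\<rho> s - fourier_L1 (h n) s)))\<^sup>2"
          by (rule norm_add_power2_le)
        also have "(norm (?T s * (\<rho> s - fourier_L1 (h n) s)))\<^sup>2 \<le> S\<^sup>2 * (norm (fourier_L1 (h n) s - \<rho> s))\<^sup>2"
          unfolding norm_mult power_mult_distrib norm_minus_commute[of "\<rho> s"]
          using TS by (intro mult_right_mono power_mono) auto
        finally have "(norm (?T s * \<rho> s))\<^sup>2 \<le> 2 * (norm (fourier_L1 (?u n) s))\<^sup>2 + 2 * S\<^sup>2 * (norm (fourier_L1 (h n) s - \<rho> s))\<^sup>2"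
          unfolding fourier_L1_shift_sum[OF h] by simp
        then have "ennreal ((norm (?T s * \<rho> s))\<^sup>2) \<le> ennreal (2 * (norm (fourier_L1 (?u n) s))\<^sup>2 + 2 * S\<^sup>2 * (norm (fourier_L1 (h n) s - \<rho> s))\<^sup>2)"
          by (rule ennreal_leI)
        also have "\<dots> = 2 * ennreal ((norm (fourier_L1 (?u n) s))\<^sup>2) + ennreal (2 * S\<^sup>2) * ennreal ((norm (fourier_L1 (h n) s - \<rho> s))\<^sup>2)"
          by (simp add: ennreal_mult)
        finally show "ennreal ((norm (?T s * \<rho> s))\<^sup>2) * ?I s \<le> 2 * (ennreal ((norm (fourier_L1 (?u n) s))\<^sup>2) * ?I s) + ennreal (2 * S\<^sup>2) * ennreal ((norm (fourier_L1 (h n) s - \<rho> s))\<^sup>2)"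
          by (auto simp: indicator_def)
      qed
      also have "\<dots> = 2 * (\<integral>\<^sup>+s. ennreal ((norm (fourier_L1 (?u n) s))\<^sup>2) * ?I s \<partial>lborel) + ennreal (2 * S\<^sup>2) * ?e' n"
      proof -
        have [measurable]: "cball (0::real^2) 1 \<in> sets borel" by simp
        define U where "U = fourier_L1 (?u n)"
        have [measurable]: "U \<in> borel_measurable borel" unfolding U_def by (rule borel_measurable_fourier_L1) measurable
        show ?thesis unfolding U_def[symmetric] by (subst nn_integral_add) (simp_all add: nn_integral_cmult)
      qed
      finally show ?thesis .
    qed
    have step2: "(\<integral>\<^sup>+x. ennreal ((norm (?u n x))\<^sup>2) \<partial>lborel) \<le> 2 * ?rhs + ennreal (2 * Q * real (card G)) * ?e n" for n
    proof -
      have "(\<integral>\<^sup>+x. ennreal ((norm (?u n x))\<^sup>2) \<partial>lborel) \<le> (\<integral>\<^sup>+u. 2 * ennreal ((norm (?k u))\<^sup>2) + ennreal (2 * Q) * (\<Sum>x\<in>G. ennreal ((norm (h n (u - x) - g (u - x)))\<^sup>2)) \<partial>lborel)"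
      proof (intro nn_integral_mono)
        fix u :: "real^2"
        let ?d = "\<Sum>x\<in>G. c x *\<^sub>R (h n (u - x) - g (u - x))"
        have "?u n u = ?k u + ?d" by (simp add: scaleR_diff_right sum_subtractf)
        then have "(norm (?u n u))\<^sup>2 \<le> 2 * (norm (?k u))\<^sup>2 + 2 * (norm ?d)\<^sup>2" by (simp only: norm_add_power2_le)
        also have "(norm ?d)\<^sup>2 \<le> Q * (\<Sum>x\<in>G. (norm (h n (u - x) - g (u - x)))\<^sup>2)"
          unfolding Q_def by (rule norm_sum_scaleR_power2_le)
        finally have "ennreal ((norm (?u n u))\<^sup>2) \<le> ennreal (2 * (norm (?k u))\<^sup>2 + 2 * Q * (\<Sum>x\<in>G. (norm (h n (u - x) - g (u - x)))\<^sup>2))"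
          by (intro ennreal_leI) simp
        also have "\<dots> = 2 * ennreal ((norm (?k u))\<^sup>2) + ennreal (2 * Q) * (\<Sum>x\<in>G. ennreal ((norm (h n (u - x) - g (u - x)))\<^sup>2))"
          using SQ by (simp add: ennreal_mult sum_nonneg sum_ennreal)
        finally show "ennreal ((norm (?u n u))\<^sup>2) \<le> 2 * ennreal ((norm (?k u))\<^sup>2) + ennreal (2 * Q) * (\<Sum>x\<in>G. ennreal ((norm (h n (u - x) - g (u - x)))\<^sup>2))" .
      qed
      also have "\<dots> = 2 * ?rhs + ennreal (2 * Q) * (\<Sum>x\<in>G. \<integral>\<^sup>+u. ennreal ((norm (h n (u - x) - g (u - x)))\<^sup>2) \<partial>lborel)"
        by (subst nn_integral_add) (simp_all add: nn_integral_cmult nn_integral_sum del: sum_ennreal)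
      also have "(\<Sum>x\<in>G. \<integral>\<^sup>+u. ennreal ((norm (h n (u - x) - g (u - x)))\<^sup>2) \<partial>lborel) = (\<Sum>x\<in>G. ?e n)"
        by (intro sum.cong refl nn_integral_lborel_shift[of "\<lambda>u. ennreal ((norm (h n u - g u))\<^sup>2)"]) measurable
      also have "ennreal (2 * Q) * (\<Sum>x\<in>G. ?e n) = ennreal (2 * Q * real (card G)) * ?e n"
        using SQ by (simp add: ennreal_mult ennreal_of_nat_eq_real_of_nat mult.assoc)
      finally show ?thesis .
    qed
    have "?lhs \<le> ennreal (4 * C) * ?rhs + (ennreal (2 * C * (2 * Q * real (card G))) * ?e n + ennreal (2 * S\<^sup>2) * ?e' n)" for n
    proof -
      have "?lhs \<le> 2 * (ennreal C * (2 * ?rhs + ennreal (2 * Q * real (card G)) * ?e n)) + ennreal (2 * S\<^sup>2) * ?e' n"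
        using bessel[OF ui[of n]] step2[of n] step1[of n]
        by (meson add_mono mult_left_mono order_refl order_trans zero_le)
      also have "\<dots> = ennreal (4 * C) * ?rhs + (ennreal (2 * C * (2 * Q * real (card G))) * ?e n + ennreal (2 * S\<^sup>2) * ?e' n)"
        using C SQ by (simp add: distrib_left ennreal_mult mult_ac add_ac)
      finally show ?thesis .
    qed
    moreover have "(\<lambda>n. ennreal (4 * C) * ?rhs + (ennreal (2 * C * (2 * Q * real (card G))) * ?e n + ennreal (2 * S\<^sup>2) * ?e' n)) \<longlonglongrightarrow> ennreal (4 * C) * ?rhs + (ennreal (2 * C * (2 * Q * real (card G))) * 0 + ennreal (2 * S\<^sup>2) * 0)"
      by (intro tendsto_add tendsto_const ennreal_tendsto_cmult e e') auto
    ultimately have "?lhs \<le> ennreal (4 * C) * ?rhs + (ennreal (2 * C * (2 * Q * real (card G))) * 0 + ennreal (2 * S\<^sup>2) * 0)"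
      by (intro LIMSEQ_le_const) auto
    then show "?lhs \<le> ennreal (4 * C) * ?rhs" by simp
  qed
qed

text \<open>Nonnegativity of the variance of \<open>P\<close> over \<open>B\<close>, with
  \<open>?a\<close> its mean.\<close>

lemma power2_integral_le:
  fixes P :: "'a::euclidean_space \<Rightarrow> real"
  assumes B: "B \<in> sets borel" "emeasure lborel B < \<infinity>" "measure lborel B > 0"
    and P: "P \<in> borel_measurable borel" "\<And>s. \<bar>P s\<bar> \<le> S"
  shows "(LINT s:B|lborel. P s)\<^sup>2 \<le> measure lborel B * (LINT s:B|lborel. (P s)\<^sup>2)"
proof -
  note [measurable] = B(1) P(1)
  let ?m = "measure lborel B" and ?a = "(LINT s:B|lborel. P s) / measure lborel B"
  have bi: "set_integrable lborel B g" if [measurable]: "g \<in> borel_measurable borel" and "\<And>s. \<bar>g s\<bar> \<le> K" for g :: "'a \<Rightarrow> real" and K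
    unfolding set_integrable_def
    by (rule integrableI_bounded_set_indicator[where B = K]) (use that B in auto)
  have P2: "\<bar>(P s)\<^sup>2\<bar> \<le> S\<^sup>2" for s using power_mono[OF P(2), of s 2] by simp
  have i: "set_integrable lborel B P" "set_integrable lborel B (\<lambda>s. (P s)\<^sup>2)" "set_integrable lborel B (\<lambda>_. ?a\<^sup>2)"
    using bi[OF _ P(2)] bi[OF _ P2] bi[of "\<lambda>_. ?a\<^sup>2" "?a\<^sup>2"] by auto
  have "0 \<le> (LINT s:B|lborel. (P s - ?a)\<^sup>2)"
    unfolding set_lebesgue_integral_def by (intro integral_nonneg_AE) (auto simp: indicator_def)
  also have "\<dots> = (LINT s:B|lborel. (P s)\<^sup>2 - (2 * ?a) * P s + ?a\<^sup>2)"
    by (simp add: power2_diff algebra_simps)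
  also have "\<dots> = (LINT s:B|lborel. (P s)\<^sup>2) - (2 * ?a) * (LINT s:B|lborel. P s) + ?a\<^sup>2 * ?m"
    using i B by (simp add: set_integral_add set_integral_diff set_integral_mult_right set_integral_const mult.commute)
  finally have "0 \<le> (LINT s:B|lborel. (P s)\<^sup>2) - (2 * ?a) * (LINT s:B|lborel. P s) + ?a\<^sup>2 * ?m" .
  then show ?thesis using B(3) by (simp add: field_simps power2_eq_square)
qed

section \<open>A function of small reproducing norm\<close>

text \<open>The test function \<open>h\<close> is the Fourier transform of the normalised indicator of a box of side
  of order \<open>1/R\<close> around the origin, where \<open>\<rho>\<close> is bounded below.\<close>

lemma reproducing_norm_bound:
  assumes ft: "is_fourier_transform (\<lambda>x. complex_of_real (q x)) \<rho>" and even: "\<And>x. q (- x) = q x"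
    and V: "open V" "0 \<in> V" "\<delta> > 0" "AE s in lborel. s \<in> V \<longrightarrow> \<delta> \<le> cmod (\<rho> s)"
  obtains K R0 :: real where "K > 0" "R0 > 0"
    "\<And>R x0. R \<ge> R0 \<Longrightarrow> \<exists>h. (\<forall>x. dist x0 x \<le> R \<longrightarrow> h x \<ge> 1) \<and>
        (\<forall>G c. finite G \<longrightarrow> (\<Sum>x\<in>G. c x * h x)\<^sup>2 \<le> K * R\<^sup>2 * (LINT u|lborel. (\<Sum>x\<in>G. c x * q (x - u))\<^sup>2))"
proof -
  obtain C where C: "C > 0" and trans: "\<And>g \<rho> G c. is_fourier_transform g \<rho> \<Longrightarrow> finite G \<Longrightarrow>
       (\<integral>\<^sup>+s. ennreal ((norm ((\<Sum>x\<in>G. c x *\<^sub>R cis (2 * pi * (x \<bullet> s))) * \<rho> s))\<^sup>2) * indicator (cball 0 1) s \<partial>lborel)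
       \<le> ennreal C * (\<integral>\<^sup>+u. ennreal ((norm (\<Sum>x\<in>G. c x *\<^sub>R g (u - x)))\<^sup>2) \<partial>lborel)"
    using transform_local_bound by blast
  obtain e where e: "e > 0" "ball 0 e \<subseteq> V" using V(1,2) openE by blast
  \<comment> \<open>R >= 1 places the box \<open>B\<close> below inside the unit ball, where the
    Bessel inequality holds, and R >= 1 / e places it inside \<open>V\<close>, where
    \<open>\<rho>\<close> is bounded below.\<close>
  define R0 where "R0 = max 1 (1 / e)"
  have R0: "R0 > 0" "R0 \<ge> 1" "R0 \<ge> 1 / e" by (auto simp: R0_def)
  have q: "square_integrable (\<lambda>x. complex_of_real (q x))"
    using ft by (simp add: is_fourier_transform_def)
  have [measurable]: "q \<in> borel_measurable borel"
  proof -
    have "(\<lambda>x. Re (complex_of_real (q x))) \<in> borel_measurable borel"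
      using q unfolding square_integrable_def by (intro measurable_compose[OF _ borel_measurable_Re]) auto
    then show ?thesis by simp
  qed
  have [measurable]: "\<rho> \<in> borel_measurable borel"
    using ft by (simp add: is_fourier_transform_def square_integrable_def)
  show thesis
  proof (rule that[of "144 * C / \<delta>\<^sup>2" R0])
    show "144 * C / \<delta>\<^sup>2 > 0" "R0 > 0" using C V(3) R0 by auto
    fix R :: real and x0 :: "real^2"
    assume R: "R \<ge> R0"
    then have R1: "R \<ge> 1" "R > 0" using R0 by auto
    \<comment> \<open>For x within R of x0 and s in the box, the phase 2 pi (x - x0) . s is at most
      2 pi R (2 r) = pi / 3, so its cosine is at least 1 / 2.\<close>
    define r where "r = 1 / (12 * R)"
    have r: "r > 0" using R1 by (simp add: r_def)
    define B :: "(real^2) set" where "B = cbox (\<chi> i. - r) (\<chi> i. r)"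
    have B_iff: "s \<in> B \<longleftrightarrow> (\<forall>i. \<bar>s $ i\<bar> \<le> r)" for s
      unfolding B_def mem_box_cart by (auto simp: abs_le_iff) (smt (verit))+
    have B_norm: "norm s \<le> 2 * r" if "s \<in> B" for s
    proof -
      have "(\<Sum>i\<in>UNIV. \<bar>s $ i\<bar>) \<le> (\<Sum>i\<in>(UNIV::2 set). r)"
        using that by (intro sum_mono) (simp add: B_iff)
      then show ?thesis using norm_le_l1_cart[of s] by (simp add: UNIV_2)
    qed
    have Bm[measurable]: "B \<in> sets borel" by (simp add: B_def)
    have Be: "emeasure lborel B = ennreal ((2 * r)\<^sup>2)"
    proof -
      have "emeasure lborel B = ennreal (\<Prod>b\<in>Basis. ((\<chi> i. r) - (\<chi> i. - r)) \<bullet> (b :: real^2))"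
        unfolding B_def using r by (intro emeasure_lborel_cbox) (auto simp: Basis_vec_def inner_axis)
      also have "(\<Prod>b\<in>Basis. ((\<chi> i. r) - (\<chi> i. - r)) \<bullet> (b :: real^2)) = (\<Prod>b\<in>(Basis :: (real^2) set). 2 * r)"
        by (intro prod.cong) (auto simp: Basis_vec_def inner_axis)
      finally show ?thesis by simp
    qed
    let ?m = "measure lborel B"
    have m: "?m = (2 * r)\<^sup>2" "?m > 0" using Be r by (simp_all add: measure_def)
    have Bfin: "emeasure lborel B < \<infinity>" using Be by simp
    have Bball: "s \<in> cball 0 1" "s \<in> V" if "s \<in> B" for s
    proof -
      have "norm s \<le> 2 * r" by (rule B_norm[OF that])
      also have "2 * r \<le> 1 / 6" using R1 by (simp add: r_def field_simps)
      finally show "s \<in> cball 0 1" by simp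
      have "2 * r < e"
      proof -
        have "1 / R \<le> 1 / R0" using R R0(1) by (intro divide_left_mono) auto
        also have "1 / R0 \<le> e" using R0(1,3) e(1) by (simp add: field_simps)
        finally have "1 / R \<le> e" .
        moreover have "2 * r < 1 / R" using R1 by (simp add: r_def field_simps)
        ultimately show ?thesis by linarith
      qed
      then show "s \<in> V" using B_norm[OF that] e(2) by auto
    qed
    have bi: "set_integrable lborel B g" if [measurable]: "g \<in> borel_measurable borel" and "\<And>s. \<bar>g s\<bar> \<le> K" for g :: "real^2 \<Rightarrow> real" and K
      unfolding set_integrable_def
      by (rule integrableI_bounded_set_indicator[where B = K]) (use that Bfin in auto)
    \<comment> \<open>Twice the mean over \<open>B\<close> of waves centred at \<open>x0\<close>:
      the factor 2 compensates the lower bound 1 / 2 for the cosine, and cosines keep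
      \<open>h\<close> real.\<close>
    define h where "h x = (2 / ?m) * (LINT s:B|lborel. cos (2 * pi * ((x - x0) \<bullet> s)))" for x
    have "h x \<ge> 1" if x: "dist x0 x \<le> R" for x
    proof -
      have "1 / 2 * ?m = (LINT s:B|lborel. 1 / 2)"
        using Bfin by (simp add: set_integral_const)
      also have "\<dots> \<le> (LINT s:B|lborel. cos (2 * pi * ((x - x0) \<bullet> s)))"
      proof (intro set_integral_mono)
        fix s assume s: "s \<in> B"
        have "\<bar>(x - x0) \<bullet> s\<bar> \<le> norm (x - x0) * norm s" by (rule Cauchy_Schwarz_ineq2)
        also have "\<dots> \<le> R * (2 * r)"
          using x B_norm[OF s] R1 by (intro mult_mono) (auto simp: dist_norm norm_minus_commute)
        also have "\<dots> = 1 / 6" using R1 by (simp add: r_def)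
        finally have "\<bar>2 * pi * ((x - x0) \<bullet> s)\<bar> \<le> pi / 3" by (simp add: abs_mult)
        then have "cos (pi / 3) \<le> cos \<bar>2 * pi * ((x - x0) \<bullet> s)\<bar>"
          by (intro cos_monotone_0_pi_le) auto
        then show "1 / 2 \<le> cos (2 * pi * ((x - x0) \<bullet> s))" by (simp only: cos_abs_real cos_60)
      qed (auto intro!: bi[of _ 1])
      finally show ?thesis using m(2) by (simp add: h_def field_simps)
    qed
    moreover have "(\<Sum>x\<in>G. c x * h x)\<^sup>2 \<le> 144 * C / \<delta>\<^sup>2 * R\<^sup>2 * (LINT u|lborel. (\<Sum>x\<in>G. c x * q (x - u))\<^sup>2)" if G: "finite G" for G c
    proof -
      define P where "P s = (\<Sum>x\<in>G. c x * cos (2 * pi * ((x - x0) \<bullet> s)))" for s :: "real^2"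
      let ?T = "\<lambda>s. \<Sum>x\<in>G. c x *\<^sub>R cis (2 * pi * (x \<bullet> s))"
      let ?k = "\<lambda>u. \<Sum>x\<in>G. c x * q (x - u)"
      have [measurable]: "P \<in> borel_measurable borel" unfolding P_def[abs_def] by measurable
      have Pb: "\<bar>P s\<bar> \<le> (\<Sum>x\<in>G. \<bar>c x\<bar>)" for s
        unfolding P_def by (intro order_trans[OF sum_abs] sum_mono) (auto simp: abs_mult intro!: mult_left_le)
      \<comment> \<open>Centring at \<open>x0\<close> multiplies \<open>?T\<close> by a number of
        modulus 1, and \<open>P\<close> is the real part of the product.\<close>
      have PT: "(P s)\<^sup>2 \<le> (norm (?T s))\<^sup>2" for s
      proof -
        have "P s = Re (cis (- (2 * pi * (x0 \<bullet> s))) * ?T s)"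
          by (simp add: P_def sum_distrib_left cis_mult inner_diff_left algebra_simps)
        then have "\<bar>P s\<bar> \<le> norm (cis (- (2 * pi * (x0 \<bullet> s))) * ?T s)" by (simp only: abs_Re_le_cmod)
        then have "\<bar>P s\<bar> \<le> norm (?T s)" by (simp add: norm_mult)
        then have "\<bar>P s\<bar>\<^sup>2 \<le> (norm (?T s))\<^sup>2" by (intro power_mono) auto
        then show ?thesis by simp
      qed
      have ci: "set_integrable lborel B (\<lambda>s. c x * cos (2 * pi * ((x - x0) \<bullet> s)))" for x
        by (rule bi[of _ "\<bar>c x\<bar>"]) (auto simp: abs_mult intro!: mult_left_le)
      have "(\<Sum>x\<in>G. c x * h x) = (2 / ?m) * (\<Sum>x\<in>G. LINT s:B|lborel. c x * cos (2 * pi * ((x - x0) \<bullet> s)))"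
        by (simp add: h_def sum_distrib_left mult_ac)
      also have "(\<Sum>x\<in>G. LINT s:B|lborel. c x * cos (2 * pi * ((x - x0) \<bullet> s))) = (LINT s:B|lborel. P s)"
        unfolding P_def set_lebesgue_integral_def scaleR_sum_right
        by (rule Bochner_Integration.integral_sum[symmetric])
           (use ci in \<open>simp add: set_integrable_def\<close>)
      finally have "(\<Sum>x\<in>G. c x * h x)\<^sup>2 = (2 / ?m)\<^sup>2 * (LINT s:B|lborel. P s)\<^sup>2"
        by (simp only: power_mult_distrib)
      also have "\<dots> \<le> (2 / ?m)\<^sup>2 * (?m * (LINT s:B|lborel. (P s)\<^sup>2))"
        using m(2) Bfin by (intro mult_left_mono power2_integral_le[OF Bm _ _ _ Pb]) auto
      also have "\<dots> = 4 / ?m * (LINT s:B|lborel. (P s)\<^sup>2)"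
        using m(2) by (simp add: field_simps power2_eq_square)
      \<comment> \<open>The box has area (2 r)^2 = 1 / (36 R^2). Its inverse is the source of the
        factor R^2 in the squared norm.\<close>
      also have "4 / ?m = 144 * R\<^sup>2"
        unfolding m r_def using R1 by (simp add: field_simps power2_eq_square)
      finally have s1: "(\<Sum>x\<in>G. c x * h x)\<^sup>2 \<le> 144 * R\<^sup>2 * (LINT s:B|lborel. (P s)\<^sup>2)" .
      have P2b: "\<bar>(P s)\<^sup>2\<bar> \<le> (\<Sum>x\<in>G. \<bar>c x\<bar>)\<^sup>2" for s
        using power_mono[OF Pb, of s 2] by simp
      have Pint: "set_integrable lborel B (\<lambda>s. (P s)\<^sup>2)" by (rule bi[OF _ P2b]) measurable
      have kint: "integrable lborel (\<lambda>u. (?k u)\<^sup>2)"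
      proof -
        have "integrable lborel (\<lambda>u. (q u)\<^sup>2)" using q by (simp add: square_integrable_def)
        then have i: "integrable lborel (\<lambda>u. (q (x - u))\<^sup>2)" for x
          using integrable_lborel_shift(1)[of "\<lambda>u. (q u)\<^sup>2" x] even[of "_ - x"] by simp
        show ?thesis
        proof (rule Bochner_Integration.integrable_bound)
          show "integrable lborel (\<lambda>u. (\<Sum>x\<in>G. (c x)\<^sup>2) * (\<Sum>x\<in>G. (q (x - u))\<^sup>2))"
            using i by (intro integrable_mult_right Bochner_Integration.integrable_sum)
          show "AE u in lborel. norm ((?k u)\<^sup>2) \<le> norm ((\<Sum>x\<in>G. (c x)\<^sup>2) * (\<Sum>x\<in>G. (q (x - u))\<^sup>2))"
            using Cauchy_Schwarz_ineq_sum[of c "\<lambda>x. q (x - _)" G] by (auto simp: abs_of_nonneg sum_nonneg mult_nonneg_nonneg)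
        qed measurable
      qed
      have "ennreal (\<delta>\<^sup>2 * (LINT s:B|lborel. (P s)\<^sup>2)) = ennreal (\<delta>\<^sup>2) * (\<integral>\<^sup>+s. ennreal (indicator B s *\<^sub>R (P s)\<^sup>2) \<partial>lborel)"
        unfolding set_lebesgue_integral_def
        using Pint by (subst nn_integral_eq_integral) (auto simp: set_integrable_def ennreal_mult indicator_def integral_nonneg_AE)
      also have "\<dots> = (\<integral>\<^sup>+s. ennreal (\<delta>\<^sup>2) * ennreal (indicator B s *\<^sub>R (P s)\<^sup>2) \<partial>lborel)"
        by (rule nn_integral_cmult[symmetric]) measurable
      also have "\<dots> \<le> (\<integral>\<^sup>+s. ennreal ((norm (?T s * \<rho> s))\<^sup>2) * indicator (cball 0 1) s \<partial>lborel)"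
      proof (intro nn_integral_mono_AE)
        show "AE s in lborel. ennreal (\<delta>\<^sup>2) * ennreal (indicator B s *\<^sub>R (P s)\<^sup>2) \<le> ennreal ((norm (?T s * \<rho> s))\<^sup>2) * indicator (cball 0 1) s"
          using V(4)
        proof eventually_elim
          fix s assume s: "s \<in> V \<longrightarrow> \<delta> \<le> cmod (\<rho> s)"
          show "ennreal (\<delta>\<^sup>2) * ennreal (indicator B s *\<^sub>R (P s)\<^sup>2) \<le> ennreal ((norm (?T s * \<rho> s))\<^sup>2) * indicator (cball 0 1) s"
          proof (cases "s \<in> B")
            case True
            then have "\<delta>\<^sup>2 \<le> (cmod (\<rho> s))\<^sup>2" using s Bball(2) V(3) by (intro power_mono) auto
            then have "\<delta>\<^sup>2 * (P s)\<^sup>2 \<le> (cmod (\<rho> s))\<^sup>2 * (norm (?T s))\<^sup>2" using PT by (intro mult_mono) auto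
            then have "\<delta>\<^sup>2 * (P s)\<^sup>2 \<le> (norm (?T s * \<rho> s))\<^sup>2" by (simp only: norm_mult power_mult_distrib mult.commute)
            then show ?thesis using True Bball(1)[OF True] by (simp add: ennreal_mult[symmetric] ennreal_leI)
          qed simp
        qed
      qed
      also have "\<dots> \<le> ennreal C * (\<integral>\<^sup>+u. ennreal ((norm (\<Sum>x\<in>G. c x *\<^sub>R complex_of_real (q (u - x))))\<^sup>2) \<partial>lborel)"
        by (rule trans[OF ft G])
      also have "(\<lambda>u. ennreal ((norm (\<Sum>x\<in>G. c x *\<^sub>R complex_of_real (q (u - x))))\<^sup>2)) = (\<lambda>u. ennreal ((?k u)\<^sup>2))"
      proof (rule ext)
        fix u
        have "q (u - x) = q (x - u)" for x using even[of "x - u"] by simp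
        then have "(\<Sum>x\<in>G. c x *\<^sub>R complex_of_real (q (u - x))) = complex_of_real (?k u)"
          by (simp add: scaleR_conv_of_real)
        then show "ennreal ((norm (\<Sum>x\<in>G. c x *\<^sub>R complex_of_real (q (u - x))))\<^sup>2) = ennreal ((?k u)\<^sup>2)"
          by (simp only: norm_of_real power2_abs)
      qed
      also have "(\<integral>\<^sup>+u. ennreal ((?k u)\<^sup>2) \<partial>lborel) = ennreal (LINT u|lborel. (?k u)\<^sup>2)"
        using kint by (intro nn_integral_eq_integral) auto
      also have "ennreal C * ennreal (LINT u|lborel. (?k u)\<^sup>2) = ennreal (C * (LINT u|lborel. (?k u)\<^sup>2))"
        using C by (simp add: ennreal_mult integral_nonneg_AE)
      finally have "\<delta>\<^sup>2 * (LINT s:B|lborel. (P s)\<^sup>2) \<le> C * (LINT u|lborel. (?k u)\<^sup>2)"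
        using C by (subst (asm) ennreal_le_iff) (auto intro!: mult_nonneg_nonneg integral_nonneg_AE)
      then have "(LINT s:B|lborel. (P s)\<^sup>2) \<le> C / \<delta>\<^sup>2 * (LINT u|lborel. (?k u)\<^sup>2)"
        using V(3) by (simp add: field_simps)
      then have "144 * R\<^sup>2 * (LINT s:B|lborel. (P s)\<^sup>2) \<le> 144 * R\<^sup>2 * (C / \<delta>\<^sup>2 * (LINT u|lborel. (?k u)\<^sup>2))"
        by (intro mult_left_mono) auto
      with s1 show ?thesis by (simp add: mult_ac)
    qed
    ultimately show "\<exists>h. (\<forall>x. dist x0 x \<le> R \<longrightarrow> h x \<ge> 1) \<and>
        (\<forall>G c. finite G \<longrightarrow> (\<Sum>x\<in>G. c x * h x)\<^sup>2 \<le> 144 * C / \<delta>\<^sup>2 * R\<^sup>2 * (LINT u|lborel. (\<Sum>x\<in>G. c x * q (x - u))\<^sup>2))"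
      by blast
  qed
qed

section \<open>Truncation of the kernel\<close>

text \<open>Dyadic shells: on 2^k a <= |x| < 2^(k + 1) a the integrand is at most its value at the
  inner radius, and the shell lies in a ball of the outer radius. The contributions are a^(2 - 2
  \<beta>) \<theta>^k up to a constant, and \<theta> < 1 because \<beta> > 1.\<close>

lemma nn_integral_powr_tail:
  assumes \<beta>: "\<beta> > 1"
  obtains K :: real where "K > 0"
    "\<And>a. a > 0 \<Longrightarrow> (\<integral>\<^sup>+x. ennreal (norm (x::real^2) powr (- 2 * \<beta>)) * indicator {x. a \<le> norm x} x \<partial>lborel) \<le> ennreal (K * a powr (2 - 2 * \<beta>))"
proof -
  define U where "U = unit_ball_vol (real DIM(real^2))"
  have U: "U > 0" by (simp add: U_def)
  define \<theta> where "\<theta> = 2 powr (2 - 2 * \<beta>)"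
  have \<theta>: "0 < \<theta>" "\<theta> < 1" using \<beta> by (auto simp: \<theta>_def powr_less_one)
  show thesis
  proof (rule that[of "4 * U / (1 - \<theta>)"])
    show "4 * U / (1 - \<theta>) > 0" using U \<theta> by simp
    fix a :: real assume a: "a > 0"
    define b where "b k = (2 ^ k * a) powr (- 2 * \<beta>)" for k :: nat
    let ?B = "\<lambda>k. ball (0::real^2) (2 ^ Suc k * a)"
    have term_eq: "b k * (U * (2 ^ Suc k * a) ^ 2) = 4 * U * a powr (2 - 2 * \<beta>) * \<theta> ^ k" for k
    proof -
      have "b k * (2 ^ k * a)\<^sup>2 = (2 ^ k * a) powr (- 2 * \<beta>) * (2 ^ k * a) powr 2"
        using a by (simp add: b_def powr_numeral)
      also have "\<dots> = (2 ^ k * a) powr (2 - 2 * \<beta>)" by (simp add: powr_add[symmetric])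
      also have "\<dots> = (2 ^ k) powr (2 - 2 * \<beta>) * a powr (2 - 2 * \<beta>)" using a by (simp add: powr_mult)
      also have "(2 ^ k) powr (2 - 2 * \<beta>) = \<theta> ^ k"
        by (simp add: \<theta>_def powr_powr powr_realpow[symmetric] mult.commute)
      finally have "b k * (2 ^ k * a)\<^sup>2 = \<theta> ^ k * a powr (2 - 2 * \<beta>)" .
      then have "4 * U * (b k * (2 ^ k * a)\<^sup>2) = 4 * U * (\<theta> ^ k * a powr (2 - 2 * \<beta>))" by simp
      then show ?thesis by (simp add: power_mult_distrib mult_ac)
    qed
    have "(\<integral>\<^sup>+x. ennreal (norm (x::real^2) powr (- 2 * \<beta>)) * indicator {x. a \<le> norm x} x \<partial>lborel)
      \<le> (\<integral>\<^sup>+x. (\<Sum>k. ennreal (b k) * indicator (?B k) x) \<partial>lborel)"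
    proof (intro nn_integral_mono)
      fix x :: "real^2"
      show "ennreal (norm x powr (- 2 * \<beta>)) * indicator {x. a \<le> norm x} x \<le> (\<Sum>k. ennreal (b k) * indicator (?B k) x)"
      proof (cases "a \<le> norm x")
        case True
        obtain n where "norm x / a < 2 ^ n" using real_arch_pow[of 2 "norm x / a"] by auto
        then have ex: "norm x < 2 ^ n * a" using a by (simp add: field_simps)
        define m where "m = (LEAST n. norm x < 2 ^ n * a)"
        have m: "norm x < 2 ^ m * a" unfolding m_def using ex by (rule LeastI)
        have "m \<noteq> 0" using m True by (intro notI) simp
        then obtain k where k: "m = Suc k" using not0_implies_Suc by blast
        have lo: "2 ^ k * a \<le> norm x"
          using not_less_Least[of k "\<lambda>n. norm x < 2 ^ n * a"] k unfolding m_def[symmetric] by simp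
        have "norm x powr (- 2 * \<beta>) \<le> b k"
          unfolding b_def using lo a \<beta> by (intro powr_mono2') auto
        then have "ennreal (norm x powr (- 2 * \<beta>)) * indicator {x. a \<le> norm x} x \<le> ennreal (b k) * indicator (?B k) x"
          using True m k by (simp add: ennreal_leI)
        also have "\<dots> = (\<Sum>j\<in>{k}. ennreal (b j) * indicator (?B j) x)" by (subst sum.insert) auto
        also have "\<dots> \<le> (\<Sum>j. ennreal (b j) * indicator (?B j) x)" by (intro sum_le_suminf) auto
        finally show ?thesis .
      qed simp
    qed
    also have "\<dots> = (\<Sum>k. \<integral>\<^sup>+x. ennreal (b k) * indicator (?B k) x \<partial>lborel)"
      by (rule nn_integral_suminf) (auto intro!: borel_measurable_times_ennreal borel_measurable_indicator)
    also have "\<dots> = (\<Sum>k. ennreal (4 * U * a powr (2 - 2 * \<beta>) * \<theta> ^ k))"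
    proof (intro suminf_cong)
      fix k
      have "(\<integral>\<^sup>+x. ennreal (b k) * indicator (?B k) x \<partial>lborel) = ennreal (b k) * emeasure lborel (?B k)"
        by (rule nn_integral_cmult_indicator) simp
      also have "emeasure lborel (?B k) = ennreal (U * (2 ^ Suc k * a) ^ 2)"
        using a by (subst emeasure_ball) (auto simp: U_def)
      also have "ennreal (b k) * \<dots> = ennreal (b k * (U * (2 ^ Suc k * a) ^ 2))"
        using U by (intro ennreal_mult[symmetric]) (auto simp: b_def)
      finally show "(\<integral>\<^sup>+x. ennreal (b k) * indicator (?B k) x \<partial>lborel) = ennreal (4 * U * a powr (2 - 2 * \<beta>) * \<theta> ^ k)"
        unfolding term_eq .
    qed
    also have "\<dots> = ennreal (\<Sum>k. 4 * U * a powr (2 - 2 * \<beta>) * \<theta> ^ k)"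
      using U \<theta> by (intro suminf_ennreal2 summable_mult summable_geometric) auto
    also have "(\<Sum>k. 4 * U * a powr (2 - 2 * \<beta>) * \<theta> ^ k) = 4 * U / (1 - \<theta>) * a powr (2 - 2 * \<beta>)"
      using \<theta> by (simp add: suminf_mult suminf_geometric)
    finally show "(\<integral>\<^sup>+x. ennreal (norm (x::real^2) powr (- 2 * \<beta>)) * indicator {x. a \<le> norm x} x \<partial>lborel) \<le> ennreal (4 * U / (1 - \<theta>) * a powr (2 - 2 * \<beta>))" .
  qed
qed

text \<open>The decay hypothesis covers |x| > 1, whereas the truncation at scale r >= 1 is examined
  from |x| = r / 8 on, hence from 1 / 8 on. The gap up to radius 1 is filled by the bound contained
  in \<open>regular_kernel\<close>, which is a constant there. The Lipschitz form is the mean value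
  inequality along a segment that avoids the ball of radius \<open>a\<close>.\<close>

lemma kernel_decay:
  assumes kernel: "regular_kernel q" and beta: "\<beta> > 1"
    and decay: "\<exists>c>0. \<forall>a b. a + b \<le> 1 \<longrightarrow>
        (\<forall>x. norm x > 1 \<longrightarrow> \<bar>multi_deriv (a, b) q x\<bar> < c * norm x powr (- \<beta>))"
  obtains C :: real where "C > 0" "\<And>x. norm x \<ge> 1 / 8 \<Longrightarrow> \<bar>q x\<bar> \<le> C * norm x powr (- \<beta>)"
    "\<And>x y a. a \<ge> 1 / 8 \<Longrightarrow> (\<And>z. z \<in> closed_segment x y \<Longrightarrow> a \<le> norm z) \<Longrightarrow> \<bar>q x - q y\<bar> \<le> C * a powr (- \<beta>) * norm (x - y)"
proof -
  obtain c where c: "c > 0" "\<And>a b x. a + b \<le> 1 \<Longrightarrow> norm x > 1 \<Longrightarrow> \<bar>multi_deriv (a, b) q x\<bar> < c * norm x powr (- \<beta>)"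
    using decay by blast
  obtain \<epsilon> c' where c': "\<epsilon> > 0" "c' > 0" "\<And>a b x. a + b \<le> 3 \<Longrightarrow> x \<noteq> 0 \<Longrightarrow> \<bar>multi_deriv (a, b) q x\<bar> \<le> c' * norm x powr (- (1 + \<epsilon>))"
    using kernel unfolding regular_kernel_def by blast
  have diff: "q differentiable (at x)" for x
  proof -
    have "Ck (Suc 2) q" using kernel by (simp add: regular_kernel_def numeral_3_eq_3 numeral_2_eq_2)
    then show ?thesis by (simp only: Ck.simps)
  qed
  \<comment> \<open>The second summand is the value of the regular-kernel bound at radius 1 / 8; on
    1 / 8 <= |x| <= 1 it suffices because |x|^(- \<beta>) >= 1.\<close>
  define K where "K = c + c' * 8 powr (1 + \<epsilon>)"
  have K: "K > 0" using c(1) c'(2) by (simp add: K_def add_pos_nonneg)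
  have bnd: "\<bar>multi_deriv (a, b) q x\<bar> \<le> K * norm x powr (- \<beta>)" if ab: "a + b \<le> 1" and x: "norm x \<ge> 1 / 8" for a b x
  proof (cases "norm x > 1")
    case True
    have "\<bar>multi_deriv (a, b) q x\<bar> \<le> c * norm x powr (- \<beta>)" using c(2)[OF ab True] by simp
    also have "\<dots> \<le> K * norm x powr (- \<beta>)" using c'(2) by (intro mult_right_mono) (auto simp: K_def)
    finally show ?thesis .
  next
    case False
    then have n: "norm x \<le> 1" "norm x > 0" "x \<noteq> 0" using x by auto
    have "\<bar>multi_deriv (a, b) q x\<bar> \<le> c' * norm x powr (- (1 + \<epsilon>))" using c'(3)[of a b x] ab n by simp
    also have "norm x powr (- (1 + \<epsilon>)) \<le> (1 / 8) powr (- (1 + \<epsilon>))"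
      using x c'(1) by (intro powr_mono2') auto
    also have "(1 / 8 :: real) powr (- (1 + \<epsilon>)) = 8 powr (1 + \<epsilon>)"
      using inverse_powr[of 8 "- (1 + \<epsilon>)"] powr_minus[of 8 "1 + \<epsilon>"] by (simp add: inverse_eq_divide)
    also have "c' * 8 powr (1 + \<epsilon>) \<le> K" using c(1) by (simp add: K_def)
    also have "K \<le> K * norm x powr (- \<beta>)"
    proof -
      have "norm x powr \<beta> \<le> 1 powr \<beta>" using n beta by (intro powr_mono2) auto
      then have "1 \<le> norm x powr (- \<beta>)" using n by (simp add: powr_minus field_simps)
      then show ?thesis using K by simp
    qed
    finally show ?thesis using c'(2) by simp
  qed
  have pd: "\<bar>partial_deriv i q x\<bar> \<le> K * norm x powr (- \<beta>)" if "norm x \<ge> 1 / 8" for i :: 2 and x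
    using bnd[of 1 0 x] bnd[of 0 1 x] that exhaust_2[of i] by auto
  \<comment> \<open>Partial derivatives are defined through \<open>deriv\<close> along an axis;
    differentiability of \<open>q\<close> identifies them with values of the total derivative, which
    the decay bounds then control.\<close>
  have pdD: "partial_deriv i q x = D (axis i 1)" if D: "(q has_derivative D) (at x)" for i x D
  proof -
    have lin: "linear D" using D has_derivative_linear by blast
    have "((\<lambda>t. q (x + t *\<^sub>R axis i 1)) has_derivative (\<lambda>t. D (t *\<^sub>R axis i 1))) (at 0)"
      by (rule has_derivative_compose[of "\<lambda>t. x + t *\<^sub>R axis i 1" "\<lambda>t. t *\<^sub>R axis i 1" 0 UNIV q D, simplified])
         (auto intro!: derivative_eq_intros simp: D)
    then have "((\<lambda>t. q (x + t *\<^sub>R axis i 1)) has_field_derivative D (axis i 1)) (at 0)"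
      by (simp add: has_field_derivative_def linear_scale[OF lin] mult_commute_abs)
    then show ?thesis unfolding partial_deriv_def by (rule DERIV_imp_deriv)
  qed
  have Dbound: "\<bar>D v\<bar> \<le> 2 * K * norm x powr (- \<beta>) * norm v" if D: "(q has_derivative D) (at x)" and x: "norm x \<ge> 1 / 8" for D x v
  proof -
    have lin: "linear D" using D has_derivative_linear by blast
    have "v = v $ 1 *\<^sub>R axis 1 1 + v $ 2 *\<^sub>R axis 2 1"
      by (simp add: vec_eq_iff forall_2 axis_def)
    from arg_cong[where f = D, OF this]
    have "D v = v $ 1 * D (axis 1 1) + v $ 2 * D (axis 2 1)"
      by (simp only: linear_add[OF lin] linear_scale[OF lin] real_scaleR_def)
    then have "\<bar>D v\<bar> \<le> \<bar>v $ 1\<bar> * \<bar>D (axis 1 1)\<bar> + \<bar>v $ 2\<bar> * \<bar>D (axis 2 1)\<bar>"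
      by (simp only: abs_mult[symmetric] abs_triangle_ineq)
    also have "\<dots> \<le> norm v * (K * norm x powr (- \<beta>)) + norm v * (K * norm x powr (- \<beta>))"
      using pd[OF x, of 1] pd[OF x, of 2] unfolding pdD[OF D]
      by (intro add_mono mult_mono component_le_norm_cart) auto
    finally show ?thesis by (simp add: algebra_simps)
  qed
  show thesis
  proof (rule that[of "2 * K"])
    show "2 * K > 0" using K by simp
    show "\<bar>q x\<bar> \<le> 2 * K * norm x powr (- \<beta>)" if "norm x \<ge> 1 / 8" for x
    proof -
      have "\<bar>q x\<bar> \<le> K * norm x powr (- \<beta>)" using bnd[of 0 0 x] that by simp
      also have "\<dots> \<le> 2 * K * norm x powr (- \<beta>)" using K by (intro mult_right_mono) auto
      finally show ?thesis .
    qed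
    fix x y :: "real^2" and a :: real
    assume a: "a \<ge> 1 / 8" "\<And>z. z \<in> closed_segment x y \<Longrightarrow> a \<le> norm z"
    obtain D where D: "\<And>z. (q has_derivative D z) (at z)" using choice[of "\<lambda>z D. (q has_derivative D) (at z)"] diff unfolding differentiable_def by blast
    have "norm (q x - q y) \<le> (2 * K * a powr (- \<beta>)) * norm (x - y)"
    proof (rule differentiable_bound[of "closed_segment x y"])
      fix z assume z: "z \<in> closed_segment x y"
      show "(q has_derivative D z) (at z within closed_segment x y)" using D by (rule has_derivative_at_withinI)
      show "onorm (D z) \<le> 2 * K * a powr (- \<beta>)"
      proof (rule onorm_bound)
        show "0 \<le> 2 * K * a powr (- \<beta>)" using K by simp
        fix v
        have "\<bar>D z v\<bar> \<le> 2 * K * norm z powr (- \<beta>) * norm v"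
          using a a(2)[OF z] by (intro Dbound[OF D]) auto
        also have "\<dots> \<le> 2 * K * a powr (- \<beta>) * norm v"
          using K a(1) a(2)[OF z] beta by (intro mult_right_mono mult_left_mono powr_mono2') auto
        finally show "norm (D z v) \<le> 2 * K * a powr (- \<beta>) * norm v" by simp
      qed
    qed auto
    then show "\<bar>q x - q y\<bar> \<le> 2 * K * a powr (- \<beta>) * norm (x - y)" by simp
  qed
qed

text \<open>Piecewise linear in |x|: 1 up to r / 4, 0 from r / 2 on, slope 4 / r between. Lipschitz
  continuity is enough for first-order increments, and the radius r / 2 makes translates at distance
  r have disjoint supports up to boundary points.\<close>

definition cutoff :: "real \<Rightarrow> real^2 \<Rightarrow> real" where
  "cutoff r x = min 1 (max 0 (2 - 4 * norm x / r))"

lemma cutoff_bounds: "0 \<le> cutoff r x" "cutoff r x \<le> 1"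
  by (auto simp: cutoff_def)

lemma cutoff_eq_1: "r > 0 \<Longrightarrow> norm x \<le> r / 4 \<Longrightarrow> cutoff r x = 1"
  by (simp add: cutoff_def field_simps min_def max_def)

lemma cutoff_eq_0: "r > 0 \<Longrightarrow> norm x \<ge> r / 2 \<Longrightarrow> cutoff r x = 0"
  by (simp add: cutoff_def field_simps min_def max_def)

lemma cutoff_Lipschitz:
  assumes "r > 0"
  shows "\<bar>cutoff r x - cutoff r y\<bar> \<le> 4 / r * norm (x - y)"
proof -
  have "\<bar>cutoff r x - cutoff r y\<bar> \<le> \<bar>4 * norm x / r - 4 * norm y / r\<bar>"
    unfolding cutoff_def by (auto simp: min_def max_def abs_if)
  also have "4 * norm x / r - 4 * norm y / r = 4 / r * (norm x - norm y)"
    by (simp add: right_diff_distrib diff_divide_distrib)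
  also have "\<bar>4 / r * (norm x - norm y)\<bar> = 4 / r * \<bar>norm x - norm y\<bar>"
    using assms by (simp only: abs_mult) simp
  also have "\<dots> \<le> 4 / r * norm (x - y)"
    using assms norm_triangle_ineq3[of x y] by (intro mult_left_mono) auto
  finally show ?thesis .
qed

lemma borel_measurable_cutoff[measurable]: "cutoff r \<in> borel_measurable borel"
  unfolding cutoff_def[abs_def] by measurable

text \<open>In the plane the L2 norm of |x|^(- \<beta>) outside a ball of radius proportional to r
  is of order r^(1 - \<beta>), and this governs both bounds. For small shifts \<open>v\<close> the
  increment of the remainder obeys the same decay with the factor |v|; for large \<open>v\<close>
  the Lipschitz bound follows from the bound on the remainder itself.\<close>

lemma truncation_error_bounds:
  assumes kernel: "regular_kernel q" and beta: "\<beta> > 1"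
    and decay: "\<exists>c>0. \<forall>a b. a + b \<le> 1 \<longrightarrow>
        (\<forall>x. norm x > 1 \<longrightarrow> \<bar>multi_deriv (a, b) q x\<bar> < c * norm x powr (- \<beta>))"
  obtains K :: real where "K > 0"
    "\<And>r. r \<ge> 1 \<Longrightarrow> (\<integral>\<^sup>+x. ennreal ((q x * (1 - cutoff r x))\<^sup>2) \<partial>lborel) \<le> ennreal ((K * r powr (1 - \<beta>))\<^sup>2)"
    "\<And>r v. r \<ge> 1 \<Longrightarrow> (\<integral>\<^sup>+x. ennreal ((q (x + v) * (1 - cutoff r (x + v)) - q x * (1 - cutoff r x))\<^sup>2) \<partial>lborel) \<le> ennreal ((K * r powr (1 - \<beta>) * norm v)\<^sup>2)"
proof -
  have [measurable]: "q \<in> borel_measurable borel"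
    using kernel by (simp add: regular_kernel_def square_integrable_def)
  obtain C where C: "C > 0" and Cq: "\<And>x. norm x \<ge> 1 / 8 \<Longrightarrow> \<bar>q x\<bar> \<le> C * norm x powr (- \<beta>)"
    and Cd: "\<And>x y a. a \<ge> 1 / 8 \<Longrightarrow> (\<And>z. z \<in> closed_segment x y \<Longrightarrow> a \<le> norm z) \<Longrightarrow> \<bar>q x - q y\<bar> \<le> C * a powr (- \<beta>) * norm (x - y)"
    using kernel_decay[OF assms] by blast
  obtain T where T: "T > 0" and tail: "\<And>a. a > 0 \<Longrightarrow> (\<integral>\<^sup>+x. ennreal (norm (x::real^2) powr (- 2 * \<beta>)) * indicator {x. a \<le> norm x} x \<partial>lborel) \<le> ennreal (T * a powr (2 - 2 * \<beta>))"
    using nn_integral_powr_tail[OF beta] by blast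
  \<comment> \<open>The power of 2 / 3 comes from the mean value estimate on a segment outside
    radius (2 / 3) |x|, the 4 from the slope 4 / r <= 4 of the cutoff.\<close>
  define C1 where "C1 = C * ((2 / 3) powr (- \<beta>) + 4)"
  have C1: "C1 > 0" "C \<le> C1" using C by (auto simp: C1_def intro!: mult_pos_pos add_nonneg_pos)
  define A where "A = C1\<^sup>2 * (T * (1 / 8) powr (2 - 2 * \<beta>))"
  have A: "A > 0" using C1 T by (simp add: A_def)
  let ?p = "\<lambda>r x. q x * (1 - cutoff r x)"
  have sq: "(norm x powr (- \<beta>))\<^sup>2 = norm x powr (- 2 * \<beta>)" for x :: "real^2"
    by (simp add: power2_eq_square powr_add[symmetric])
  \<comment> \<open>Common tail estimate, used with m = 1 for the remainder and with m = |v| for its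
    increments.\<close>
  have gen: "(\<integral>\<^sup>+x. ennreal ((g x)\<^sup>2) \<partial>lborel) \<le> ennreal (A * m\<^sup>2 * (r powr (1 - \<beta>))\<^sup>2)"
    if r: "r \<ge> 1" and m: "m \<ge> 0" and out: "\<And>x. norm x < r / 8 \<Longrightarrow> g x = 0"
      and g: "\<And>x. norm x \<ge> r / 8 \<Longrightarrow> \<bar>g x\<bar> \<le> C1 * m * norm x powr (- \<beta>)" for r m and g :: "real^2 \<Rightarrow> real"
  proof -
    have "(\<integral>\<^sup>+x. ennreal ((g x)\<^sup>2) \<partial>lborel) \<le> (\<integral>\<^sup>+x. ennreal (C1\<^sup>2 * m\<^sup>2) * (ennreal (norm (x::real^2) powr (- 2 * \<beta>)) * indicator {x. r / 8 \<le> norm x} x) \<partial>lborel)"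
    proof (intro nn_integral_mono)
      fix x :: "real^2"
      show "ennreal ((g x)\<^sup>2) \<le> ennreal (C1\<^sup>2 * m\<^sup>2) * (ennreal (norm x powr (- 2 * \<beta>)) * indicator {x. r / 8 \<le> norm x} x)"
      proof (cases "r / 8 \<le> norm x")
        case True
        have "\<bar>g x\<bar>\<^sup>2 \<le> (C1 * m * norm x powr (- \<beta>))\<^sup>2" using g[OF True] by (intro power_mono) auto
        then have "(g x)\<^sup>2 \<le> C1\<^sup>2 * m\<^sup>2 * norm x powr (- 2 * \<beta>)" by (simp only: power2_abs power_mult_distrib sq)
        then show ?thesis using True by (simp add: ennreal_mult[symmetric] ennreal_leI)
      qed (simp add: out)
    qed
    also have "\<dots> = ennreal (C1\<^sup>2 * m\<^sup>2) * (\<integral>\<^sup>+x. ennreal (norm (x::real^2) powr (- 2 * \<beta>)) * indicator {x. r / 8 \<le> norm x} x \<partial>lborel)"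
      by (rule nn_integral_cmult) measurable
    also have "\<dots> \<le> ennreal (C1\<^sup>2 * m\<^sup>2) * ennreal (T * (r / 8) powr (2 - 2 * \<beta>))"
      using r by (intro mult_left_mono tail) auto
    also have "\<dots> = ennreal (C1\<^sup>2 * m\<^sup>2 * (T * (r / 8) powr (2 - 2 * \<beta>)))"
      using T by (intro ennreal_mult[symmetric]) auto
    also have "(r / 8) powr (2 - 2 * \<beta>) = (1 / 8) powr (2 - 2 * \<beta>) * (r powr (1 - \<beta>))\<^sup>2"
    proof -
      have "(r powr (1 - \<beta>))\<^sup>2 = r powr (2 - 2 * \<beta>)" using r by (simp add: power2_eq_square powr_add[symmetric])
      moreover have "(1 / 8 * r) powr (2 - 2 * \<beta>) = (1 / 8) powr (2 - 2 * \<beta>) * r powr (2 - 2 * \<beta>)" by (rule powr_mult)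
      ultimately show ?thesis by simp
    qed
    finally show ?thesis by (simp add: A_def mult_ac)
  qed
  have main: "(\<integral>\<^sup>+x. ennreal ((?p r x)\<^sup>2) \<partial>lborel) \<le> ennreal (A * (r powr (1 - \<beta>))\<^sup>2)" if r: "r \<ge> 1" for r
  proof -
    have "(\<integral>\<^sup>+x. ennreal ((?p r x)\<^sup>2) \<partial>lborel) \<le> ennreal (A * 1\<^sup>2 * (r powr (1 - \<beta>))\<^sup>2)"
    proof (rule gen[OF r])
      show "?p r x = 0" if "norm x < r / 8" for x using cutoff_eq_1[of r x] that r by simp
      fix x :: "real^2" assume x: "norm x \<ge> r / 8"
      have "\<bar>?p r x\<bar> \<le> \<bar>q x\<bar>" using cutoff_bounds[of r x] by (simp add: abs_mult mult_left_le)
      also have "\<dots> \<le> C * norm x powr (- \<beta>)" using x r by (intro Cq) auto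
      also have "\<dots> \<le> C1 * 1 * norm x powr (- \<beta>)" using C1 by (simp add: mult_right_mono)
      finally show "\<bar>?p r x\<bar> \<le> C1 * 1 * norm x powr (- \<beta>)" .
    qed simp
    then show ?thesis by simp
  qed
  have incr: "(\<integral>\<^sup>+x. ennreal ((?p r (x + v) - ?p r x)\<^sup>2) \<partial>lborel) \<le> ennreal (1024 * A * (norm v)\<^sup>2 * (r powr (1 - \<beta>))\<^sup>2)" if r: "r \<ge> 1" for r v
  \<comment> \<open>If |v| <= r / 16, a point with |x| < 3 r / 16 stays within r / 4, where the
    remainder vanishes; from 3 r / 16 on, |v| <= |x| / 3, so the whole segment stays outside radius
    (2 / 3) |x| >= r / 8.\<close>
  proof (cases "norm v \<le> r / 16")
    case True
    have "(\<integral>\<^sup>+x. ennreal ((?p r (x + v) - ?p r x)\<^sup>2) \<partial>lborel) \<le> ennreal (A * (norm v)\<^sup>2 * (r powr (1 - \<beta>))\<^sup>2)"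
    proof (rule gen[OF r])
      show "?p r (x + v) - ?p r x = 0" if x: "norm x < r / 8" for x
      proof -
        have "norm (x + v) \<le> r / 4" using norm_triangle_ineq[of x v] x True r by linarith
        then show ?thesis using cutoff_eq_1[of r x] cutoff_eq_1[of r "x + v"] x r by simp
      qed
      fix x :: "real^2" assume x: "norm x \<ge> r / 8"
      show "\<bar>?p r (x + v) - ?p r x\<bar> \<le> C1 * norm v * norm x powr (- \<beta>)"
      proof (cases "norm x \<ge> 3 * r / 16")
        case False
        then have "norm (x + v) \<le> r / 4" "norm x \<le> r / 4" using norm_triangle_ineq[of x v] True r by linarith+
        then show ?thesis using cutoff_eq_1[of r x] cutoff_eq_1[of r "x + v"] r C1(1) by simp
      next
        case big: True
        have seg: "2 / 3 * norm x \<le> norm z" if "z \<in> closed_segment (x + v) x" for z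
        proof -
          have "norm (z - x) \<le> norm v"
            using that segment_bound[of z "x + v" x] by simp
          then show ?thesis using norm_triangle_ineq2[of x z] big True by (simp add: norm_minus_commute)
        qed
        have "\<bar>q (x + v) - q x\<bar> \<le> C * (2 / 3 * norm x) powr (- \<beta>) * norm (x + v - x)"
          using seg big r by (intro Cd) auto
        also have "(2 / 3 * norm x) powr (- \<beta>) = (2 / 3) powr (- \<beta>) * norm x powr (- \<beta>)"
          by (rule powr_mult)
        finally have d1: "\<bar>q (x + v) - q x\<bar> \<le> C * (2 / 3) powr (- \<beta>) * norm v * norm x powr (- \<beta>)" by (simp add: mult_ac)
        have "\<bar>cutoff r x - cutoff r (x + v)\<bar> \<le> 4 / r * norm v" using cutoff_Lipschitz[of r x "x + v"] r by simp
        also have "\<dots> \<le> 4 * norm v" using r by (intro mult_right_mono) (auto simp: field_simps)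
        finally have d2: "\<bar>cutoff r x - cutoff r (x + v)\<bar> \<le> 4 * norm v" .
        have "?p r (x + v) - ?p r x = (q (x + v) - q x) * (1 - cutoff r (x + v)) + q x * (cutoff r x - cutoff r (x + v))"
          by (simp add: algebra_simps)
        then have "\<bar>?p r (x + v) - ?p r x\<bar> \<le> \<bar>q (x + v) - q x\<bar> * \<bar>1 - cutoff r (x + v)\<bar> + \<bar>q x\<bar> * \<bar>cutoff r x - cutoff r (x + v)\<bar>"
          by (simp only: abs_mult[symmetric] abs_triangle_ineq)
        also have "\<dots> \<le> \<bar>q (x + v) - q x\<bar> + (C * norm x powr (- \<beta>)) * (4 * norm v)"
        proof (intro add_mono mult_mono d2)
          show "\<bar>q (x + v) - q x\<bar> * \<bar>1 - cutoff r (x + v)\<bar> \<le> \<bar>q (x + v) - q x\<bar>"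
            using cutoff_bounds[of r "x + v"] by (intro mult_left_le) auto
          show "\<bar>q x\<bar> \<le> C * norm x powr (- \<beta>)" using x r by (intro Cq) auto
        qed (use C in auto)
        also have "\<dots> \<le> C1 * norm v * norm x powr (- \<beta>)"
          using d1 by (simp add: C1_def algebra_simps)
        finally show ?thesis .
      qed
    qed simp
    also have "\<dots> \<le> ennreal (1024 * A * (norm v)\<^sup>2 * (r powr (1 - \<beta>))\<^sup>2)"
      using A by (intro ennreal_leI mult_right_mono) auto
    finally show ?thesis .
  next
    case False
    then have v: "1 / 16 < norm v" using r by simp
    have "(\<integral>\<^sup>+x. ennreal ((?p r (x + v) - ?p r x)\<^sup>2) \<partial>lborel) \<le> (\<integral>\<^sup>+x. 2 * ennreal ((?p r (x - (- v)))\<^sup>2) + 2 * ennreal ((?p r x)\<^sup>2) \<partial>lborel)"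
    proof (intro nn_integral_mono)
      fix x
      have "(?p r (x + v) - ?p r x)\<^sup>2 \<le> 2 * (?p r (x + v))\<^sup>2 + 2 * (?p r x)\<^sup>2"
        using norm_add_power2_le[of "?p r (x + v)" "- ?p r x"] by simp
      then have "ennreal ((?p r (x + v) - ?p r x)\<^sup>2) \<le> ennreal (2 * (?p r (x + v))\<^sup>2 + 2 * (?p r x)\<^sup>2)" by (rule ennreal_leI)
      also have "\<dots> = 2 * ennreal ((?p r (x - (- v)))\<^sup>2) + 2 * ennreal ((?p r x)\<^sup>2)" by (simp add: ennreal_mult)
      finally show "ennreal ((?p r (x + v) - ?p r x)\<^sup>2) \<le> 2 * ennreal ((?p r (x - (- v)))\<^sup>2) + 2 * ennreal ((?p r x)\<^sup>2)" .
    qed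
    also have "\<dots> = 2 * (\<integral>\<^sup>+x. ennreal ((?p r (x - (- v)))\<^sup>2) \<partial>lborel) + 2 * (\<integral>\<^sup>+x. ennreal ((?p r x)\<^sup>2) \<partial>lborel)"
      by (subst nn_integral_add) (simp_all add: nn_integral_cmult)
    also have "(\<integral>\<^sup>+x. ennreal ((?p r (x - (- v)))\<^sup>2) \<partial>lborel) = (\<integral>\<^sup>+x. ennreal ((?p r x)\<^sup>2) \<partial>lborel)"
      by (rule nn_integral_lborel_shift[of "\<lambda>x. ennreal ((?p r x)\<^sup>2)"]) measurable
    also have "2 * (\<integral>\<^sup>+x. ennreal ((?p r x)\<^sup>2) \<partial>lborel) + 2 * (\<integral>\<^sup>+x. ennreal ((?p r x)\<^sup>2) \<partial>lborel) \<le> 2 * ennreal (A * (r powr (1 - \<beta>))\<^sup>2) + 2 * ennreal (A * (r powr (1 - \<beta>))\<^sup>2)"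
      by (intro add_mono mult_left_mono main r) auto
    also have "\<dots> = ennreal (4 * (A * (r powr (1 - \<beta>))\<^sup>2))"
      using A by (simp add: ennreal_mult flip: distrib_right)
    also have "\<dots> \<le> ennreal (1024 * A * (norm v)\<^sup>2 * (r powr (1 - \<beta>))\<^sup>2)"
    proof (rule ennreal_leI)
      \<comment> \<open>The constant 1024 is 4 * 16^2: here |v| > 1 / 16, as r >= 1.\<close>
      have "(1 / 16)\<^sup>2 \<le> (norm v)\<^sup>2" using v by (intro power_mono) auto
      then have "4 * A \<le> 1024 * A * (norm v)\<^sup>2" using A by (simp add: power2_eq_square field_simps)
      then have "4 * A * (r powr (1 - \<beta>))\<^sup>2 \<le> 1024 * A * (norm v)\<^sup>2 * (r powr (1 - \<beta>))\<^sup>2" by (rule mult_right_mono) simp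
      then show "4 * (A * (r powr (1 - \<beta>))\<^sup>2) \<le> 1024 * A * (norm v)\<^sup>2 * (r powr (1 - \<beta>))\<^sup>2" by simp
    qed
    finally show ?thesis .
  qed
  show thesis
  proof (rule that[of "sqrt (1024 * A)"])
    show "sqrt (1024 * A) > 0" using A by simp
    fix r :: real assume r: "r \<ge> 1"
    have "ennreal (A * (r powr (1 - \<beta>))\<^sup>2) \<le> ennreal ((sqrt (1024 * A) * r powr (1 - \<beta>))\<^sup>2)"
      using A by (intro ennreal_leI) (simp add: power_mult_distrib)
    then show "(\<integral>\<^sup>+x. ennreal ((?p r x)\<^sup>2) \<partial>lborel) \<le> ennreal ((sqrt (1024 * A) * r powr (1 - \<beta>))\<^sup>2)"
      using main[OF r] by (rule order_trans[rotated])
    fix v :: "real^2"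
    have "1024 * A * (norm v)\<^sup>2 * (r powr (1 - \<beta>))\<^sup>2 = (sqrt (1024 * A) * r powr (1 - \<beta>) * norm v)\<^sup>2"
      using A by (simp add: power_mult_distrib mult_ac)
    then show "(\<integral>\<^sup>+x. ennreal ((?p r (x + v) - ?p r x)\<^sup>2) \<partial>lborel) \<le> ennreal ((sqrt (1024 * A) * r powr (1 - \<beta>) * norm v)\<^sup>2)"
      using incr[OF r, of v] by simp
  qed
qed

section \<open>The Gaussian space of the noise\<close>

lemma square_integrableD:
  fixes a :: "real^2 \<Rightarrow> real"
  assumes "square_integrable a"
  shows "a \<in> borel_measurable borel" "integrable lborel (\<lambda>x. (a x)\<^sup>2)"
  using assms by (auto simp: square_integrable_def)

lemma abs_mult_le_squares: "\<bar>u * v\<bar> \<le> u\<^sup>2 + v\<^sup>2" for u v :: real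
proof -
  have "2 * \<bar>u\<bar> * \<bar>v\<bar> \<le> u\<^sup>2 + v\<^sup>2" using sum_squares_bound[of "\<bar>u\<bar>" "\<bar>v\<bar>"] by simp
  moreover have "0 \<le> \<bar>u\<bar> * \<bar>v\<bar>" by simp
  ultimately show ?thesis unfolding abs_mult by linarith
qed

lemma square_integrable_product:
  fixes a b :: "real^2 \<Rightarrow> real"
  assumes "square_integrable a" "square_integrable b"
  shows "integrable lborel (\<lambda>x. a x * b x)"
proof (rule Bochner_Integration.integrable_bound)
  note [measurable] = square_integrableD(1)[OF assms(1)] square_integrableD(1)[OF assms(2)]
  show "integrable lborel (\<lambda>x. (a x)\<^sup>2 + (b x)\<^sup>2)"
    using assms by (intro Bochner_Integration.integrable_add square_integrableD)
  show "(\<lambda>x. a x * b x) \<in> borel_measurable lborel" by measurable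
  show "AE x in lborel. norm (a x * b x) \<le> norm ((a x)\<^sup>2 + (b x)\<^sup>2)" by (auto simp: abs_mult_le_squares)
qed

lemma square_integrable_add:
  fixes a b :: "real^2 \<Rightarrow> real"
  assumes "square_integrable a" "square_integrable b"
  shows "square_integrable (\<lambda>x. a x + b x)"
proof -
  note [measurable] = square_integrableD(1)[OF assms(1)] square_integrableD(1)[OF assms(2)]
  have "integrable lborel (\<lambda>x. (a x)\<^sup>2 + 2 * (a x * b x) + (b x)\<^sup>2)"
    using assms by (intro Bochner_Integration.integrable_add integrable_mult_right square_integrableD square_integrable_product)
  then show ?thesis by (simp add: square_integrable_def power2_sum algebra_simps)
qed

lemma square_integrable_scale:
  fixes a :: "real^2 \<Rightarrow> real"
  assumes "square_integrable a"
  shows "square_integrable (\<lambda>x. c * a x)"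
  using assms by (auto simp: square_integrable_def power_mult_distrib)

lemma (in prob_space) gaussian_rv_integrable:
  assumes "gaussian_rv M X"
  shows "integrable M X" "integrable M (\<lambda>\<omega>. (X \<omega>)\<^sup>2)"
proof -
  have [measurable]: "X \<in> borel_measurable M" using assms by (simp add: gaussian_rv_def)
  obtain \<mu> \<sigma> where "(\<sigma> = 0 \<and> (AE \<omega> in M. X \<omega> = \<mu>)) \<or>
      (\<sigma> > 0 \<and> distributed M lborel X (\<lambda>x. ennreal (normal_density \<mu> \<sigma> x)))"
    using assms by (auto simp: gaussian_rv_def)
  then have "integrable M X \<and> integrable M (\<lambda>\<omega>. (X \<omega>)\<^sup>2)"
  proof
    assume "\<sigma> = 0 \<and> (AE \<omega> in M. X \<omega> = \<mu>)"
    then have ae: "AE \<omega> in M. X \<omega> = \<mu>" by simp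
    have "integrable M X \<longleftrightarrow> integrable M (\<lambda>_. \<mu>)" "integrable M (\<lambda>\<omega>. (X \<omega>)\<^sup>2) \<longleftrightarrow> integrable M (\<lambda>_. \<mu>\<^sup>2)"
      by (rule integrable_cong_AE; use ae in auto)+
    then show ?thesis by simp
  next
    assume *: "\<sigma> > 0 \<and> distributed M lborel X (\<lambda>x. ennreal (normal_density \<mu> \<sigma> x))"
    then have s: "0 < \<sigma>" and d: "distributed M lborel X (\<lambda>x. ennreal (normal_density \<mu> \<sigma> x))" by auto
    note mom = integrable_normal_moment[OF s, of \<mu>]
    have m1: "integrable lborel (\<lambda>x. normal_density \<mu> \<sigma> x * x)" by (rule integrable_normal_moment_nz_1[OF s])
    have "integrable lborel (\<lambda>x. normal_density \<mu> \<sigma> x * (x - \<mu>)^2 + (2 * \<mu>) * (normal_density \<mu> \<sigma> x * x) - \<mu>\<^sup>2 * normal_density \<mu> \<sigma> x)"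
      using mom[of 2] m1 s by (intro Bochner_Integration.integrable_add Bochner_Integration.integrable_diff integrable_mult_right) auto
    also have "(\<lambda>x. normal_density \<mu> \<sigma> x * (x - \<mu>)^2 + (2 * \<mu>) * (normal_density \<mu> \<sigma> x * x) - \<mu>\<^sup>2 * normal_density \<mu> \<sigma> x) = (\<lambda>x. normal_density \<mu> \<sigma> x * x\<^sup>2)"
      by (auto simp: power2_eq_square algebra_simps)
    finally have m2: "integrable lborel (\<lambda>x. normal_density \<mu> \<sigma> x * x\<^sup>2)" .
    show ?thesis
      using distributed_integrable[OF d, of "\<lambda>x. x"] distributed_integrable[OF d, of "\<lambda>x. x\<^sup>2"] m1 m2 by simp
  qed
  then show "integrable M X" "integrable M (\<lambda>\<omega>. (X \<omega>)\<^sup>2)" by auto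
qed

lemma gaussian_rv_cong_AE:
  assumes Y: "gaussian_rv M Y" and X[measurable]: "X \<in> borel_measurable M" and ae: "AE \<omega> in M. X \<omega> = Y \<omega>"
  shows "gaussian_rv M X"
proof -
  have [measurable]: "Y \<in> borel_measurable M" using Y by (simp add: gaussian_rv_def)
  obtain \<mu> \<sigma> where ms: "(\<sigma> = 0 \<and> (AE \<omega> in M. Y \<omega> = \<mu>)) \<or>
      (\<sigma> > 0 \<and> distributed M lborel Y (\<lambda>x. ennreal (normal_density \<mu> \<sigma> x)))"
    using Y by (auto simp: gaussian_rv_def)
  have "distr M lborel X = distr M lborel Y" using ae by (intro distr_cong_AE) auto
  then have "distributed M lborel Y g \<Longrightarrow> distributed M lborel X g" for g
    by (simp add: distributed_def)
  moreover have "AE \<omega> in M. X \<omega> = \<mu>" if "AE \<omega> in M. Y \<omega> = \<mu>"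
    using ae that by eventually_elim auto
  ultimately show ?thesis using ms X unfolding gaussian_rv_def by blast
qed

text \<open>The noise is not assumed linear in its argument; linearity up to null sets follows from the
  covariance structure.\<close>

definition noise_space :: "'w measure \<Rightarrow> ((real^2 \<Rightarrow> real) \<Rightarrow> 'w \<Rightarrow> real) \<Rightarrow> ('w \<Rightarrow> real) set" where
  "noise_space M W = {X \<in> borel_measurable M. \<exists>\<phi>. square_integrable \<phi> \<and> (AE \<omega> in M. X \<omega> = W \<phi> \<omega>)}"

context
  fixes M :: "'w measure" and W
  assumes noise: "white_noise M W"
begin

interpretation prob_space M using noise by (simp add: white_noise_def)

lemma noise_gaussian: "square_integrable a \<Longrightarrow> gaussian_rv M (W a)"
  using noise[unfolded white_noise_def gaussian_process_def, THEN conjunct2, THEN conjunct1, rule_format, of "{a}" "\<lambda>_. 1"]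
  by simp

lemma noise_measurable: "square_integrable a \<Longrightarrow> W a \<in> borel_measurable M"
  using noise_gaussian by (simp add: gaussian_rv_def)

lemma noise_product:
  assumes a: "square_integrable a" and b: "square_integrable b"
  shows "integrable M (\<lambda>\<omega>. W a \<omega> * W b \<omega>)" "expectation (\<lambda>\<omega>. W a \<omega> * W b \<omega>) = (LINT u|lborel. a u * b u)"
proof -
  note [measurable] = noise_measurable[OF a] noise_measurable[OF b]
  show "integrable M (\<lambda>\<omega>. W a \<omega> * W b \<omega>)"
  proof (rule Bochner_Integration.integrable_bound)
    show "integrable M (\<lambda>\<omega>. (W a \<omega>)\<^sup>2 + (W b \<omega>)\<^sup>2)"
      using a b by (intro Bochner_Integration.integrable_add gaussian_rv_integrable(2) noise_gaussian)
    show "AE \<omega> in M. norm (W a \<omega> * W b \<omega>) \<le> norm ((W a \<omega>)\<^sup>2 + (W b \<omega>)\<^sup>2)" by (auto simp: abs_mult_le_squares)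
  qed measurable
  show "expectation (\<lambda>\<omega>. W a \<omega> * W b \<omega>) = (LINT u|lborel. a u * b u)"
    using noise a b by (simp add: white_noise_def)
qed

text \<open>By the isometry the second moment of the defect is the squared L2 norm of (c a + b) - c
  a - b, which is 0. It has to be expanded into covariances, since nothing else about sums is
  known.\<close>

lemma noise_linear:
  assumes a: "square_integrable a" and b: "square_integrable b"
  shows "AE \<omega> in M. W (\<lambda>u. c * a u + b u) \<omega> = c * W a \<omega> + W b \<omega>"
proof -
  let ?s = "\<lambda>u. c * a u + b u"
  have s: "square_integrable ?s" by (intro square_integrable_add square_integrable_scale a b)
  let ?d = "\<lambda>\<omega>. W ?s \<omega> - c * W a \<omega> - W b \<omega>"
  note [measurable] = noise_measurable[OF a] noise_measurable[OF b] noise_measurable[OF s]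
  have ex: "(?d \<omega>)\<^sup>2 = W ?s \<omega> * W ?s \<omega> + c * c * (W a \<omega> * W a \<omega>) + W b \<omega> * W b \<omega> - 2 * c * (W a \<omega> * W ?s \<omega>) - 2 * (W b \<omega> * W ?s \<omega>) + 2 * c * (W a \<omega> * W b \<omega>)" for \<omega>
    by (simp add: power2_eq_square algebra_simps)
  note i = noise_product(1)[OF s s] noise_product(1)[OF a a] noise_product(1)[OF b b] noise_product(1)[OF a s] noise_product(1)[OF b s] noise_product(1)[OF a b]
  note j = square_integrable_product[OF a a] square_integrable_product[OF b b] square_integrable_product[OF a b]
  have "expectation (\<lambda>\<omega>. (?d \<omega>)\<^sup>2) = (LINT u|lborel. ?s u * ?s u) + c * c * (LINT u|lborel. a u * a u) + (LINT u|lborel. b u * b u)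
      - 2 * c * (LINT u|lborel. a u * ?s u) - 2 * (LINT u|lborel. b u * ?s u) + 2 * c * (LINT u|lborel. a u * b u)"
    unfolding ex using i
    by (simp add: noise_product(2)[OF s s] noise_product(2)[OF a a] noise_product(2)[OF b b] noise_product(2)[OF a s] noise_product(2)[OF b s] noise_product(2)[OF a b])
  also have "(LINT u|lborel. ?s u * ?s u) = c * c * (LINT u|lborel. a u * a u) + 2 * c * (LINT u|lborel. a u * b u) + (LINT u|lborel. b u * b u)"
  proof -
    have e: "?s u * ?s u = c * c * (a u * a u) + 2 * c * (a u * b u) + b u * b u" for u by (simp add: algebra_simps)
    show ?thesis unfolding e using j by simp
  qed
  also have "(LINT u|lborel. a u * ?s u) = c * (LINT u|lborel. a u * a u) + (LINT u|lborel. a u * b u)"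
  proof -
    have e: "a u * ?s u = c * (a u * a u) + a u * b u" for u by (simp add: algebra_simps)
    show ?thesis unfolding e using j by simp
  qed
  also have "(LINT u|lborel. b u * ?s u) = c * (LINT u|lborel. a u * b u) + (LINT u|lborel. b u * b u)"
  proof -
    have e: "b u * ?s u = c * (a u * b u) + b u * b u" for u by (simp add: algebra_simps)
    show ?thesis unfolding e using j by simp
  qed
  finally have z: "expectation (\<lambda>\<omega>. (?d \<omega>)\<^sup>2) = 0" by (simp add: algebra_simps)
  have "integrable M (\<lambda>\<omega>. (?d \<omega>)\<^sup>2)" unfolding ex using i by simp
  from integral_nonneg_eq_0_iff_AE[OF this] z have "AE \<omega> in M. (?d \<omega>)\<^sup>2 = 0" by simp
  then show ?thesis by eventually_elim simp
qed

lemma noise_zero: "AE \<omega> in M. W (\<lambda>_. 0) \<omega> = 0"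
proof -
  have "square_integrable (\<lambda>_. 0 :: real)" by (simp add: square_integrable_def)
  from noise_linear[OF this this, of 1] show ?thesis by eventually_elim simp
qed

lemma noise_linear_combination:
  assumes X: "X \<in> borel_measurable M" "square_integrable \<phi>" "AE \<omega> in M. X \<omega> = W \<phi> \<omega>"
    and Y: "Y \<in> borel_measurable M" "square_integrable \<psi>" "AE \<omega> in M. Y \<omega> = W \<psi> \<omega>"
  shows "(\<lambda>\<omega>. c * X \<omega> + Y \<omega>) \<in> borel_measurable M" "square_integrable (\<lambda>u. c * \<phi> u + \<psi> u)"
    "AE \<omega> in M. c * X \<omega> + Y \<omega> = W (\<lambda>u. c * \<phi> u + \<psi> u) \<omega>"
proof -
  show "(\<lambda>\<omega>. c * X \<omega> + Y \<omega>) \<in> borel_measurable M" using X(1) Y(1) by measurable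
  show "square_integrable (\<lambda>u. c * \<phi> u + \<psi> u)" by (intro square_integrable_add square_integrable_scale X Y)
  show "AE \<omega> in M. c * X \<omega> + Y \<omega> = W (\<lambda>u. c * \<phi> u + \<psi> u) \<omega>"
    using X(3) Y(3) noise_linear[OF X(2) Y(2), of c] by eventually_elim simp
qed

lemma gaussian_space_noise: "gaussian_space M (noise_space M W)"
proof
  fix X assume "X \<in> noise_space M W"
  then obtain \<phi> where X: "X \<in> borel_measurable M" "square_integrable \<phi>" "AE \<omega> in M. X \<omega> = W \<phi> \<omega>"
    by (auto simp: noise_space_def)
  show "gaussian_rv M X" using gaussian_rv_cong_AE[OF noise_gaussian[OF X(2)] X(1,3)] .
  have "expectation X = expectation (W \<phi>)"
    using X noise_measurable by (intro integral_cong_AE) auto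
  also have "\<dots> = 0" using noise X(2) by (simp add: white_noise_def)
  finally show "expectation X = 0" .
  fix c
  show "(\<lambda>\<omega>. c * X \<omega>) \<in> noise_space M W"
  proof -
    have z: "square_integrable (\<lambda>_. 0 :: real)" by (simp add: square_integrable_def)
    have "AE \<omega> in M. 0 = W (\<lambda>_. 0) \<omega>" using noise_zero by eventually_elim simp
    have "(\<lambda>_. 0 :: real) \<in> borel_measurable M" by simp
    from noise_linear_combination[OF X this z \<open>AE \<omega> in M. 0 = W (\<lambda>_. 0) \<omega>\<close>, of c]
    show ?thesis unfolding noise_space_def add_0_right by blast
  qed
next
  have "AE \<omega> in M. 0 = W (\<lambda>_. 0) \<omega>" using noise_zero by eventually_elim simp
  then show "(\<lambda>_. 0) \<in> noise_space M W"
    unfolding noise_space_def by (auto intro!: exI[of _ "\<lambda>_. 0"] simp: square_integrable_def)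
next
  fix X Y assume "X \<in> noise_space M W" "Y \<in> noise_space M W"
  then obtain \<phi> \<psi> where "X \<in> borel_measurable M" "square_integrable \<phi>" "AE \<omega> in M. X \<omega> = W \<phi> \<omega>"
      "Y \<in> borel_measurable M" "square_integrable \<psi>" "AE \<omega> in M. Y \<omega> = W \<psi> \<omega>"
    by (auto simp: noise_space_def)
  from noise_linear_combination[OF this, of 1] show "(\<lambda>\<omega>. X \<omega> + Y \<omega>) \<in> noise_space M W"
    unfolding noise_space_def mult_1 by blast
qed

lemma noise_expectation_product:
  assumes X: "X \<in> borel_measurable M" "square_integrable \<phi>" "AE \<omega> in M. X \<omega> = W \<phi> \<omega>"
    and Y: "Y \<in> borel_measurable M" "square_integrable \<psi>" "AE \<omega> in M. Y \<omega> = W \<psi> \<omega>"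
  shows "expectation (\<lambda>\<omega>. X \<omega> * Y \<omega>) = (LINT u|lborel. \<phi> u * \<psi> u)"
proof -
  note [measurable] = X(1) Y(1) noise_measurable[OF X(2)] noise_measurable[OF Y(2)]
  have "expectation (\<lambda>\<omega>. X \<omega> * Y \<omega>) = expectation (\<lambda>\<omega>. W \<phi> \<omega> * W \<psi> \<omega>)"
  proof (rule integral_cong_AE)
    show "AE \<omega> in M. X \<omega> * Y \<omega> = W \<phi> \<omega> * W \<psi> \<omega>" using X(3) Y(3) by eventually_elim simp
  qed measurable
  then show ?thesis using noise_product(2)[OF X(2) Y(2)] by simp
qed

lemma noise_finite_sum:
  assumes "finite G" and "\<And>x. x \<in> G \<Longrightarrow> X x \<in> borel_measurable M \<and> square_integrable (\<phi> x) \<and> (AE \<omega> in M. X x \<omega> = W (\<phi> x) \<omega>)"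
  shows "(\<lambda>\<omega>. \<Sum>x\<in>G. c x * X x \<omega>) \<in> borel_measurable M \<and> square_integrable (\<lambda>u. \<Sum>x\<in>G. c x * \<phi> x u) \<and>
    (AE \<omega> in M. (\<Sum>x\<in>G. c x * X x \<omega>) = W (\<lambda>u. \<Sum>x\<in>G. c x * \<phi> x u) \<omega>)"
  using assms
proof (induction G)
  case empty
  have "AE \<omega> in M. 0 = W (\<lambda>_. 0) \<omega>" using noise_zero by eventually_elim simp
  then show ?case by (simp add: square_integrable_def)
next
  case (insert k G)
  have IH: "(\<lambda>\<omega>. \<Sum>x\<in>G. c x * X x \<omega>) \<in> borel_measurable M" "square_integrable (\<lambda>u. \<Sum>x\<in>G. c x * \<phi> x u)"
    "AE \<omega> in M. (\<Sum>x\<in>G. c x * X x \<omega>) = W (\<lambda>u. \<Sum>x\<in>G. c x * \<phi> x u) \<omega>"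
    using insert by auto
  have k: "X k \<in> borel_measurable M" "square_integrable (\<phi> k)" "AE \<omega> in M. X k \<omega> = W (\<phi> k) \<omega>"
    using insert by auto
  show ?case using noise_linear_combination[OF k IH, of "c k"] insert.hyps by simp
qed

end

section \<open>Discretisation of monotonic events\<close>

text \<open>A weighted mean of the values at net points closer than \<open>2 * d\<close>, with
  hat-shaped weights. Clipping the denominator at \<open>d\<close> keeps the interpolant continuous
  on the whole plane; near the net the clip is inactive and the weights sum to 1. Positive weights
  preserve order, so increasing events can be pulled back to vectors on \<open>G\<close>.\<close>

definition interp :: "real \<Rightarrow> (real^2) set \<Rightarrow> (real^2 \<Rightarrow> real) \<Rightarrow> real^2 \<Rightarrow> real" where
  "interp d G v x = (\<Sum>y\<in>G. max 0 (2 * d - dist x y) * v y) / max d (\<Sum>y\<in>G. max 0 (2 * d - dist x y))"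

lemma interp_C_plane:
  assumes "d > 0"
  shows "interp d G v \<in> C_plane"
proof -
  have "continuous_on UNIV (\<lambda>x. (\<Sum>y\<in>G. max 0 (2 * d - dist x y) * v y) / max d (\<Sum>y\<in>G. max 0 (2 * d - dist x y)))"
    using assms by (intro continuous_intros) (auto simp: max_def)
  then show ?thesis by (simp add: C_plane_def interp_def[abs_def])
qed

lemma interp_mono:
  assumes "d > 0" "\<And>y. y \<in> G \<Longrightarrow> v y \<le> w y"
  shows "interp d G v x \<le> interp d G w x"
  unfolding interp_def using assms
  by (intro divide_right_mono sum_mono mult_left_mono) auto

lemma interp_cong:
  assumes "\<And>y. y \<in> G \<Longrightarrow> v y = w y"
  shows "interp d G v = interp d G w"
  unfolding interp_def[abs_def] using assms by (intro ext arg_cong2[where f = "(/)"] sum.cong) auto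

text \<open>A net point within \<open>d\<close> has weight at least \<open>d\<close> on its own, so
  the clip is inactive at \<open>x\<close>.\<close>

lemma interp_denominator:
  assumes "finite G" "z \<in> G" "dist x z \<le> d"
  shows "d \<le> (\<Sum>y\<in>G. max 0 (2 * d - dist x y))"
proof -
  have "d \<le> max 0 (2 * d - dist x z)" using assms(3) by simp
  also have "\<dots> \<le> (\<Sum>y\<in>G. max 0 (2 * d - dist x y))"
    using assms by (intro member_le_sum) auto
  finally show ?thesis .
qed

lemma interp_add_const:
  assumes "finite G" "z \<in> G" "dist x z \<le> d" "d > 0"
  shows "interp d G (\<lambda>y. v y + s) x = interp d G v x + s"
proof -
  let ?S = "\<Sum>y\<in>G. max 0 (2 * d - dist x y)"
  have d: "d \<le> ?S" by (rule interp_denominator[OF assms(1-3)])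
  have "(\<Sum>y\<in>G. max 0 (2 * d - dist x y) * (v y + s)) = (\<Sum>y\<in>G. max 0 (2 * d - dist x y) * v y) + s * ?S"
    by (simp add: distrib_left sum.distrib sum_distrib_left mult.commute[of _ s])
  then have "interp d G (\<lambda>y. v y + s) x = ((\<Sum>y\<in>G. max 0 (2 * d - dist x y) * v y) + s * ?S) / ?S"
    using d unfolding interp_def by (simp add: max_absorb2)
  also have "\<dots> = interp d G v x + s"
    using d assms(4) unfolding interp_def by (simp add: max_absorb2 add_divide_distrib)
  finally show ?thesis .
qed

lemma interp_close:
  assumes G: "finite G" "z \<in> G" "dist x z \<le> d" "d > 0"
    and close: "\<And>y. y \<in> G \<Longrightarrow> dist x y < 2 * d \<Longrightarrow> \<bar>c - v y\<bar> \<le> e"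
  shows "\<bar>c - interp d G v x\<bar> \<le> e"
proof -
  let ?w = "\<lambda>y. max 0 (2 * d - dist x y)"
  let ?S = "\<Sum>y\<in>G. ?w y"
  have d: "d \<le> ?S" by (rule interp_denominator[OF G(1-3)])
  then have S: "?S > 0" using G(4) by linarith
  have "(c - interp d G v x) * ?S = c * ?S - (\<Sum>y\<in>G. ?w y * v y)"
    using d S unfolding interp_def by (simp add: max_absorb2 left_diff_distrib)
  also have "\<dots> = (\<Sum>y\<in>G. ?w y * (c - v y))"
    unfolding sum_distrib_left sum_subtractf[symmetric] by (intro sum.cong refl) (simp add: algebra_simps)
  finally have "(c - interp d G v x) * ?S = (\<Sum>y\<in>G. ?w y * (c - v y))" .
  then have "\<bar>(c - interp d G v x) * ?S\<bar> = \<bar>\<Sum>y\<in>G. ?w y * (c - v y)\<bar>" by (rule arg_cong)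
  then have "\<bar>c - interp d G v x\<bar> * ?S = \<bar>\<Sum>y\<in>G. ?w y * (c - v y)\<bar>"
    unfolding abs_mult abs_of_pos[OF S] .
  also have "\<dots> \<le> (\<Sum>y\<in>G. ?w y * e)"
  proof (intro order_trans[OF sum_abs] sum_mono)
    fix y assume y: "y \<in> G"
    show "\<bar>?w y * (c - v y)\<bar> \<le> ?w y * e"
    proof (cases "dist x y < 2 * d")
      case True
      have "?w y * \<bar>c - v y\<bar> \<le> ?w y * e" using close[OF y True] by (intro mult_left_mono) auto
      then show ?thesis by (simp add: abs_mult)
    qed simp
  qed
  also have "\<dots> = e * ?S" unfolding sum_distrib_right[symmetric] by (rule mult.commute)
  finally show ?thesis using S by simp
qed

text \<open>Induction over the generated sigma-algebra. The space \<open>N\<close> is arbitrary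
  because the lemma serves both the probability space, with random paths, and the space of vectors
  on a finite net, with interpolated paths.\<close>

lemma eval_events_vimage:
  assumes A: "A \<in> eval_events D" and F: "\<And>\<omega>. \<omega> \<in> space N \<Longrightarrow> F \<omega> \<in> C_plane"
    and m: "\<And>x. x \<in> D \<Longrightarrow> (\<lambda>\<omega>. F \<omega> x) \<in> borel_measurable N"
  shows "{\<omega> \<in> space N. F \<omega> \<in> A} \<in> sets N"
  using A unfolding eval_events_def
proof (induction rule: sigma_sets.induct)
  case (Basic a)
  then obtain x S where xS: "a = {u \<in> C_plane. u x \<in> S}" "x \<in> D" "S \<in> sets borel" by blast
  note [measurable] = m[OF xS(2)] xS(3)
  have "{\<omega> \<in> space N. F \<omega> \<in> a} = {\<omega> \<in> space N. F \<omega> x \<in> S}" using F xS(1) by auto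
  then show ?case by simp
next
  case Empty
  then show ?case by simp
next
  case (Compl a)
  have "{\<omega> \<in> space N. F \<omega> \<in> C_plane - a} = space N - {\<omega> \<in> space N. F \<omega> \<in> a}" using F by auto
  then show ?case using Compl by auto
next
  case (Union a)
  have "{\<omega> \<in> space N. F \<omega> \<in> (\<Union>i. a i)} = (\<Union>i. {\<omega> \<in> space N. F \<omega> \<in> a i})" by auto
  then show ?case using Union by auto
qed

lemma eval_events_determined:
  assumes A: "A \<in> eval_events D" and uv: "u \<in> C_plane" "v \<in> C_plane" "\<And>x. x \<in> D \<Longrightarrow> u x = v x"
  shows "u \<in> A \<longleftrightarrow> v \<in> A"
  using A unfolding eval_events_def
  by (induction rule: sigma_sets.induct) (use uv in auto)

text \<open>The pointwise maximum of \<open>u\<close> and \<open>v\<close> dominates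
  \<open>u\<close> everywhere and agrees with \<open>v\<close> on \<open>D\<close>, and membership
  in \<open>A\<close> depends on values on \<open>D\<close> alone.\<close>

lemma increasing_event_on:
  assumes A: "A \<in> eval_events D" "increasing_event A" and u: "u \<in> A" and v: "v \<in> C_plane"
    and le: "\<And>x. x \<in> D \<Longrightarrow> u x \<le> v x"
  shows "v \<in> A"
proof -
  let ?m = "\<lambda>x. max (u x) (v x)"
  have uC: "u \<in> C_plane" using A(2) u by (auto simp: increasing_event_def)
  have mC: "?m \<in> C_plane" using uC v by (auto simp: C_plane_def intro!: continuous_on_max)
  have "?m \<in> A" using A(2) u mC unfolding increasing_event_def by (meson max.cobounded1)
  moreover have "?m x = v x" if "x \<in> D" for x using le[OF that] by simp
  ultimately show ?thesis using eval_events_determined[OF A(1) mC v] by blast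
qed

lemma finite_net:
  fixes D :: "'a::heine_borel set"
  assumes "bounded D" and d: "d > 0"
  obtains G where "finite G" "G \<subseteq> D" "\<And>x. x \<in> D \<Longrightarrow> \<exists>z\<in>G. dist x z \<le> d"
proof -
  have cpt: "compact (closure D)" using assms by simp
  have cover: "closure D \<subseteq> (\<Union>z\<in>D. ball z d)"
    using d by (auto simp: closure_approachable)
  have op: "open (ball z d)" for z :: 'a by simp
  obtain G where G: "G \<subseteq> D" "finite G" "closure D \<subseteq> (\<Union>z\<in>G. ball z d)"
    using compactE_image[OF cpt op cover] by blast
  show thesis
  proof (rule that[OF G(2,1)])
    fix x assume "x \<in> D"
    then have "x \<in> (\<Union>z\<in>G. ball z d)" using G(3) closure_subset by blast
    then show "\<exists>z\<in>G. dist x z \<le> d" by (auto simp: dist_commute intro: less_imp_le)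
  qed
qed

section \<open>A monotonic event of the field compared with its discretised version for the
  truncated field\<close>

context gaussian_space
begin

text \<open>Paths are uniformly continuous on the compact closure of \<open>D\<close>, so the events
  shrink to the empty set along d = 1 / (n + 1) and their probabilities tend to 0. A countable dense
  subset of \<open>D\<close> makes them measurable.\<close>

lemma modulus_events:
  fixes f :: "real^2 \<Rightarrow> 'w \<Rightarrow> real"
  assumes f: "\<And>x. f x \<in> borel_measurable M" and cont: "\<And>\<omega>. \<omega> \<in> space M \<Longrightarrow> continuous_on UNIV (\<lambda>x. f x \<omega>)"
    and D: "bounded D" and e: "e > 0" and \<eta>: "\<eta> > 0"
  obtains d where "d > 0" "{\<omega> \<in> space M. \<exists>x\<in>D. \<exists>y\<in>D. dist x y < 2 * d \<and> \<bar>f x \<omega> - f y \<omega>\<bar> > e} \<in> events"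
    "prob {\<omega> \<in> space M. \<exists>x\<in>D. \<exists>y\<in>D. dist x y < 2 * d \<and> \<bar>f x \<omega> - f y \<omega>\<bar> > e} < \<eta>"
proof -
  note [measurable] = f
  obtain T where T: "countable T" "T \<subseteq> D" "D \<subseteq> closure T"
    using separable[of D] by blast
  define N where "N S d = {\<omega> \<in> space M. \<exists>x\<in>S. \<exists>y\<in>S. dist x y < 2 * d \<and> \<bar>f x \<omega> - f y \<omega>\<bar> > e}" for S d
  have NT: "N D d = N T d" for d
  proof
    show "N T d \<subseteq> N D d" using T(2) unfolding N_def by blast
    show "N D d \<subseteq> N T d"
    proof
      fix \<omega> assume "\<omega> \<in> N D d"
      then obtain x y where xy: "\<omega> \<in> space M" "x \<in> D" "y \<in> D" "dist x y < 2 * d" "\<bar>f x \<omega> - f y \<omega>\<bar> > e"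
        by (auto simp: N_def)
      have cf: "continuous_on UNIV (\<lambda>p::(real^2)\<times>(real^2). f (fst p) \<omega>)" "continuous_on UNIV (\<lambda>p::(real^2)\<times>(real^2). f (snd p) \<omega>)"
        by (auto intro!: continuous_on_compose2[OF cont[OF xy(1)]] continuous_intros)
      \<comment> \<open>Both strict inequalities are open conditions on the pair, so a violating
        pair in \<open>D\<close> can be moved into the dense subset.\<close>
      define Q where "Q = {p::(real^2)\<times>(real^2). dist (fst p) (snd p) < 2 * d} \<inter> {p. e < \<bar>f (fst p) \<omega> - f (snd p) \<omega>\<bar>}"
      have "open Q" unfolding Q_def
        by (intro open_Int open_Collect_less continuous_intros cf)
      moreover have "(x, y) \<in> Q" using xy by (simp add: Q_def)
      moreover have "(x, y) \<in> closure (T \<times> T)" using xy T(3) by (auto simp: closure_Times)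
      ultimately have "Q \<inter> (T \<times> T) \<noteq> {}" using open_Int_closure_eq_empty by blast
      then show "\<omega> \<in> N T d" using xy(1) by (auto simp: N_def Q_def)
    qed
  qed
  have Nev: "N T d \<in> events" for d
  proof -
    have "N T d = (\<Union>x\<in>T. \<Union>y\<in>T. if dist x y < 2 * d then {\<omega> \<in> space M. \<bar>f x \<omega> - f y \<omega>\<bar> > e} else {})"
      by (auto simp: N_def split: if_splits)
    then show ?thesis using T(1) by (auto intro!: sets.countable_UN')
  qed
  let ?d = "\<lambda>n. 1 / real (Suc n)"
  have "(\<lambda>n. prob (N T (?d n))) \<longlonglongrightarrow> prob (\<Inter>n. N T (?d n))"
  proof (rule finite_Lim_measure_decseq)
    show "range (\<lambda>n. N T (?d n)) \<subseteq> events" using Nev by auto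
    show "decseq (\<lambda>n. N T (?d n))"
    proof (rule decseq_SucI)
      fix n
      have "?d (Suc n) \<le> ?d n" by (simp add: field_simps)
      then have "dist x y < 2 * ?d n" if "dist x y < 2 * ?d (Suc n)" for x y :: "real^2" using that by linarith
      then show "N T (?d (Suc n)) \<subseteq> N T (?d n)" unfolding N_def by blast
    qed
  qed
  moreover have "(\<Inter>n. N T (?d n)) = {}"
  proof (rule ccontr)
    assume "(\<Inter>n. N T (?d n)) \<noteq> {}"
    then obtain \<omega> where w: "\<And>n. \<omega> \<in> N T (?d n)" by blast
    then have sp: "\<omega> \<in> space M" using w[of 0] by (auto simp: N_def)
    have "uniformly_continuous_on (closure D) (\<lambda>x. f x \<omega>)"
      using D by (intro compact_uniformly_continuous continuous_on_subset[OF cont[OF sp]]) auto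
    then obtain d where d: "d > 0" "\<And>x y. x \<in> closure D \<Longrightarrow> y \<in> closure D \<Longrightarrow> dist y x < d \<Longrightarrow> dist (f y \<omega>) (f x \<omega>) < e"
      using e unfolding uniformly_continuous_on_def by metis
    obtain n where "inverse (real (Suc n)) < d / 2" using reals_Archimedean[of "d / 2"] d(1) by auto
    then have n: "2 * ?d n < d" by (simp add: inverse_eq_divide)
    obtain x y where xy: "x \<in> T" "y \<in> T" "dist x y < 2 * ?d n" "\<bar>f x \<omega> - f y \<omega>\<bar> > e"
      using w[of n] by (auto simp: N_def)
    have "x \<in> closure D" "y \<in> closure D" using xy T(2) closure_subset by auto
    moreover have "dist x y < d" using xy(3) n by linarith
    ultimately have "dist (f x \<omega>) (f y \<omega>) < e" using d(2) by blast
    then show False using xy(4) by (simp add: dist_real_def)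
  qed
  ultimately have "(\<lambda>n. prob (N T (?d n))) \<longlonglongrightarrow> 0" by simp
  then have "eventually (\<lambda>n. prob (N T (?d n)) < \<eta>) sequentially" using \<eta> by (rule order_tendstoD)
  then obtain n where "prob (N T (?d n)) < \<eta>" using eventually_happens by force
  then show thesis
    using that[of "?d n"] Nev[of "?d n"] unfolding NT[symmetric] by (simp add: N_def)
qed

text \<open>The order of choices matters: \<open>e\<close> is the size of \<open>f - g\<close> given
  by chaining, \<open>d\<close> comes from the modulus of continuity of \<open>f\<close> at scale
  \<open>e\<close>, and \<open>G\<close> is a \<open>d\<close>-net of \<open>D\<close>. The chaining
  and shift bounds do not depend on the net, so refining it costs nothing. Only \<open>f\<close>
  needs a modulus; \<open>g\<close> is compared with it at net points and then interpolated.\<close>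

lemma increasing_event_approx:
  fixes f g :: "real^2 \<Rightarrow> 'w \<Rightarrow> real"
  assumes fH: "\<And>x. f x \<in> H" and gH: "\<And>x. g x \<in> H"
    and cont: "\<And>\<omega>. \<omega> \<in> space M \<Longrightarrow> continuous_on UNIV (\<lambda>x. f x \<omega>)"
    and s: "s > 0"
    and var: "\<And>x. cov (\<lambda>\<omega>. f x \<omega> - g x \<omega>) (\<lambda>\<omega>. f x \<omega> - g x \<omega>) \<le> s\<^sup>2"
    and lip: "\<And>x y. cov (\<lambda>\<omega>. (f x \<omega> - g x \<omega>) - (f y \<omega> - g y \<omega>)) (\<lambda>\<omega>. (f x \<omega> - g x \<omega>) - (f y \<omega> - g y \<omega>)) \<le> (s * dist x y)\<^sup>2"
    and x0: "x0 \<in> D" and h: "\<And>x. dist x0 x \<le> R \<Longrightarrow> h x \<ge> 1"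
    and bound: "\<And>G c. finite G \<Longrightarrow> (\<Sum>x\<in>G. c x * h x)\<^sup>2 \<le> K * cov (\<lambda>\<omega>. \<Sum>x\<in>G. c x * f x \<omega>) (\<lambda>\<omega>. \<Sum>x\<in>G. c x * f x \<omega>)"
    and D: "bounded D" "diameter D \<le> R" and R: "R \<ge> 1" and t: "t \<ge> 1" "t \<ge> ln R"
    and A: "A \<in> eval_events D" "increasing_event A" and \<eta>: "\<eta> > 0"
  shows "\<exists>G d. finite G \<and> G \<subseteq> D \<and> d > 0 \<and>
     prob {\<omega> \<in> space M. ((\<lambda>x. f x \<omega>) \<in> A) \<noteq> (interp d G (\<lambda>y. g y \<omega>) \<in> A)} \<le> 20809 * exp (- t\<^sup>2) + 424 * s * t * sqrt K + \<eta>"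
proof -
  define e where "e = 53 * s * t"
  have e: "e > 0" using s t by (simp add: e_def)
  have [measurable]: "\<And>x. f x \<in> borel_measurable M" "\<And>x. g x \<in> borel_measurable M" using fH gH measurable_mem by auto
  let ?N = "\<lambda>d. {\<omega> \<in> space M. \<exists>x\<in>D. \<exists>y\<in>D. dist x y < 2 * d \<and> \<bar>f x \<omega> - f y \<omega>\<bar> > e}"
  obtain d where d: "d > 0" and Nev: "?N d \<in> events" and N: "prob (?N d) < \<eta>"
    using modulus_events[where f = f, OF _ cont D(1) e \<eta>] by auto
  obtain G where G: "finite G" "G \<subseteq> D" and net: "\<And>x. x \<in> D \<Longrightarrow> \<exists>z\<in>G. dist x z \<le> d"
    using finite_net[OF D(1) d] by blast
  have Gne: "G \<noteq> {}" using net[OF x0] by auto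
  have distR: "dist x0 x \<le> R" if "x \<in> D" for x
    using diameter_bounded_bound[OF D(1) x0 that] D(2) by linarith
  let ?F = "\<lambda>\<omega> x. f x \<omega>"
  let ?L = "interp d G"
  have LC: "?L v \<in> C_plane" for v using d by (rule interp_C_plane)
  have FC: "?F \<omega> \<in> C_plane" if "\<omega> \<in> space M" for \<omega> using cont[OF that] by (simp add: C_plane_def)
  define U where "U = {\<omega> \<in> space M. \<exists>x\<in>G. \<bar>f x \<omega> - g x \<omega>\<bar> > 53 * s * t}"
  define E where "E = {v \<in> space (PiM G (\<lambda>_. borel)). ?L v \<in> A}"
  \<comment> \<open>The shift \<open>2 * e\<close> dominates both the interpolation error of
    \<open>f\<close> on \<open>D\<close> and the difference of \<open>f\<close> and \<open>g\<close>
    on \<open>G\<close>.\<close>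
  define V where "V = {\<omega> \<in> space M. (\<lambda>x\<in>G. f x \<omega> + 2 * e) \<in> E \<and> (\<lambda>x\<in>G. f x \<omega> - 2 * e) \<notin> E}"
  have Em: "E \<in> sets (PiM G (\<lambda>_. borel))"
    unfolding E_def
  proof (rule eval_events_vimage[OF A(1) LC])
    fix x
    show "(\<lambda>v. ?L v x) \<in> borel_measurable (PiM G (\<lambda>_. borel))"
      unfolding interp_def using G(1) by (intro borel_measurable_divide borel_measurable_sum borel_measurable_times) measurable
  qed
  have U: "prob U \<le> 20809 * exp (- t\<^sup>2)"
    unfolding U_def
    by (rule sup_tail_bound[OF diff_mem[OF fH gH] var lip s G(1) _ R t, of x0]) (use distR G(2) in auto)
  have V: "prob V \<le> 4 * (2 * e) * sqrt K"
    unfolding V_def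
  proof (rule increasing_shift_bound[OF G(1) Gne fH bound[OF G(1)] _ Em])
    show "h x \<ge> 1" if "x \<in> G" for x using h distR G(2) that by auto
    fix u v assume "u \<in> E" "v \<in> space (PiM G (\<lambda>_. borel))" "\<And>x. x \<in> G \<Longrightarrow> u x \<le> v x"
    then show "v \<in> E"
      using interp_mono[OF d, of G u v] increasing_event_on[OF A, of "?L u" "?L v"] LC by (auto simp: E_def)
  qed (use e in auto)
  have "{\<omega> \<in> space M. (?F \<omega> \<in> A) \<noteq> (?L (\<lambda>y. g y \<omega>) \<in> A)} \<subseteq> ?N d \<union> U \<union> V"
  proof (rule subsetI, rule ccontr)
    fix \<omega> assume w: "\<omega> \<in> {\<omega> \<in> space M. (?F \<omega> \<in> A) \<noteq> (?L (\<lambda>y. g y \<omega>) \<in> A)}" and n: "\<omega> \<notin> ?N d \<union> U \<union> V"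
    then have sp: "\<omega> \<in> space M" and ne: "(?F \<omega> \<in> A) \<noteq> (?L (\<lambda>y. g y \<omega>) \<in> A)" by auto
    have mod: "\<bar>f x \<omega> - f y \<omega>\<bar> \<le> e" if "x \<in> D" "y \<in> D" "dist x y < 2 * d" for x y
    proof (rule ccontr)
      assume "\<not> \<bar>f x \<omega> - f y \<omega>\<bar> \<le> e"
      then have "\<omega> \<in> ?N d" using sp that by (intro CollectI conjI bexI[of _ x] bexI[of _ y]) auto
      with n show False by blast
    qed
    have fg: "\<bar>f y \<omega> - g y \<omega>\<bar> \<le> e" if "y \<in> G" for y
      using n sp that by (auto simp: U_def not_less e_def)
    have FL: "\<bar>f x \<omega> - ?L (?F \<omega>) x\<bar> \<le> e" if x: "x \<in> D" for x
    proof -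
      obtain z where z: "z \<in> G" "dist x z \<le> d" using net[OF x] by blast
      show ?thesis using G(2) x by (intro interp_close[OF G(1) z d] mod) auto
    qed
    have shift: "?L (\<lambda>y. f y \<omega> + r) x = ?L (?F \<omega>) x + r" if x: "x \<in> D" for x r
    proof -
      obtain z where z: "z \<in> G" "dist x z \<le> d" using net[OF x] by blast
      show ?thesis by (rule interp_add_const[OF G(1) z d])
    qed
    have up: "?L (\<lambda>y. f y \<omega> + 2 * e) \<in> A" if a: "?F \<omega> \<in> A \<or> ?L (\<lambda>y. g y \<omega>) \<in> A"
      using a
    proof
      assume "?F \<omega> \<in> A"
      then show ?thesis
      proof (rule increasing_event_on[OF A _ LC])
        fix x assume "x \<in> D"
        then show "f x \<omega> \<le> ?L (\<lambda>y. f y \<omega> + 2 * e) x" using FL[of x] e by (simp add: shift abs_le_iff)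
      qed
    next
      assume "?L (\<lambda>y. g y \<omega>) \<in> A"
      then show ?thesis
      proof (rule increasing_event_on[OF A _ LC])
        fix x show "?L (\<lambda>y. g y \<omega>) x \<le> ?L (\<lambda>y. f y \<omega> + 2 * e) x"
          using fg e by (intro interp_mono[OF d]) (fastforce simp: abs_le_iff)
      qed
    qed
    have down: "?L (\<lambda>y. f y \<omega> + (- (2 * e))) \<notin> A" if a: "?F \<omega> \<notin> A \<or> ?L (\<lambda>y. g y \<omega>) \<notin> A"
    proof
      assume b: "?L (\<lambda>y. f y \<omega> + (- (2 * e))) \<in> A"
      have "?F \<omega> \<in> A"
      proof (rule increasing_event_on[OF A b FC[OF sp]])
        fix x assume x: "x \<in> D"
        show "?L (\<lambda>y. f y \<omega> + (- (2 * e))) x \<le> f x \<omega>"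
          unfolding shift[OF x] using FL[OF x] e by linarith
      qed
      moreover have "?L (\<lambda>y. g y \<omega>) \<in> A"
      proof (rule increasing_event_on[OF A b LC])
        fix x show "?L (\<lambda>y. f y \<omega> + (- (2 * e))) x \<le> ?L (\<lambda>y. g y \<omega>) x"
          using fg e by (intro interp_mono[OF d]) (fastforce simp: abs_le_iff)
      qed
      ultimately show False using a by blast
    qed
    have res: "(\<lambda>x\<in>G. f x \<omega> + r) \<in> E \<longleftrightarrow> ?L (\<lambda>y. f y \<omega> + r) \<in> A" for r
    proof -
      have "?L (\<lambda>x\<in>G. f x \<omega> + r) = ?L (\<lambda>y. f y \<omega> + r)" by (rule interp_cong) simp
      then show ?thesis by (simp add: E_def space_PiM)
    qed
    \<comment> \<open>Exactly one of the two paths belongs to \<open>A\<close>, so \<open>up\<close>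
      applies to that one and \<open>down\<close> to the other: the two shifted interpolants
      separate.\<close>
    have "\<omega> \<in> V"
      using up down ne sp res[of "2 * e"] res[of "- (2 * e)"] by (auto simp: V_def)
    with n show False by simp
  qed
  moreover have "U \<in> events" unfolding U_def using G(1) by measurable
  moreover have "V \<in> events"
  proof -
    note [measurable] = Em
    have [measurable]: "(\<lambda>\<omega>. \<lambda>x\<in>G. f x \<omega> + 2 * e) \<in> measurable M (PiM G (\<lambda>_. borel))"
      "(\<lambda>\<omega>. \<lambda>x\<in>G. f x \<omega> - 2 * e) \<in> measurable M (PiM G (\<lambda>_. borel))"
      by (intro measurable_restrict; measurable)+
    show ?thesis unfolding V_def by measurable
  qed
  ultimately have "prob {\<omega> \<in> space M. (?F \<omega> \<in> A) \<noteq> (?L (\<lambda>y. g y \<omega>) \<in> A)} \<le> prob (?N d \<union> U \<union> V)"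
    using Nev by (intro finite_measure_mono) auto
  also have "\<dots> \<le> prob (?N d) + prob U + prob V"
    using Nev \<open>U \<in> events\<close> \<open>V \<in> events\<close> by (intro order_trans[OF measure_Un_le] add_mono) auto
  \<comment> \<open>The shift bound is 8 e times sqrt K, and 8 * 53 = 424.\<close>
  also have "\<dots> \<le> \<eta> + 20809 * exp (- t\<^sup>2) + 424 * s * t * sqrt K"
    using N U V by (simp add: e_def)
  finally have "prob {\<omega> \<in> space M. (?F \<omega> \<in> A) \<noteq> (?L (\<lambda>y. g y \<omega>) \<in> A)} \<le> 20809 * exp (- t\<^sup>2) + 424 * s * t * sqrt K + \<eta>" by simp
  then show ?thesis using G d by blast
qed

text \<open>Two continuous paths disagree about \<open>A\<close> exactly when they disagree about
  its complement in \<open>C_plane\<close>, so decreasing events reduce to increasing ones.\<close>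

lemma monotonic_event_approx:
  fixes f g :: "real^2 \<Rightarrow> 'w \<Rightarrow> real"
  assumes "\<And>x. f x \<in> H" "\<And>x. g x \<in> H"
    and cont: "\<And>\<omega>. \<omega> \<in> space M \<Longrightarrow> continuous_on UNIV (\<lambda>x. f x \<omega>)"
    and "s > 0"
    and "\<And>x. cov (\<lambda>\<omega>. f x \<omega> - g x \<omega>) (\<lambda>\<omega>. f x \<omega> - g x \<omega>) \<le> s\<^sup>2"
    and "\<And>x y. cov (\<lambda>\<omega>. (f x \<omega> - g x \<omega>) - (f y \<omega> - g y \<omega>)) (\<lambda>\<omega>. (f x \<omega> - g x \<omega>) - (f y \<omega> - g y \<omega>)) \<le> (s * dist x y)\<^sup>2"
    and "x0 \<in> D" "\<And>x. dist x0 x \<le> R \<Longrightarrow> h x \<ge> 1"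
    and "\<And>G c. finite G \<Longrightarrow> (\<Sum>x\<in>G. c x * h x)\<^sup>2 \<le> K * cov (\<lambda>\<omega>. \<Sum>x\<in>G. c x * f x \<omega>) (\<lambda>\<omega>. \<Sum>x\<in>G. c x * f x \<omega>)"
    and "bounded D" "diameter D \<le> R" "R \<ge> 1" "t \<ge> 1" "t \<ge> ln R"
    and A: "A \<in> eval_events D" "monotonic_event A" and "\<eta> > 0"
  shows "\<exists>G d. finite G \<and> G \<subseteq> D \<and> d > 0 \<and>
     prob {\<omega> \<in> space M. ((\<lambda>x. f x \<omega>) \<in> A) \<noteq> (interp d G (\<lambda>y. g y \<omega>) \<in> A)} \<le> 20809 * exp (- t\<^sup>2) + 424 * s * t * sqrt K + \<eta>"
proof (cases "increasing_event A")
  case True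
  show ?thesis by (rule increasing_event_approx[OF assms(1-15) True assms(17)])
next
  case False
  then have dec: "increasing_event (C_plane - A)"
    using A(2) by (auto simp: monotonic_event_def decreasing_event_def)
  have ev: "C_plane - A \<in> eval_events D"
    using A(1) unfolding eval_events_def by (rule sigma_sets.Compl)
  obtain G d where G: "finite G" "G \<subseteq> D" "d > 0"
    and p: "prob {\<omega> \<in> space M. ((\<lambda>x. f x \<omega>) \<in> C_plane - A) \<noteq> (interp d G (\<lambda>y. g y \<omega>) \<in> C_plane - A)} \<le> 20809 * exp (- t\<^sup>2) + 424 * s * t * sqrt K + \<eta>"
    using increasing_event_approx[OF assms(1-14) ev dec assms(17)] by blast
  have "{\<omega> \<in> space M. ((\<lambda>x. f x \<omega>) \<in> C_plane - A) \<noteq> (interp d G (\<lambda>y. g y \<omega>) \<in> C_plane - A)} = {\<omega> \<in> space M. ((\<lambda>x. f x \<omega>) \<in> A) \<noteq> (interp d G (\<lambda>y. g y \<omega>) \<in> A)}"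
    using cont interp_C_plane[OF G(3)] by (auto simp: C_plane_def)
  then show ?thesis using G p by auto
qed

end

section \<open>Decorrelation\<close>

lemma (in prob_space) prob_diff_le_symdiff:
  assumes "X \<in> events" "Y \<in> events" "Z \<in> events" and "X \<subseteq> Y \<union> Z" "Y \<subseteq> X \<union> Z"
  shows "\<bar>prob X - prob Y\<bar> \<le> prob Z"
proof -
  have "prob X \<le> prob (Y \<union> Z)" "prob Y \<le> prob (X \<union> Z)"
    using assms by (auto intro!: finite_measure_mono)
  moreover have "prob (Y \<union> Z) \<le> prob Y + prob Z" "prob (X \<union> Z) \<le> prob X + prob Z"
    using assms by (auto intro!: measure_Un_le)
  ultimately show ?thesis by linarith
qed

text \<open>The joint probability and the product of probabilities each move by at most \<delta>1 +
  \<delta>2 when the events are replaced by the independent ones.\<close>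

lemma (in prob_space) decorrelation_by_approximation:
  assumes ev: "a \<in> events" "b \<in> events" "a' \<in> events" "b' \<in> events"
    and indep: "prob (a' \<inter> b') = prob a' * prob b'"
    and da: "prob ((a - a') \<union> (a' - a)) \<le> \<delta>1" and db: "prob ((b - b') \<union> (b' - b)) \<le> \<delta>2"
  shows "\<bar>prob (a \<inter> b) - prob a * prob b\<bar> \<le> 2 * \<delta>1 + 2 * \<delta>2"
proof -
  let ?Z1 = "(a - a') \<union> (a' - a)" and ?Z2 = "(b - b') \<union> (b' - b)"
  have A: "\<bar>prob a - prob a'\<bar> \<le> \<delta>1"
    using prob_diff_le_symdiff[of a a' ?Z1] ev da by fastforce
  have B: "\<bar>prob b - prob b'\<bar> \<le> \<delta>2"
    using prob_diff_le_symdiff[of b b' ?Z2] ev db by fastforce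
  have "\<bar>prob (a \<inter> b) - prob (a' \<inter> b')\<bar> \<le> prob (?Z1 \<union> ?Z2)"
    using ev by (intro prob_diff_le_symdiff) auto
  also have "\<dots> \<le> prob ?Z1 + prob ?Z2" using ev by (intro measure_Un_le) auto
  finally have C: "\<bar>prob (a \<inter> b) - prob (a' \<inter> b')\<bar> \<le> \<delta>1 + \<delta>2" using da db by linarith
  have "prob a' * prob b' - prob a * prob b = (prob a' - prob a) * prob b' + prob a * (prob b' - prob b)"
    by (simp add: algebra_simps)
  then have "\<bar>prob a' * prob b' - prob a * prob b\<bar> \<le> \<bar>prob a' - prob a\<bar> * prob b' + prob a * \<bar>prob b' - prob b\<bar>"
    using abs_triangle_ineq[of "(prob a' - prob a) * prob b'" "prob a * (prob b' - prob b)"] by (simp add: abs_mult)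
  also have "\<dots> \<le> \<bar>prob a' - prob a\<bar> + \<bar>prob b' - prob b\<bar>"
    by (intro add_mono mult_left_le mult_left_le_one_le) auto
  finally have "\<bar>prob a' * prob b' - prob a * prob b\<bar> \<le> \<delta>1 + \<delta>2" using A B by linarith
  with C indep show ?thesis by linarith
qed

lemma square_integrable_reflect:
  fixes q :: "real^2 \<Rightarrow> real"
  assumes "square_integrable q"
  shows "square_integrable (\<lambda>u. q (x - u))"
proof -
  have [measurable]: "q \<in> borel_measurable borel" using square_integrableD(1)[OF assms] .
  have "(\<integral>\<^sup>+u. ennreal ((q (x - u))\<^sup>2) \<partial>lborel) = (\<integral>\<^sup>+u. ennreal ((q u)\<^sup>2) \<partial>lborel)"
    by (rule nn_integral_lborel_reflect[of "\<lambda>u. ennreal ((q u)\<^sup>2)"]) measurable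
  also have "\<dots> < \<infinity>" using square_integrableD(2)[OF assms] by (simp add: integrable_iff_bounded)
  finally show ?thesis by (simp add: square_integrable_def integrable_iff_bounded)
qed

theorem theorem4p2:
  fixes M :: "'w measure"
    and W :: "(real^2 \<Rightarrow> real) \<Rightarrow> 'w \<Rightarrow> real"
    and q :: "real^2 \<Rightarrow> real"
    and f :: "real^2 \<Rightarrow> 'w \<Rightarrow> real"
    and \<rho> :: "real^2 \<Rightarrow> complex"
    and \<beta> :: real
  assumes noise: "white_noise M W"
    and kernel: "regular_kernel q"
    and field: "continuous_modification M (noise_conv q W) f"
    and transform: "is_fourier_transform (\<lambda>x. complex_of_real (q x)) \<rho>"
    and beta: "\<beta> > 1"
    and decay: "\<exists>c>0. \<forall>a b. a + b \<le> 1 \<longrightarrow>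
        (\<forall>x. norm x > 1 \<longrightarrow> \<bar>multi_deriv (a, b) q x\<bar> < c * norm x powr (- \<beta>))"
    and nonvanishing: "\<exists>V. open V \<and> 0 \<in> V \<and>
        (\<exists>\<delta>>0. AE s in lborel. s \<in> V \<longrightarrow> \<delta> \<le> cmod (\<rho> s))"
  shows "\<exists>c\<^sub>1>0. \<exists>c\<^sub>2>0. \<exists>R\<^sub>0>0.
    \<forall>R\<^sub>1 R\<^sub>2 r t\<^sub>1 t\<^sub>2 :: real. \<forall>D\<^sub>1 D\<^sub>2 :: (real^2) set. \<forall>A B :: (real^2 \<Rightarrow> real) set.
      R\<^sub>1 \<ge> R\<^sub>0 \<longrightarrow> R\<^sub>2 \<ge> R\<^sub>0 \<longrightarrow> r \<ge> 1 \<longrightarrow> t\<^sub>1 \<ge> ln R\<^sub>1 \<longrightarrow> t\<^sub>2 \<ge> ln R\<^sub>2 \<longrightarrow>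
      D\<^sub>1 \<in> sets borel \<longrightarrow> D\<^sub>2 \<in> sets borel \<longrightarrow>
      bounded D\<^sub>1 \<longrightarrow> diameter D\<^sub>1 \<le> R\<^sub>1 \<longrightarrow>
      bounded D\<^sub>2 \<longrightarrow> diameter D\<^sub>2 \<le> R\<^sub>2 \<longrightarrow>
      r = setdist D\<^sub>1 D\<^sub>2 \<longrightarrow>
      A \<in> eval_events D\<^sub>1 \<longrightarrow> monotonic_event A \<longrightarrow>
      B \<in> eval_events D\<^sub>2 \<longrightarrow> monotonic_event B \<longrightarrow>
      \<bar>\<P>(\<omega> in M. (\<lambda>x. f x \<omega>) \<in> A \<inter> B)
         - \<P>(\<omega> in M. (\<lambda>x. f x \<omega>) \<in> A) * \<P>(\<omega> in M. (\<lambda>x. f x \<omega>) \<in> B)\<bar>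
      \<le> c\<^sub>1 * R\<^sub>1 * t\<^sub>1 * r powr (1 - \<beta>) + c\<^sub>1 * exp (- c\<^sub>2 * t\<^sub>1\<^sup>2)
        + c\<^sub>1 * R\<^sub>2 * t\<^sub>2 * r powr (1 - \<beta>) + c\<^sub>1 * exp (- c\<^sub>2 * t\<^sub>2\<^sup>2)"
proof -
  interpret gaussian_space M "noise_space M W" by (rule gaussian_space_noise[OF noise])
  have qL2: "square_integrable q" and qeven: "\<And>x. q (- x) = q x"
    using kernel by (auto simp: regular_kernel_def)
  have [measurable]: "q \<in> borel_measurable borel" by (rule square_integrableD(1)[OF qL2])
  obtain \<kappa> where \<kappa>: "\<kappa> > 0"
    and p_norm: "\<And>r. r \<ge> 1 \<Longrightarrow> (\<integral>\<^sup>+x. ennreal ((q x * (1 - cutoff r x))\<^sup>2) \<partial>lborel) \<le> ennreal ((\<kappa> * r powr (1 - \<beta>))\<^sup>2)"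
    and p_incr: "\<And>r v. r \<ge> 1 \<Longrightarrow> (\<integral>\<^sup>+x. ennreal ((q (x + v) * (1 - cutoff r (x + v)) - q x * (1 - cutoff r x))\<^sup>2) \<partial>lborel) \<le> ennreal ((\<kappa> * r powr (1 - \<beta>) * norm v)\<^sup>2)"
    using truncation_error_bounds[OF kernel beta decay] by blast
  obtain V \<delta> where "open V" "0 \<in> V" "\<delta> > 0" "AE s in lborel. s \<in> V \<longrightarrow> \<delta> \<le> cmod (\<rho> s)"
    using nonvanishing by blast
  then obtain K R\<^sub>0 where K: "K > 0" and R\<^sub>0: "R\<^sub>0 > 0"
    and repro: "\<And>R x0. R \<ge> R\<^sub>0 \<Longrightarrow> \<exists>h. (\<forall>x. dist x0 x \<le> R \<longrightarrow> h x \<ge> 1) \<and>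
        (\<forall>G c. finite G \<longrightarrow> (\<Sum>x\<in>G. c x * h x)\<^sup>2 \<le> K * R\<^sup>2 * (LINT u|lborel. (\<Sum>x\<in>G. c x * q (x - u))\<^sup>2))"
    using reproducing_norm_bound[OF transform qeven] by blast
  have f_meas[measurable]: "f x \<in> borel_measurable M" for x
    using field by (simp add: continuous_modification_def)
  have f_cont: "continuous_on UNIV (\<lambda>x. f x \<omega>)" if "\<omega> \<in> space M" for \<omega>
    using field that by (simp add: continuous_modification_def)
  have f_rep: "f x \<in> borel_measurable M \<and> square_integrable (\<lambda>u. q (x - u)) \<and> (AE \<omega> in M. f x \<omega> = W (\<lambda>u. q (x - u)) \<omega>)" for x
    using field square_integrable_reflect[OF qL2] by (simp add: continuous_modification_def noise_conv_def)
  have fH: "f x \<in> noise_space M W" for x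
    using f_rep[of x] by (auto simp: noise_space_def)
  have cov_f: "cov (\<lambda>\<omega>. \<Sum>x\<in>G. c x * f x \<omega>) (\<lambda>\<omega>. \<Sum>x\<in>G. c x * f x \<omega>) = (LINT u|lborel. (\<Sum>x\<in>G. c x * q (x - u))\<^sup>2)"
    if G: "finite G" for G c
  proof -
    have r: "(\<lambda>\<omega>. \<Sum>x\<in>G. c x * f x \<omega>) \<in> borel_measurable M" "square_integrable (\<lambda>u. \<Sum>x\<in>G. c x * q (x - u))"
      "AE \<omega> in M. (\<Sum>x\<in>G. c x * f x \<omega>) = W (\<lambda>u. \<Sum>x\<in>G. c x * q (x - u)) \<omega>"
      using noise_finite_sum[OF noise G, of f "\<lambda>x u. q (x - u)" c] f_rep by auto
    show ?thesis using noise_expectation_product[OF noise r r] by (simp add: cov_def power2_eq_square)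
  qed
  define \<phi> where "\<phi> r x = (\<lambda>u. q (x - u) * cutoff r (x - u))" for r and x :: "real^2"
  define g where "g r x = W (\<phi> r x)" for r x
  have \<phi>L2: "square_integrable (\<phi> r x)" for r x
  proof -
    have "square_integrable (\<lambda>u. q u * cutoff r u)"
      unfolding square_integrable_def
    proof
      show "integrable lborel (\<lambda>u. (norm (q u * cutoff r u))\<^sup>2)"
      proof (rule Bochner_Integration.integrable_bound[OF square_integrableD(2)[OF qL2]])
        have "(q u * cutoff r u)\<^sup>2 \<le> (q u)\<^sup>2" for u
          using cutoff_bounds[of r u] by (simp add: power_mult_distrib mult_left_le power_le_one)
        then show "AE u in lborel. norm ((norm (q u * cutoff r u))\<^sup>2) \<le> norm ((q u)\<^sup>2)" by simp
      qed measurable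
    qed measurable
    from square_integrable_reflect[OF this] show ?thesis by (simp add: \<phi>_def)
  qed
  have g_meas[measurable]: "g r x \<in> borel_measurable M" for r x
    unfolding g_def by (rule noise_measurable[OF noise \<phi>L2])
  have gH: "g r x \<in> noise_space M W" for r x
    unfolding noise_space_def g_def using \<phi>L2[of r x] noise_measurable[OF noise \<phi>L2[of r x]] by auto
  define p where "p r u = q u * (1 - cutoff r u)" for r u
  have [measurable]: "p r \<in> borel_measurable borel" for r unfolding p_def[abs_def] by measurable
  have fg_rep: "(\<lambda>\<omega>. f x \<omega> - g r x \<omega>) \<in> borel_measurable M" "square_integrable (\<lambda>u. p r (x - u))"
    "AE \<omega> in M. f x \<omega> - g r x \<omega> = W (\<lambda>u. p r (x - u)) \<omega>" for r x
  proof -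
    have a: "g r x \<in> borel_measurable M" "square_integrable (\<phi> r x)" "AE \<omega> in M. g r x \<omega> = W (\<phi> r x) \<omega>"
      using \<phi>L2 noise_measurable[OF noise \<phi>L2] by (auto simp: g_def)
    have b: "f x \<in> borel_measurable M" "square_integrable (\<lambda>u. q (x - u))" "AE \<omega> in M. f x \<omega> = W (\<lambda>u. q (x - u)) \<omega>"
      using f_rep by auto
    have "(\<lambda>u. - 1 * \<phi> r x u + q (x - u)) = (\<lambda>u. p r (x - u))" by (auto simp: \<phi>_def p_def algebra_simps)
    then show "(\<lambda>\<omega>. f x \<omega> - g r x \<omega>) \<in> borel_measurable M" "square_integrable (\<lambda>u. p r (x - u))"
      "AE \<omega> in M. f x \<omega> - g r x \<omega> = W (\<lambda>u. p r (x - u)) \<omega>"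
      using noise_linear_combination[OF noise a b, of "- 1"] by simp_all
  qed
  have cov_le: "cov X X \<le> m\<^sup>2" if X: "X \<in> borel_measurable M" "square_integrable \<psi>" "AE \<omega> in M. X \<omega> = W \<psi> \<omega>"
      and m: "(\<integral>\<^sup>+u. ennreal ((\<psi> u)\<^sup>2) \<partial>lborel) \<le> ennreal (m\<^sup>2)" for X \<psi> m
  proof -
    have "cov X X = (LINT u|lborel. (\<psi> u)\<^sup>2)"
      using noise_expectation_product[OF noise X X] by (simp add: cov_def power2_eq_square)
    moreover have "(\<integral>\<^sup>+u. ennreal ((\<psi> u)\<^sup>2) \<partial>lborel) = ennreal (LINT u|lborel. (\<psi> u)\<^sup>2)"
      using square_integrableD(2)[OF X(2)] by (intro nn_integral_eq_integral) auto
    ultimately show ?thesis using m by (simp add: ennreal_le_iff)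
  qed
  have var: "cov (\<lambda>\<omega>. f x \<omega> - g r x \<omega>) (\<lambda>\<omega>. f x \<omega> - g r x \<omega>) \<le> (\<kappa> * r powr (1 - \<beta>))\<^sup>2" if r: "r \<ge> 1" for r x
  proof (rule cov_le[OF fg_rep])
    have "(\<integral>\<^sup>+u. ennreal ((p r (x - u))\<^sup>2) \<partial>lborel) = (\<integral>\<^sup>+u. ennreal ((p r u)\<^sup>2) \<partial>lborel)"
      by (rule nn_integral_lborel_reflect[of "\<lambda>u. ennreal ((p r u)\<^sup>2)"]) measurable
    then show "(\<integral>\<^sup>+u. ennreal ((p r (x - u))\<^sup>2) \<partial>lborel) \<le> ennreal ((\<kappa> * r powr (1 - \<beta>))\<^sup>2)"
      using p_norm[OF r] by (simp add: p_def)
  qed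
  have lip: "cov (\<lambda>\<omega>. (f x \<omega> - g r x \<omega>) - (f y \<omega> - g r y \<omega>)) (\<lambda>\<omega>. (f x \<omega> - g r x \<omega>) - (f y \<omega> - g r y \<omega>)) \<le> (\<kappa> * r powr (1 - \<beta>) * dist x y)\<^sup>2"
    if r: "r \<ge> 1" for r x y
  proof (rule cov_le)
    have rep_at: "(\<lambda>\<omega>. f z \<omega> - g r z \<omega>) \<in> borel_measurable M" "square_integrable (\<lambda>u. p r (z - u))"
      "AE \<omega> in M. f z \<omega> - g r z \<omega> = W (\<lambda>u. p r (z - u)) \<omega>" for z by (rule fg_rep)+
    note rep = noise_linear_combination[OF noise rep_at[of y] rep_at[of x], of "- 1"]
    show "(\<lambda>\<omega>. (f x \<omega> - g r x \<omega>) - (f y \<omega> - g r y \<omega>)) \<in> borel_measurable M" by measurable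
    have eq: "(\<lambda>u. - 1 * p r (y - u) + p r (x - u)) = (\<lambda>u. p r (x - u) - p r (y - u))" by auto
    show "square_integrable (\<lambda>u. p r (x - u) - p r (y - u))" using rep(2) unfolding eq .
    show "AE \<omega> in M. (f x \<omega> - g r x \<omega>) - (f y \<omega> - g r y \<omega>) = W (\<lambda>u. p r (x - u) - p r (y - u)) \<omega>"
      using rep(3) unfolding eq by eventually_elim simp
    have "(\<integral>\<^sup>+u. ennreal ((p r (x - u) - p r (y - u))\<^sup>2) \<partial>lborel) = (\<integral>\<^sup>+u. ennreal ((p r (y - u + (x - y)) - p r (y - u))\<^sup>2) \<partial>lborel)"
      by (simp add: algebra_simps)
    also have "\<dots> = (\<integral>\<^sup>+u. ennreal ((p r (u + (x - y)) - p r u)\<^sup>2) \<partial>lborel)"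
      by (rule nn_integral_lborel_reflect[of "\<lambda>u. ennreal ((p r (u + (x - y)) - p r u)\<^sup>2)"]) measurable
    also have "\<dots> \<le> ennreal ((\<kappa> * r powr (1 - \<beta>) * dist x y)\<^sup>2)"
      using p_incr[OF r, of "x - y"] by (simp add: p_def dist_norm)
    finally show "(\<integral>\<^sup>+u. ennreal ((p r (x - u) - p r (y - u))\<^sup>2) \<partial>lborel) \<le> ennreal ((\<kappa> * r powr (1 - \<beta>) * dist x y)\<^sup>2)" .
  qed
  have unc: "cov (g r x) (g r y) = 0" if r: "r > 0" and xy: "dist x y \<ge> r" for r x y
  proof -
    have disj: "\<phi> r x u * \<phi> r y u = 0" for u
    proof -
      \<comment> \<open>As x and y are at distance at least r, no u is closer than r / 2 to both, so
        one of the two truncated kernels vanishes at u.\<close>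
      have "norm (x - u) \<ge> r / 2 \<or> norm (y - u) \<ge> r / 2"
        using dist_triangle2[of x y u] xy by (auto simp: dist_norm)
      then show ?thesis using cutoff_eq_0[OF r] by (auto simp: \<phi>_def)
    qed
    have "cov (g r x) (g r y) = (LINT u|lborel. \<phi> r x u * \<phi> r y u)"
      unfolding cov_def g_def using noise_product(2)[OF noise \<phi>L2 \<phi>L2] .
    then show ?thesis unfolding disj by simp
  qed
  \<comment> \<open>Decorrelation doubles each approximation error, and 848 = 2 * 424. Taking the
    sum lets one constant serve both kinds of terms.\<close>
  define c1 where "c1 = 2 * 20809 + 848 * \<kappa> * sqrt K"
  have c1: "c1 > 0" "c1 \<ge> 2 * 20809" "c1 \<ge> 848 * \<kappa> * sqrt K" using \<kappa> K by (auto simp: c1_def intro!: add_pos_nonneg)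
  have approx: "\<exists>G d. finite G \<and> G \<subseteq> D \<and> d > 0 \<and>
     2 * prob {\<omega> \<in> space M. ((\<lambda>x. f x \<omega>) \<in> A) \<noteq> (interp d G (\<lambda>y. g r y \<omega>) \<in> A)} \<le> c1 * R * t * r powr (1 - \<beta>) + c1 * exp (- 1 * t\<^sup>2) + 2 * \<eta>"
    if R: "R \<ge> max R\<^sub>0 (exp 1)" and r: "r \<ge> 1" and t: "t \<ge> ln R" and D: "D \<noteq> {}" "bounded D" "diameter D \<le> R"
      and A: "A \<in> eval_events D" "monotonic_event A" and \<eta>: "\<eta> > 0" for R r t D A \<eta>
  proof -
    obtain x0 where x0: "x0 \<in> D" using D(1) by auto
    have R1: "R \<ge> 1" using R one_le_exp_iff[of 1] by linarith
    \<comment> \<open>This is the purpose of exp 1 in the radius threshold.\<close>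
    have t1: "t \<ge> 1"
    proof -
      have "ln (exp 1) \<le> ln R" using R R1 by (subst ln_le_cancel_iff) auto
      then show ?thesis using t by simp
    qed
    obtain h where h: "\<And>x. dist x0 x \<le> R \<Longrightarrow> h x \<ge> 1"
      "\<And>G c. finite G \<Longrightarrow> (\<Sum>x\<in>G. c x * h x)\<^sup>2 \<le> K * R\<^sup>2 * (LINT u|lborel. (\<Sum>x\<in>G. c x * q (x - u))\<^sup>2)"
      using repro[of R x0] R by auto
    have bound: "(\<Sum>x\<in>G. c x * h x)\<^sup>2 \<le> (K * R\<^sup>2) * cov (\<lambda>\<omega>. \<Sum>x\<in>G. c x * f x \<omega>) (\<lambda>\<omega>. \<Sum>x\<in>G. c x * f x \<omega>)" if "finite G" for G c
      using h(2)[OF that] by (simp add: cov_f[OF that])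
    let ?s = "\<kappa> * r powr (1 - \<beta>)"
    have s: "?s > 0" using \<kappa> r by simp
    obtain G d where G: "finite G" "G \<subseteq> D" "d > 0"
      and pr: "prob {\<omega> \<in> space M. ((\<lambda>x. f x \<omega>) \<in> A) \<noteq> (interp d G (\<lambda>y. g r y \<omega>) \<in> A)} \<le> 20809 * exp (- t\<^sup>2) + 424 * ?s * t * sqrt (K * R\<^sup>2) + \<eta>"
      using monotonic_event_approx[OF fH gH f_cont s var[OF r] lip[OF r] x0 h(1) bound D(2,3) R1 t1 t A \<eta>] by blast
    have "sqrt (K * R\<^sup>2) = sqrt K * R" using R1 by (simp add: real_sqrt_mult)
    then have "2 * (20809 * exp (- t\<^sup>2) + 424 * ?s * t * sqrt (K * R\<^sup>2) + \<eta>) = (848 * \<kappa> * sqrt K) * (R * t * r powr (1 - \<beta>)) + (2 * 20809) * exp (- t\<^sup>2) + 2 * \<eta>"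
      by (simp add: algebra_simps)
    also have "\<dots> \<le> c1 * (R * t * r powr (1 - \<beta>)) + c1 * exp (- t\<^sup>2) + 2 * \<eta>"
      using c1 R1 t1 \<eta> by (intro add_mono mult_right_mono) auto
    finally show ?thesis using G pr by (intro exI[of _ G] exI[of _ d]) (simp add: mult.assoc)
  qed
  have f_event: "{\<omega> \<in> space M. (\<lambda>x. f x \<omega>) \<in> A} \<in> events" if "A \<in> eval_events D" for A D
    by (rule eval_events_vimage[OF that]) (use f_cont in \<open>auto simp: C_plane_def\<close>)
  have core: "\<bar>prob {\<omega> \<in> space M. (\<lambda>x. f x \<omega>) \<in> A \<inter> B}
         - prob {\<omega> \<in> space M. (\<lambda>x. f x \<omega>) \<in> A} * prob {\<omega> \<in> space M. (\<lambda>x. f x \<omega>) \<in> B}\<bar>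
      \<le> c1 * R\<^sub>1 * t\<^sub>1 * r powr (1 - \<beta>) + c1 * exp (- 1 * t\<^sub>1\<^sup>2) + c1 * R\<^sub>2 * t\<^sub>2 * r powr (1 - \<beta>) + c1 * exp (- 1 * t\<^sub>2\<^sup>2)"
    if R: "R\<^sub>1 \<ge> max R\<^sub>0 (exp 1)" "R\<^sub>2 \<ge> max R\<^sub>0 (exp 1)" and r: "r \<ge> 1" "r = setdist D\<^sub>1 D\<^sub>2"
      and t: "t\<^sub>1 \<ge> ln R\<^sub>1" "t\<^sub>2 \<ge> ln R\<^sub>2" and D: "bounded D\<^sub>1" "diameter D\<^sub>1 \<le> R\<^sub>1" "bounded D\<^sub>2" "diameter D\<^sub>2 \<le> R\<^sub>2"
      and A: "A \<in> eval_events D\<^sub>1" "monotonic_event A" and B: "B \<in> eval_events D\<^sub>2" "monotonic_event B"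
    for R\<^sub>1 R\<^sub>2 r t\<^sub>1 t\<^sub>2 D\<^sub>1 D\<^sub>2 A B
  proof (rule field_le_epsilon)
    \<comment> \<open>The nets depend on the error left by discretisation, but the other terms do
      not, so it suffices to reach the bound with an arbitrary extra e. Each of the two
      approximations is granted e / 4, doubled by decorrelation.\<close>
    fix e :: real assume e: "e > 0"
    \<comment> \<open>\<open>setdist\<close> is 0 if one of the sets is empty, so r >= 1 guarantees
      a base point in each.\<close>
    have ne: "D\<^sub>1 \<noteq> {}" "D\<^sub>2 \<noteq> {}" using r by auto
    have e4: "e / 4 > 0" using e by simp
    obtain G1 d1 where G1: "finite G1" "G1 \<subseteq> D\<^sub>1" "d1 > 0"
      and p1: "2 * prob {\<omega> \<in> space M. ((\<lambda>x. f x \<omega>) \<in> A) \<noteq> (interp d1 G1 (\<lambda>y. g r y \<omega>) \<in> A)} \<le> c1 * R\<^sub>1 * t\<^sub>1 * r powr (1 - \<beta>) + c1 * exp (- 1 * t\<^sub>1\<^sup>2) + 2 * (e / 4)"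
      using approx[OF R(1) r(1) t(1) ne(1) D(1,2) A e4] by blast
    obtain G2 d2 where G2: "finite G2" "G2 \<subseteq> D\<^sub>2" "d2 > 0"
      and p2: "2 * prob {\<omega> \<in> space M. ((\<lambda>x. f x \<omega>) \<in> B) \<noteq> (interp d2 G2 (\<lambda>y. g r y \<omega>) \<in> B)} \<le> c1 * R\<^sub>2 * t\<^sub>2 * r powr (1 - \<beta>) + c1 * exp (- 1 * t\<^sub>2\<^sup>2) + 2 * (e / 4)"
      using approx[OF R(2) r(1) t(2) ne(2) D(3,4) B e4] by blast
    have Em: "{v \<in> space (PiM G (\<lambda>_. borel)). interp d G v \<in> E} \<in> sets (PiM G (\<lambda>_. borel))"
      if "finite G" "d > 0" "E \<in> eval_events D" for G d E D
    proof (rule eval_events_vimage[OF that(3) interp_C_plane[OF that(2)]])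
      show "(\<lambda>v. interp d G v x) \<in> borel_measurable (PiM G (\<lambda>_. borel))" for x
        unfolding interp_def using that(1) by (intro borel_measurable_divide borel_measurable_sum borel_measurable_times) measurable
    qed
    have restr: "{\<omega> \<in> space M. (\<lambda>x\<in>G. g r x \<omega>) \<in> {v \<in> space (PiM G (\<lambda>_. borel)). interp d G v \<in> E}} = {\<omega> \<in> space M. interp d G (\<lambda>y. g r y \<omega>) \<in> E}" for G d E
    proof -
      have "interp d G (\<lambda>x\<in>G. g r x \<omega>) = interp d G (\<lambda>y. g r y \<omega>)" for \<omega> by (rule interp_cong) simp
      then show ?thesis by (simp add: space_PiM)
    qed
    let ?a = "{\<omega> \<in> space M. (\<lambda>x. f x \<omega>) \<in> A}" and ?b = "{\<omega> \<in> space M. (\<lambda>x. f x \<omega>) \<in> B}"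
    let ?a' = "{\<omega> \<in> space M. interp d1 G1 (\<lambda>y. g r y \<omega>) \<in> A}" and ?b' = "{\<omega> \<in> space M. interp d2 G2 (\<lambda>y. g r y \<omega>) \<in> B}"
    let ?EA = "{v \<in> space (PiM G1 (\<lambda>_. borel)). interp d1 G1 v \<in> A}" and ?EB = "{v \<in> space (PiM G2 (\<lambda>_. borel)). interp d2 G2 v \<in> B}"
    have ev': "{\<omega> \<in> space M. interp d G (\<lambda>y. g r y \<omega>) \<in> E} \<in> events" if "finite G" "d > 0" "E \<in> eval_events D" for G d E D
    proof (rule eval_events_vimage[OF that(3) interp_C_plane[OF that(2)]])
      show "(\<lambda>\<omega>. interp d G (\<lambda>y. g r y \<omega>) x) \<in> borel_measurable M" for x
        unfolding interp_def by measurable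
    qed
    have far: "cov (g r x) (g r y) = 0" if "x \<in> G1" "y \<in> G2" for x y
    proof (rule unc)
      show "dist x y \<ge> r" using setdist_le_dist[of x D\<^sub>1 y D\<^sub>2] that G1(2) G2(2) r(2) by auto
    qed (use r in auto)
    have "prob {\<omega> \<in> space M. (\<lambda>x\<in>G1. g r x \<omega>) \<in> ?EA \<and> (\<lambda>x\<in>G2. g r x \<omega>) \<in> ?EB}
      = prob {\<omega> \<in> space M. (\<lambda>x\<in>G1. g r x \<omega>) \<in> ?EA} * prob {\<omega> \<in> space M. (\<lambda>x\<in>G2. g r x \<omega>) \<in> ?EB}"
      by (rule uncorrelated_indep[OF G1(1) G2(1) gH gH far Em[OF G1(1,3) A(1)] Em[OF G2(1,3) B(1)]])
    moreover have "{\<omega> \<in> space M. (\<lambda>x\<in>G1. g r x \<omega>) \<in> ?EA \<and> (\<lambda>x\<in>G2. g r x \<omega>) \<in> ?EB} = ?a' \<inter> ?b'"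
      unfolding restr[symmetric] by blast
    ultimately have indep: "prob (?a' \<inter> ?b') = prob ?a' * prob ?b'" unfolding restr by simp
    have sd: "(?a - ?a') \<union> (?a' - ?a) = {\<omega> \<in> space M. ((\<lambda>x. f x \<omega>) \<in> A) \<noteq> (interp d1 G1 (\<lambda>y. g r y \<omega>) \<in> A)}"
      "(?b - ?b') \<union> (?b' - ?b) = {\<omega> \<in> space M. ((\<lambda>x. f x \<omega>) \<in> B) \<noteq> (interp d2 G2 (\<lambda>y. g r y \<omega>) \<in> B)}" by blast+
    have "\<bar>prob (?a \<inter> ?b) - prob ?a * prob ?b\<bar> \<le> 2 * prob ((?a - ?a') \<union> (?a' - ?a)) + 2 * prob ((?b - ?b') \<union> (?b' - ?b))"
      by (rule decorrelation_by_approximation[OF f_event[OF A(1)] f_event[OF B(1)] ev'[OF G1(1,3) A(1)] ev'[OF G2(1,3) B(1)] indep]) auto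
    moreover have "?a \<inter> ?b = {\<omega> \<in> space M. (\<lambda>x. f x \<omega>) \<in> A \<inter> B}" by blast
    ultimately show "\<bar>prob {\<omega> \<in> space M. (\<lambda>x. f x \<omega>) \<in> A \<inter> B} - prob ?a * prob ?b\<bar>
      \<le> c1 * R\<^sub>1 * t\<^sub>1 * r powr (1 - \<beta>) + c1 * exp (- 1 * t\<^sub>1\<^sup>2) + c1 * R\<^sub>2 * t\<^sub>2 * r powr (1 - \<beta>) + c1 * exp (- 1 * t\<^sub>2\<^sup>2) + e"
      using p1 p2 unfolding sd by simp
  qed
  have "max R\<^sub>0 (exp 1) > 0" by (simp add: less_max_iff_disj)
  \<comment> \<open>The chaining bound was arranged to have the tail exp (- t^2), so the constant in
    the exponent is 1.\<close>
  with core c1(1) show ?thesis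
    by (intro exI[of _ c1] conjI exI[of _ "1::real"] exI[of _ "max R\<^sub>0 (exp 1)"] allI impI) auto
qed

end
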